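(* Let $\mathcal B$ be a finitely semisimple ribbon $\Bbbk$-category whose simple objects are scalar, with $\Lambda$, $\vee$, the coend $(B,j)$ and $(e_\lambda)_{\lambda\in\Lambda}$ as in the context. Let $\alpha=\sum_{\lambda\in\Lambda}\alpha_\lambda e_\lambda\in\mathrm{Hom}_{\mathcal B}(\mathbf 1,B)$, where $\alpha_\lambda\in\Bbbk$. Suppose that $\alpha\in\mathcal I(\mathcal B)$. Set $\Lambda_\alpha=\{\lambda\in\Lambda:\alpha_\lambda\neq0\}$. Then $$\alpha=\alpha_{\mathbf 1}\sum_{\lambda\in\Lambda_\alpha}\dim_q(\lambda)\,e_\lambda .$$ Moreover, $\Lambda_\alpha^\vee=\Lambda_\alpha$ and $m_B(\alpha\otimes e_\lambda)=\dim_q(\lambda)\,\alpha=m_B(e_\lambda\otimes\alpha)$ for all $\lambda\in\Lambda_\alpha$.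
   Context: **Ribbon $\Bbbk$-categories.** $\Bbbk$ is a field. Monoidal categories are taken strict. A ribbon category is a monoidal category with unit $\mathbf 1$, a left duality ($X^*$, $\mathrm{ev}_X:X^*\otimes X\to\mathbf 1$, $\mathrm{coev}_X:\mathbf 1\to X\otimes X^*$; $\mathbf 1^*=\mathbf 1$), a braiding $c_{X,Y}$, and a twist $\theta_X$ (natural isomorphisms with $\theta_{X\otimes Y}=c_{Y,X}c_{X,Y}(\theta_X\otimes\theta_Y)$ and $\theta_{X^*}=(\theta_X)^*$). A ribbon $\Bbbk$-category is a ribbon category whose Hom-sets are $\Bbbk$-vector spaces, with bilinear composition and tensor product, and with $\mathrm{End}(\mathbf 1)=\Bbbk$. Put $\widetilde{\mathrm{ev}}_X=\mathrm{ev}_X c_{X,X^*}(\theta_X\otimes\mathrm{id}_{X^*})$, $\widetilde{\mathrm{coev}}_X=(\mathrm{id}_{X^*}\otimes\theta_X^{-1})(c_{X^*,X})^{-1}\mathrm{coev}_X$, $\mathrm{tr}_q(f)=\widetilde{\mathrm{ev}}_X(f\otimes\mathrm{id}_{X^*})\mathrm{coev}_X\in\Bbbk$ for $f\in\mathrm{End}(X)$, $\dim_q(X)=\mathrm{tr}_q(\mathrm{id}_X)$. A morphism $f:X\to Y$ is negligible if $\mathrm{tr}_q(gf)=0$ for all $g:Y\to X$. **Coend and $\mathcal I$.** For a ribbon $\Bbbk$-category with a coend $(A,i)$ of $(X,Y)\mapsto X^*\otimes Y$ (universal dinatural family $i_X:X^*\otimes X\to A$), $A$ is a Hopf algebra with: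 $\Delta_A i_X=(i_X\otimes i_X)(\mathrm{id}\otimes\mathrm{coev}_X\otimes\mathrm{id})$; $\varepsilon_A i_X=\mathrm{ev}_X$; $\eta_A=i_{\mathbf 1}$; $m_A(i_X\otimes i_Y)=i_{Y\otimes X}(\gamma_{X,Y}\otimes\mathrm{id}_{Y\otimes X})(\mathrm{id}_{X^*}\otimes c_{X,Y^*\otimes Y})$ with $\gamma_{X,Y}:X^*\otimes Y^*\to(Y\otimes X)^*$ canonical; $S_A i_X=i_{X^*}(\beta_X\otimes\theta_{X^*})c_{X^*,X}$ with $\beta_X=(\widetilde{\mathrm{ev}}_X\otimes\mathrm{id}_{X^{**}})(\mathrm{id}_X\otimes\mathrm{coev}_{X^*})$. With $\Gamma_l=(\mathrm{id}_A\otimes m_A)(\Delta_A\otimes\mathrm{id}_A)$, $\mathcal I(\mathcal C)$ is the set of $\alpha\in\mathrm{Hom}(\mathbf 1,A)$ such that $S_A\alpha-\alpha$ and $\Gamma_l(\alpha\otimes\alpha)-\alpha\otimes\alpha$ are negligible. (In a semisimple ribbon $\Bbbk$-category negligible morphisms are zero, so these conditions read $S_A\alpha=\alpha$, $\Gamma_l(\alpha\otimes\alpha)=\alpha\otimes\alpha$.) **Finitely semisimple case.** A $\Bbbk$-category is finitely semisimple if it is abelian, every object is a finite direct sum of simple objects, and there are finitely many isomorphism classes of simple objects. An object $X$ is scalar if $\mathrm{End}(X)=\Bbbk$. $\Lambda$ is a (finite) set of representatives of isomorphism classes of simple objects of $\mathcal B$ with $\mathbf 1\in\Lambda$; $\lambda^\vee\in\Lambda$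 is the unique element with $\lambda^\vee\simeq\lambda^*$. $B=\bigoplus_{\lambda\in\Lambda}\lambda^*\otimes\lambda$ with projections $p_\lambda:B\to\lambda^*\otimes\lambda$ and injections $q_\lambda:\lambda^*\otimes\lambda\to B$. For an object $X\simeq\bigoplus_{k\in I}\lambda_k$ with projections $p_k:X\to\lambda_k$ and injections $q_k:\lambda_k\to X$ ($\lambda_k\in\Lambda$), set $j_X=\sum_k q_{\lambda_k}(q_k^*\otimes p_k):X^*\otimes X\to B$. Then $(B,j)$ is a coend of $(X,Y)\mapsto X^*\otimes Y$, $j_\lambda=q_\lambda$. Set $e_\lambda=j_\lambda\widetilde{\mathrm{coev}}_\lambda:\mathbf 1\to B$; these form a basis of $\mathrm{Hom}_{\mathcal B}(\mathbf 1,B)$. *)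

theory Defs
  imports "HOL-Algebra.Module"
begin

text \<open>
  A category is given by the type of its objects and the family of its Hom-sets inside a single type
  of morphisms; composition and the tensor product of morphisms are total functions that are only
  constrained on Hom-sets.  The Hom-sets need not be disjoint, so notions depending on source or
  target take these objects as arguments.  Every Hom-set is the carrier of a module over the field
  \<open>base C\<close>, i.e. of a vector space.
\<close>

section \<open>Linear categories\<close>

record ('o, 'm, 'k) linear_cat =
  base :: "'k ring"
  Hom :: "'o \<Rightarrow> 'o \<Rightarrow> ('k, 'm) module"
  ident :: "'o \<Rightarrow> 'm" (\<open>\<i>\<d>\<index>\<close>)
  compose :: "'m \<Rightarrow> 'm \<Rightarrow> 'm" (infixr \<open>\<cdot>\<index>\<close> 70)

locale linear_category =
  fixes C :: "('o, 'm, 'k, 'z) linear_cat_scheme" (structure)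
  assumes base_field: "field (base C)"
    and Hom_module: "module (base C) (Hom C X Y)"
    and ident_in_Hom: "\<i>\<d> X \<in> carrier (Hom C X X)"
    and compose_in_Hom:
      "\<lbrakk>f \<in> carrier (Hom C X Y); g \<in> carrier (Hom C Y Z)\<rbrakk> \<Longrightarrow> g \<cdot> f \<in> carrier (Hom C X Z)"
    and compose_assoc:
      "\<lbrakk>f \<in> carrier (Hom C W X); g \<in> carrier (Hom C X Y); h \<in> carrier (Hom C Y Z)\<rbrakk>
        \<Longrightarrow> (h \<cdot> g) \<cdot> f = h \<cdot> (g \<cdot> f)"
    and ident_left: "f \<in> carrier (Hom C X Y) \<Longrightarrow> \<i>\<d> Y \<cdot> f = f"
    and ident_right: "f \<in> carrier (Hom C X Y) \<Longrightarrow> f \<cdot> \<i>\<d> X = f"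
    and compose_add_left:
      "\<lbrakk>f \<in> carrier (Hom C X Y); g \<in> carrier (Hom C Y Z); h \<in> carrier (Hom C Y Z)\<rbrakk>
        \<Longrightarrow> (g \<oplus>\<^bsub>Hom C Y Z\<^esub> h) \<cdot> f = (g \<cdot> f) \<oplus>\<^bsub>Hom C X Z\<^esub> (h \<cdot> f)"
    and compose_add_right:
      "\<lbrakk>f \<in> carrier (Hom C X Y); g \<in> carrier (Hom C X Y); h \<in> carrier (Hom C Y Z)\<rbrakk>
        \<Longrightarrow> h \<cdot> (f \<oplus>\<^bsub>Hom C X Y\<^esub> g) = (h \<cdot> f) \<oplus>\<^bsub>Hom C X Z\<^esub> (h \<cdot> g)"
    and compose_smult_left:
      "\<lbrakk>a \<in> carrier (base C); f \<in> carrier (Hom C X Y); g \<in> carrier (Hom C Y Z)\<rbrakk>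
        \<Longrightarrow> (a \<odot>\<^bsub>Hom C Y Z\<^esub> g) \<cdot> f = a \<odot>\<^bsub>Hom C X Z\<^esub> (g \<cdot> f)"
    and compose_smult_right:
      "\<lbrakk>a \<in> carrier (base C); f \<in> carrier (Hom C X Y); g \<in> carrier (Hom C Y Z)\<rbrakk>
        \<Longrightarrow> g \<cdot> (a \<odot>\<^bsub>Hom C X Y\<^esub> f) = a \<odot>\<^bsub>Hom C X Z\<^esub> (g \<cdot> f)"

definition inverse_morphisms where
  "inverse_morphisms C X Y f g \<longleftrightarrow>
     f \<in> carrier (Hom C X Y) \<and> g \<in> carrier (Hom C Y X) \<and> g \<cdot> f = \<i>\<d> X \<and> f \<cdot> g = \<i>\<d> Y"
  for C :: "('o, 'm, 'k, 'z) linear_cat_scheme" (structure)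

definition is_iso where
  "is_iso C X Y f \<longleftrightarrow> (\<exists>g. inverse_morphisms C X Y f g)"
  for C :: "('o, 'm, 'k, 'z) linear_cat_scheme" (structure)

definition inverse_of where
  "inverse_of C X Y f = (THE g. inverse_morphisms C X Y f g)"
  for C :: "('o, 'm, 'k, 'z) linear_cat_scheme" (structure)

definition isomorphic where
  "isomorphic C X Y \<longleftrightarrow> (\<exists>f. is_iso C X Y f)"
  for C :: "('o, 'm, 'k, 'z) linear_cat_scheme" (structure)

text \<open>\<open>End(X) = \<k>\<close> means that \<open>a \<mapsto> a id\<^sub>X\<close> is a bijection from the field to \<open>End(X)\<close>.\<close>

definition scalar_object where
  "scalar_object C X \<longleftrightarrow>
     bij_betw (\<lambda>a. a \<odot>\<^bsub>Hom C X X\<^esub> \<i>\<d> X) (carrier (base C)) (carrier (Hom C X X))"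
  for C :: "('o, 'm, 'k, 'z) linear_cat_scheme" (structure)


section \<open>Finitely semisimple categories\<close>

definition direct_sum ::
    "('o, 'm, 'k, 'z) linear_cat_scheme \<Rightarrow> 'i set \<Rightarrow> ('i \<Rightarrow> 'o) \<Rightarrow> 'o \<Rightarrow> ('i \<Rightarrow> 'm) \<Rightarrow> ('i \<Rightarrow> 'm) \<Rightarrow> bool"
  where
  "direct_sum C I F X p q \<longleftrightarrow> finite I \<and>
     (\<forall>i\<in>I. p i \<in> carrier (Hom C X (F i)) \<and> q i \<in> carrier (Hom C (F i) X)) \<and>
     (\<forall>i\<in>I. \<forall>j\<in>I. p i \<cdot> q j = (if i = j then \<i>\<d> (F i) else \<zero>\<^bsub>Hom C (F j) (F i)\<^esub>)) \<and>
     (\<Oplus>\<^bsub>Hom C X X\<^esub>i\<in>I. q i \<cdot> p i) = \<i>\<d> X"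
  for C (structure)

definition zero_object where
  "zero_object C Z \<longleftrightarrow>
     (\<forall>X. (\<exists>!f. f \<in> carrier (Hom C X Z)) \<and> (\<exists>!f. f \<in> carrier (Hom C Z X)))"
  for C :: "('o, 'm, 'k, 'z) linear_cat_scheme" (structure)

definition monic where
  "monic C X Y f \<longleftrightarrow> f \<in> carrier (Hom C X Y) \<and>
     (\<forall>W. \<forall>g\<in>carrier (Hom C W X). \<forall>h\<in>carrier (Hom C W X). f \<cdot> g = f \<cdot> h \<longrightarrow> g = h)"
  for C :: "('o, 'm, 'k, 'z) linear_cat_scheme" (structure)

definition epic where
  "epic C X Y f \<longleftrightarrow> f \<in> carrier (Hom C X Y) \<and>
     (\<forall>W. \<forall>g\<in>carrier (Hom C Y W). \<forall>h\<in>carrier (Hom C Y W). g \<cdot> f = h \<cdot> f \<longrightarrow> g = h)"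
  for C :: "('o, 'm, 'k, 'z) linear_cat_scheme" (structure)

text \<open>\<open>k : N \<rightarrow> X\<close> is a kernel of \<open>f : X \<rightarrow> Y\<close>; \<open>k : Y \<rightarrow> N\<close> is a cokernel of \<open>f : X \<rightarrow> Y\<close>.\<close>

definition is_kernel where
  "is_kernel C X Y f N k \<longleftrightarrow>
     f \<in> carrier (Hom C X Y) \<and> k \<in> carrier (Hom C N X) \<and> f \<cdot> k = \<zero>\<^bsub>Hom C N Y\<^esub> \<and>
     (\<forall>W. \<forall>h\<in>carrier (Hom C W X). f \<cdot> h = \<zero>\<^bsub>Hom C W Y\<^esub> \<longrightarrow>
        (\<exists>!u. u \<in> carrier (Hom C W N) \<and> k \<cdot> u = h))"
  for C :: "('o, 'm, 'k, 'z) linear_cat_scheme" (structure)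

definition is_cokernel where
  "is_cokernel C X Y f N k \<longleftrightarrow>
     f \<in> carrier (Hom C X Y) \<and> k \<in> carrier (Hom C Y N) \<and> k \<cdot> f = \<zero>\<^bsub>Hom C X N\<^esub> \<and>
     (\<forall>W. \<forall>h\<in>carrier (Hom C Y W). h \<cdot> f = \<zero>\<^bsub>Hom C X W\<^esub> \<longrightarrow>
        (\<exists>!u. u \<in> carrier (Hom C N W) \<and> u \<cdot> k = h))"
  for C :: "('o, 'm, 'k, 'z) linear_cat_scheme" (structure)

definition abelian_category where
  "abelian_category C \<longleftrightarrow>
     (\<exists>Z. zero_object C Z) \<and>
     (\<forall>X Y. \<exists>S p q. direct_sum C (UNIV :: bool set) (\<lambda>b. if b then X else Y) S p q) \<and>
     (\<forall>X Y. \<forall>f\<in>carrier (Hom C X Y). \<exists>N k. is_kernel C X Y f N k) \<and>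
     (\<forall>X Y. \<forall>f\<in>carrier (Hom C X Y). \<exists>N k. is_cokernel C X Y f N k) \<and>
     (\<forall>X Y f. monic C X Y f \<longrightarrow> (\<exists>Z g. is_kernel C Y Z g X f)) \<and>
     (\<forall>X Y f. epic C X Y f \<longrightarrow> (\<exists>Z g. is_cokernel C Z X g Y f))"
  for C :: "('o, 'm, 'k, 'z) linear_cat_scheme" (structure)

definition simple_object where
  "simple_object C X \<longleftrightarrow> \<not> zero_object C X \<and>
     (\<forall>Y f. monic C Y X f \<longrightarrow> zero_object C Y \<or> is_iso C Y X f)"
  for C :: "('o, 'm, 'k, 'z) linear_cat_scheme" (structure)

definition finitely_semisimple where
  "finitely_semisimple C \<longleftrightarrow> abelian_category C \<and>
     (\<forall>X. \<exists>(n::nat) F p q. (\<forall>k<n. simple_object C (F k)) \<and> direct_sum C {..<n} F X p q) \<and>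
     (\<exists>S. finite S \<and> (\<forall>X. simple_object C X \<longrightarrow> (\<exists>Y\<in>S. isomorphic C X Y)))"
  for C :: "('o, 'm, 'k, 'z) linear_cat_scheme" (structure)

definition simple_representatives where
  "simple_representatives C L \<longleftrightarrow> (\<forall>l\<in>L. simple_object C l) \<and>
     (\<forall>X. simple_object C X \<longrightarrow> (\<exists>!l. l \<in> L \<and> isomorphic C X l))"
  for C :: "('o, 'm, 'k, 'z) linear_cat_scheme" (structure)


section \<open>Ribbon categories\<close>

record ('o, 'm, 'k) monoidal_cat = "('o, 'm, 'k) linear_cat" +
  unit_object :: "'o" (\<open>\<I>\<index>\<close>)
  tensor_ob :: "'o \<Rightarrow> 'o \<Rightarrow> 'o" (infixr \<open>\<otimes>\<^sub>o\<index>\<close> 76)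
  tensor_mor :: "'m \<Rightarrow> 'm \<Rightarrow> 'm" (infixr \<open>\<otimes>\<^sub>m\<index>\<close> 76)

text \<open>Strict monoidal categories with bilinear tensor product and \<open>End(\<I>) = \<k>\<close>.\<close>

locale strict_monoidal_linear_category = linear_category C
  for C :: "('o, 'm, 'k, 'z) monoidal_cat_scheme" (structure) +
  assumes tensor_ob_assoc: "(X \<otimes>\<^sub>o Y) \<otimes>\<^sub>o Z = X \<otimes>\<^sub>o (Y \<otimes>\<^sub>o Z)"
    and tensor_ob_unit_left: "\<I> \<otimes>\<^sub>o X = X"
    and tensor_ob_unit_right: "X \<otimes>\<^sub>o \<I> = X"
    and tensor_in_Hom:
      "\<lbrakk>f \<in> carrier (Hom C X Y); g \<in> carrier (Hom C X' Y')\<rbrakk>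
        \<Longrightarrow> f \<otimes>\<^sub>m g \<in> carrier (Hom C (X \<otimes>\<^sub>o X') (Y \<otimes>\<^sub>o Y'))"
    and tensor_ident: "\<i>\<d> X \<otimes>\<^sub>m \<i>\<d> Y = \<i>\<d> (X \<otimes>\<^sub>o Y)"
    and interchange:
      "\<lbrakk>f \<in> carrier (Hom C X Y); g \<in> carrier (Hom C Y Z);
        f' \<in> carrier (Hom C X' Y'); g' \<in> carrier (Hom C Y' Z')\<rbrakk>
        \<Longrightarrow> (g \<cdot> f) \<otimes>\<^sub>m (g' \<cdot> f') = (g \<otimes>\<^sub>m g') \<cdot> (f \<otimes>\<^sub>m f')"
    and tensor_assoc:
      "\<lbrakk>f \<in> carrier (Hom C X Y); g \<in> carrier (Hom C X' Y'); h \<in> carrier (Hom C X'' Y'')\<rbrakk>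
        \<Longrightarrow> (f \<otimes>\<^sub>m g) \<otimes>\<^sub>m h = f \<otimes>\<^sub>m (g \<otimes>\<^sub>m h)"
    and tensor_unit_left: "f \<in> carrier (Hom C X Y) \<Longrightarrow> \<i>\<d> \<I> \<otimes>\<^sub>m f = f"
    and tensor_unit_right: "f \<in> carrier (Hom C X Y) \<Longrightarrow> f \<otimes>\<^sub>m \<i>\<d> \<I> = f"
    and tensor_add_left:
      "\<lbrakk>f \<in> carrier (Hom C X Y); g \<in> carrier (Hom C X Y); h \<in> carrier (Hom C X' Y')\<rbrakk>
        \<Longrightarrow> (f \<oplus>\<^bsub>Hom C X Y\<^esub> g) \<otimes>\<^sub>m h
          = (f \<otimes>\<^sub>m h) \<oplus>\<^bsub>Hom C (X \<otimes>\<^sub>o X') (Y \<otimes>\<^sub>o Y')\<^esub> (g \<otimes>\<^sub>m h)"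
    and tensor_add_right:
      "\<lbrakk>f \<in> carrier (Hom C X Y); g \<in> carrier (Hom C X' Y'); h \<in> carrier (Hom C X' Y')\<rbrakk>
        \<Longrightarrow> f \<otimes>\<^sub>m (g \<oplus>\<^bsub>Hom C X' Y'\<^esub> h)
          = (f \<otimes>\<^sub>m g) \<oplus>\<^bsub>Hom C (X \<otimes>\<^sub>o X') (Y \<otimes>\<^sub>o Y')\<^esub> (f \<otimes>\<^sub>m h)"
    and tensor_smult_left:
      "\<lbrakk>a \<in> carrier (base C); f \<in> carrier (Hom C X Y); g \<in> carrier (Hom C X' Y')\<rbrakk>
        \<Longrightarrow> (a \<odot>\<^bsub>Hom C X Y\<^esub> f) \<otimes>\<^sub>m g
          = a \<odot>\<^bsub>Hom C (X \<otimes>\<^sub>o X') (Y \<otimes>\<^sub>o Y')\<^esub> (f \<otimes>\<^sub>m g)"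
    and tensor_smult_right:
      "\<lbrakk>a \<in> carrier (base C); f \<in> carrier (Hom C X Y); g \<in> carrier (Hom C X' Y')\<rbrakk>
        \<Longrightarrow> f \<otimes>\<^sub>m (a \<odot>\<^bsub>Hom C X' Y'\<^esub> g)
          = a \<odot>\<^bsub>Hom C (X \<otimes>\<^sub>o X') (Y \<otimes>\<^sub>o Y')\<^esub> (f \<otimes>\<^sub>m g)"
    and unit_scalar: "scalar_object C \<I>"

record ('o, 'm, 'k) ribbon_cat = "('o, 'm, 'k) monoidal_cat" +
  dual :: "'o \<Rightarrow> 'o" (\<open>(_\<^sup>\<star>\<index>)\<close> [1000] 999)
  ev :: "'o \<Rightarrow> 'm"
  coev :: "'o \<Rightarrow> 'm"
  braid :: "'o \<Rightarrow> 'o \<Rightarrow> 'm"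
  twist :: "'o \<Rightarrow> 'm"

text \<open>The dual \<open>f\<^sup>\<star> : Y\<^sup>\<star> \<rightarrow> X\<^sup>\<star>\<close> of \<open>f : X \<rightarrow> Y\<close>.\<close>

definition dual_mor where
  "dual_mor C X Y f =
     (ev C Y \<otimes>\<^sub>m \<i>\<d> (X\<^sup>\<star>)) \<cdot> (\<i>\<d> (Y\<^sup>\<star>) \<otimes>\<^sub>m f \<otimes>\<^sub>m \<i>\<d> (X\<^sup>\<star>)) \<cdot> (\<i>\<d> (Y\<^sup>\<star>) \<otimes>\<^sub>m coev C X)"
  for C :: "('o, 'm, 'k, 'z) ribbon_cat_scheme" (structure)

locale ribbon_linear_category = strict_monoidal_linear_category C
  for C :: "('o, 'm, 'k, 'z) ribbon_cat_scheme" (structure) +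
  assumes ev_in_Hom: "ev C X \<in> carrier (Hom C (X\<^sup>\<star> \<otimes>\<^sub>o X) \<I>)"
    and coev_in_Hom: "coev C X \<in> carrier (Hom C \<I> (X \<otimes>\<^sub>o X\<^sup>\<star>))"
    and zigzag: "(\<i>\<d> X \<otimes>\<^sub>m ev C X) \<cdot> (coev C X \<otimes>\<^sub>m \<i>\<d> X) = \<i>\<d> X"
    and zigzag_dual: "(ev C X \<otimes>\<^sub>m \<i>\<d> (X\<^sup>\<star>)) \<cdot> (\<i>\<d> (X\<^sup>\<star>) \<otimes>\<^sub>m coev C X) = \<i>\<d> (X\<^sup>\<star>)"
    and dual_unit: "\<I>\<^sup>\<star> = \<I>"
    and braid_iso: "is_iso C (X \<otimes>\<^sub>o Y) (Y \<otimes>\<^sub>o X) (braid C X Y)"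
    and braid_natural:
      "\<lbrakk>f \<in> carrier (Hom C X X'); g \<in> carrier (Hom C Y Y')\<rbrakk>
        \<Longrightarrow> braid C X' Y' \<cdot> (f \<otimes>\<^sub>m g) = (g \<otimes>\<^sub>m f) \<cdot> braid C X Y"
    and braid_tensor_right:
      "braid C X (Y \<otimes>\<^sub>o Z) = (\<i>\<d> Y \<otimes>\<^sub>m braid C X Z) \<cdot> (braid C X Y \<otimes>\<^sub>m \<i>\<d> Z)"
    and braid_tensor_left:
      "braid C (X \<otimes>\<^sub>o Y) Z = (braid C X Z \<otimes>\<^sub>m \<i>\<d> Y) \<cdot> (\<i>\<d> X \<otimes>\<^sub>m braid C Y Z)"
    and twist_iso: "is_iso C X X (twist C X)"
    and twist_natural: "f \<in> carrier (Hom C X Y) \<Longrightarrow> twist C Y \<cdot> f = f \<cdot> twist C X"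
    and twist_tensor:
      "twist C (X \<otimes>\<^sub>o Y) = braid C Y X \<cdot> braid C X Y \<cdot> (twist C X \<otimes>\<^sub>m twist C Y)"
    and twist_dual: "twist C (X\<^sup>\<star>) = dual_mor C X X (twist C X)"

definition evt where
  "evt C X = ev C X \<cdot> braid C X (X\<^sup>\<star>) \<cdot> (twist C X \<otimes>\<^sub>m \<i>\<d> (X\<^sup>\<star>))"
  for C :: "('o, 'm, 'k, 'z) ribbon_cat_scheme" (structure)

definition coevt where
  "coevt C X =
     (\<i>\<d> (X\<^sup>\<star>) \<otimes>\<^sub>m inverse_of C X X (twist C X)) \<cdot>
     inverse_of C (X\<^sup>\<star> \<otimes>\<^sub>o X) (X \<otimes>\<^sub>o X\<^sup>\<star>) (braid C (X\<^sup>\<star>) X) \<cdot> coev C X"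
  for C :: "('o, 'm, 'k, 'z) ribbon_cat_scheme" (structure)

definition tr_q where
  "tr_q C X f = (THE a. a \<in> carrier (base C) \<and>
     evt C X \<cdot> (f \<otimes>\<^sub>m \<i>\<d> (X\<^sup>\<star>)) \<cdot> coev C X = a \<odot>\<^bsub>Hom C \<I> \<I>\<^esub> \<i>\<d> \<I>)"
  for C :: "('o, 'm, 'k, 'z) ribbon_cat_scheme" (structure)

definition dim_q where
  "dim_q C X = tr_q C X (\<i>\<d> X)"
  for C :: "('o, 'm, 'k, 'z) ribbon_cat_scheme" (structure)

definition negligible where
  "negligible C X Y f \<longleftrightarrow> f \<in> carrier (Hom C X Y) \<and>
     (\<forall>g\<in>carrier (Hom C Y X). tr_q C X (g \<cdot> f) = \<zero>\<^bsub>base C\<^esub>)"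
  for C :: "('o, 'm, 'k, 'z) ribbon_cat_scheme" (structure)


section \<open>The coend and the set \<open>\<I>(C)\<close>\<close>

definition dinatural where
  "dinatural C Z d \<longleftrightarrow> (\<forall>X. d X \<in> carrier (Hom C (X\<^sup>\<star> \<otimes>\<^sub>o X) Z)) \<and>
     (\<forall>X Y. \<forall>f\<in>carrier (Hom C X Y).
        d X \<cdot> (dual_mor C X Y f \<otimes>\<^sub>m \<i>\<d> X) = d Y \<cdot> (\<i>\<d> (Y\<^sup>\<star>) \<otimes>\<^sub>m f))"
  for C :: "('o, 'm, 'k, 'z) ribbon_cat_scheme" (structure)

definition is_coend where
  "is_coend C A i \<longleftrightarrow> dinatural C A i \<and>
     (\<forall>Z d. dinatural C Z d \<longrightarrow>
        (\<exists>!r. r \<in> carrier (Hom C A Z) \<and> (\<forall>X. r \<cdot> i X = d X)))"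
  for C :: "('o, 'm, 'k, 'z) ribbon_cat_scheme" (structure)

definition coend_factor where
  "coend_factor C A i Z d = (THE r. r \<in> carrier (Hom C A Z) \<and> (\<forall>X. r \<cdot> i X = d X))"
  for C :: "('o, 'm, 'k, 'z) ribbon_cat_scheme" (structure)

lemma coend_factor:
  fixes C :: "('o, 'm, 'k, 'z) ribbon_cat_scheme" (structure)
  assumes "is_coend C A i" and "dinatural C Z d"
  shows "coend_factor C A i Z d \<in> carrier (Hom C A Z)" and "coend_factor C A i Z d \<cdot> i X = d X"
proof -
  have "\<exists>!r. r \<in> carrier (Hom C A Z) \<and> (\<forall>X. r \<cdot> i X = d X)"
    using assms unfolding is_coend_def by blast
  from theI'[OF this]
  show "coend_factor C A i Z d \<in> carrier (Hom C A Z)" and "coend_factor C A i Z d \<cdot> i X = d X"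
    unfolding coend_factor_def by blast+
qed

text \<open>
  \<open>\<gamma>\<^sub>X\<^sub>,\<^sub>Y : X\<^sup>\<star> \<otimes> Y\<^sup>\<star> \<rightarrow> (Y \<otimes> X)\<^sup>\<star>\<close> is the canonical isomorphism, characterised by
  \<open>ev\<^sub>Y\<^sub>\<otimes>\<^sub>X (\<gamma> \<otimes> id) = ev\<^sub>X (id \<otimes> ev\<^sub>Y \<otimes> id)\<close>.
\<close>

definition gamma_mor where
  "gamma_mor C X Y =
     ((ev C X \<cdot> (\<i>\<d> (X\<^sup>\<star>) \<otimes>\<^sub>m ev C Y \<otimes>\<^sub>m \<i>\<d> X)) \<otimes>\<^sub>m \<i>\<d> ((Y \<otimes>\<^sub>o X)\<^sup>\<star>)) \<cdot>
     (\<i>\<d> (X\<^sup>\<star> \<otimes>\<^sub>o Y\<^sup>\<star>) \<otimes>\<^sub>m coev C (Y \<otimes>\<^sub>o X))"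
  for C :: "('o, 'm, 'k, 'z) ribbon_cat_scheme" (structure)

definition beta_mor where
  "beta_mor C X = (evt C X \<otimes>\<^sub>m \<i>\<d> ((X\<^sup>\<star>)\<^sup>\<star>)) \<cdot> (\<i>\<d> X \<otimes>\<^sub>m coev C (X\<^sup>\<star>))"
  for C :: "('o, 'm, 'k, 'z) ribbon_cat_scheme" (structure)

definition coend_comult where
  "coend_comult C A i = coend_factor C A i (A \<otimes>\<^sub>o A)
     (\<lambda>X. (i X \<otimes>\<^sub>m i X) \<cdot> (\<i>\<d> (X\<^sup>\<star>) \<otimes>\<^sub>m coev C X \<otimes>\<^sub>m \<i>\<d> X))"
  for C :: "('o, 'm, 'k, 'z) ribbon_cat_scheme" (structure)

definition coend_mult where
  "coend_mult C A i = (THE m. m \<in> carrier (Hom C (A \<otimes>\<^sub>o A) A) \<and>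
     (\<forall>X Y. m \<cdot> (i X \<otimes>\<^sub>m i Y) =
        i (Y \<otimes>\<^sub>o X) \<cdot> (gamma_mor C X Y \<otimes>\<^sub>m \<i>\<d> (Y \<otimes>\<^sub>o X)) \<cdot>
        (\<i>\<d> (X\<^sup>\<star>) \<otimes>\<^sub>m braid C X (Y\<^sup>\<star> \<otimes>\<^sub>o Y))))"
  for C :: "('o, 'm, 'k, 'z) ribbon_cat_scheme" (structure)

definition coend_antipode where
  "coend_antipode C A i = coend_factor C A i A
     (\<lambda>X. i (X\<^sup>\<star>) \<cdot> (beta_mor C X \<otimes>\<^sub>m twist C (X\<^sup>\<star>)) \<cdot> braid C (X\<^sup>\<star>) X)"
  for C :: "('o, 'm, 'k, 'z) ribbon_cat_scheme" (structure)

definition Gamma_l where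
  "Gamma_l C A i = (\<i>\<d> A \<otimes>\<^sub>m coend_mult C A i) \<cdot> (coend_comult C A i \<otimes>\<^sub>m \<i>\<d> A)"
  for C :: "('o, 'm, 'k, 'z) ribbon_cat_scheme" (structure)

text \<open>The set \<open>\<I>(C)\<close>, computed with the coend \<open>(A, i)\<close>.\<close>

definition I_set where
  "I_set C A i = {\<alpha> \<in> carrier (Hom C \<I> A).
     negligible C \<I> A ((coend_antipode C A i \<cdot> \<alpha>) \<ominus>\<^bsub>Hom C \<I> A\<^esub> \<alpha>) \<and>
     negligible C \<I> (A \<otimes>\<^sub>o A)
       ((Gamma_l C A i \<cdot> (\<alpha> \<otimes>\<^sub>m \<alpha>)) \<ominus>\<^bsub>Hom C \<I> (A \<otimes>\<^sub>o A)\<^esub> (\<alpha> \<otimes>\<^sub>m \<alpha>))}"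
  for C :: "('o, 'm, 'k, 'z) ribbon_cat_scheme" (structure)


section \<open>The coend of a finitely semisimple ribbon category\<close>

text \<open>
  For \<open>B = \<Oplus>\<^sub>\<lambda> \<lambda>\<^sup>\<star> \<otimes> \<lambda>\<close> with injections \<open>q\<close>, \<open>j\<^sub>X = \<Sum>\<^sub>k q\<^bsub>\<lambda>\<^sub>k\<^esub> (q'\<^sub>k\<^sup>\<star> \<otimes> p'\<^sub>k)\<close>, computed from some decomposition of
  \<open>X\<close> as a direct sum of objects \<open>\<lambda>\<^sub>k \<in> \<Lambda>\<close>.  When the simple objects are scalar, the sum does not
  depend on the decomposition.
\<close>

definition ss_coend_map where
  "ss_coend_map C L B q X = (SOME h. \<exists>(n::nat) l p' q'.
     (\<forall>k<n. l k \<in> L) \<and> direct_sum C {..<n} l X p' q' \<and>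
     h = (\<Oplus>\<^bsub>Hom C (X\<^sup>\<star> \<otimes>\<^sub>o X) B\<^esub>k\<in>{..<n}. q (l k) \<cdot> (dual_mor C (l k) X (q' k) \<otimes>\<^sub>m p' k)))"
  for C :: "('o, 'm, 'k, 'z) ribbon_cat_scheme" (structure)

definition ss_basis where
  "ss_basis C L B q l = ss_coend_map C L B q l \<cdot> coevt C l"
  for C :: "('o, 'm, 'k, 'z) ribbon_cat_scheme" (structure)

definition vee where
  "vee C L l = (THE k. k \<in> L \<and> isomorphic C k (l\<^sup>\<star>))"
  for C :: "('o, 'm, 'k, 'z) ribbon_cat_scheme" (structure)

end

theory Submission
  imports Defs
begin

text \<open>
  For every object \<open>X\<close> put \<open>e\<^sub>X = j\<^sub>X coevt\<^sub>X : \<I> \<rightarrow> B\<close>.  By dinaturality of \<open>j\<close> the assignment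
  \<open>f \<mapsto> j\<^sub>X (id \<otimes> f) coevt\<^sub>X\<close> on endomorphisms is cyclic, so \<open>e\<^sub>X\<close> depends only on the isomorphism class
  of \<open>X\<close> and is additive on direct sums (\<open>E_isomorphic\<close>, \<open>E_dsum\<close>).  The structure maps act on these
  elements as on the Grothendieck ring: \<open>m (e\<^sub>X \<otimes> e\<^sub>Y) = e\<^bsub>Y \<otimes> X\<^esub>\<close> and \<open>S e\<^sub>X = e\<^bsub>X\<^sup>\<star>\<^esub>\<close> (\<open>MULT_E\<close>, \<open>ANTI_E\<close>).
  In particular the product of two such elements is commutative, because \<open>X \<otimes> Y\<close> and \<open>Y \<otimes> X\<close> are
  isomorphic through the braiding.

  Let \<open>\<alpha> = \<Sum> a\<^sub>l e\<^sub>l\<close> satisfy the two invariance conditions, which are equations since a negligible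
  morphism out of the simple object \<open>\<I>\<close> vanishes.  Project \<open>\<Gamma>\<^sub>l(\<alpha> \<otimes> \<alpha>) = \<alpha> \<otimes> \<alpha>\<close> to the summand \<open>l\<^sup>\<star> \<otimes> l\<close> of
  the first factor \<open>B\<close>.  Both sides acquire the factor \<open>a\<^sub>l\<close>; if it is nonzero it cancels, and bending the
  strands \<open>l\<^sup>\<star>\<close> and \<open>l\<close> with the two dualities leaves \<open>m (j\<^sub>l \<otimes> \<alpha>) = \<alpha> ev\<^sub>l\<close> (\<open>MULT_J_A\<close>).  Composition with
  \<open>coevt\<^sub>l\<close> turns this into \<open>m (e\<^sub>l \<otimes> \<alpha>) = dim\<^sub>q(l) \<alpha>\<close>.

  Compare the coefficients of \<open>e\<^sub>\<I>\<close> in the last equation.  On the left, \<open>m (e\<^sub>l \<otimes> \<alpha>) = \<Sum> a\<^sub>k e\<^bsub>k \<otimes> l\<^esub>\<close>, and by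
  Schur's lemma \<open>\<I>\<close> is a summand of \<open>k \<otimes> l\<close> exactly once if \<open>k = l\<^sup>\<or>\<close> and not at all otherwise
  (\<open>PB_unit_E_tensor\<close>).  Hence \<open>a\<^bsub>l\<^sup>\<or>\<^esub> = dim\<^sub>q(l) a\<^sub>\<I>\<close>.  The condition \<open>S \<alpha> = \<alpha>\<close> says \<open>a\<^bsub>l\<^sup>\<or>\<^esub> = a\<^sub>l\<close>, so the support of
  \<open>a\<close> is stable under \<open>\<or>\<close> and \<open>a\<^sub>l = dim\<^sub>q(l) a\<^sub>\<I>\<close> on it.

  Before these few lines make sense, \<open>(B, j)\<close> must be shown to be a coend with a well-defined product,
  and the right duality \<open>(evt, coevt)\<close> must be shown to satisfy the zigzag identities and to be compatible
  with \<open>\<beta>\<close>, \<open>\<gamma>\<close>, the braiding and the twist.  These are string diagram computations, carried out with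
  arrows that remember their source and target.
\<close>

section \<open>Arrows with source and target\<close>

text \<open>
  The Hom-sets of a category are families indexed by two objects, so a bare morphism determines neither
  its source nor its target, and rewriting with the associativity or interchange law would have to guess
  them.  An arrow carries both.  The value \<open>None\<close> marks an ill-typed composite: its source and target are
  still defined, which makes \<open>src\<close> and \<open>tgt\<close> of a composite unconditional simplification rules and
  composition associative without any premise.
\<close>

datatype ('o, 'm) arrow = Arrow (src: 'o) (mor: "'m option") (tgt: 'o)

definition raw :: "('o, 'm) arrow \<Rightarrow> 'm" where
  "raw f = the (mor f)"

context linear_category
begin

sublocale Hom: module "base C" "Hom C X Y" for X Y
  by (rule Hom_module)

definition arrow :: "'o \<Rightarrow> 'm \<Rightarrow> 'o \<Rightarrow> ('o, 'm) arrow" where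
  "arrow X m Y = Arrow X (if m \<in> carrier (Hom C X Y) then Some m else None) Y"

text \<open>
  The carrier condition is part of the predicate because \<open>Arrow X (Some m) Y\<close> can be formed for every \<open>m\<close>.
\<close>

definition arr :: "('o, 'm) arrow \<Rightarrow> bool" where
  "arr f \<longleftrightarrow> (\<exists>m\<in>carrier (Hom C (src f) (tgt f)). mor f = Some m)"

definition homset :: "'o \<Rightarrow> 'o \<Rightarrow> ('o, 'm) arrow set" where
  "homset X Y = {f. arr f \<and> src f = X \<and> tgt f = Y}"

definition Id :: "'o \<Rightarrow> ('o, 'm) arrow" where
  "Id X = arrow X (\<i>\<d> X) X"

definition comp :: "('o, 'm) arrow \<Rightarrow> ('o, 'm) arrow \<Rightarrow> ('o, 'm) arrow" (infixr \<open>\<bullet>\<close> 70) where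
  "g \<bullet> f = Arrow (src f)
     (if arr f \<and> arr g \<and> src g = tgt f then Some (raw g \<cdot> raw f) else None) (tgt g)"

definition Zero :: "'o \<Rightarrow> 'o \<Rightarrow> ('o, 'm) arrow" where
  "Zero X Y = arrow X \<zero>\<^bsub>Hom C X Y\<^esub> Y"

definition scale :: "'k \<Rightarrow> ('o, 'm) arrow \<Rightarrow> ('o, 'm) arrow" where
  "scale a f = arrow (src f) (a \<odot>\<^bsub>Hom C (src f) (tgt f)\<^esub> raw f) (tgt f)"

definition Sum :: "'o \<Rightarrow> 'o \<Rightarrow> ('i \<Rightarrow> ('o, 'm) arrow) \<Rightarrow> 'i set \<Rightarrow> ('o, 'm) arrow" where
  "Sum X Y F I = arrow X (\<Oplus>\<^bsub>Hom C X Y\<^esub>i\<in>I. raw (F i)) Y"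

lemma src_tgt [simp]:
  "src (arrow X m Y) = X" "tgt (arrow X m Y) = Y" "src (Id X) = X" "tgt (Id X) = X"
  "src (g \<bullet> f) = src f" "tgt (g \<bullet> f) = tgt g"
  "src (Zero X Y) = X" "tgt (Zero X Y) = Y" "src (scale a f) = src f" "tgt (scale a f) = tgt f"
  "src (Sum X Y F I) = X" "tgt (Sum X Y F I) = Y"
  by (simp_all add: arrow_def Id_def comp_def Zero_def scale_def Sum_def)

lemma raw_in_Hom: "arr f \<Longrightarrow> raw f \<in> carrier (Hom C (src f) (tgt f))"
  by (auto simp: arr_def raw_def)

lemma raw_in_Hom': "f \<in> homset X Y \<Longrightarrow> raw f \<in> carrier (Hom C X Y)"
  using raw_in_Hom by (auto simp: homset_def)

lemma arrow_raw: "arr f \<Longrightarrow> arrow (src f) (raw f) (tgt f) = f"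
  by (cases f) (auto simp: arr_def raw_def arrow_def)

lemma arr_arrow [simp]: "arr (arrow X m Y) \<longleftrightarrow> m \<in> carrier (Hom C X Y)"
  by (auto simp: arr_def arrow_def)

lemma arr_Arrow [simp]:
  "\<not> arr (Arrow X None Y)" "arr (Arrow X (Some m) Y) \<longleftrightarrow> m \<in> carrier (Hom C X Y)"
  by (simp_all add: arr_def)

lemma raw_arrow [simp]: "m \<in> carrier (Hom C X Y) \<Longrightarrow> raw (arrow X m Y) = m"
  by (simp add: raw_def arrow_def)

lemma arr_Id [simp]: "arr (Id X)"
  by (simp add: Id_def ident_in_Hom)

lemma raw_Id: "raw (Id X) = \<i>\<d> X"
  by (simp add: Id_def ident_in_Hom)

lemma arr_comp [simp]: "arr (g \<bullet> f) \<longleftrightarrow> arr f \<and> arr g \<and> src g = tgt f"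
proof (cases "arr f \<and> arr g \<and> src g = tgt f")
  case True
  then have "raw g \<cdot> raw f \<in> carrier (Hom C (src f) (tgt g))"
    using raw_in_Hom[of f] raw_in_Hom[of g] by (metis compose_in_Hom)
  moreover have "mor (g \<bullet> f) = Some (raw g \<cdot> raw f)" "src (g \<bullet> f) = src f" "tgt (g \<bullet> f) = tgt g"
    using True by (simp_all add: comp_def)
  ultimately have "arr (g \<bullet> f)" unfolding arr_def[of "g \<bullet> f"] by metis
  with True show ?thesis by simp
next
  case False
  then have "mor (g \<bullet> f) = None" by (auto simp: comp_def)
  then have "\<not> arr (g \<bullet> f)" by (auto simp: arr_def)
  with False show ?thesis by blast
qed

lemma comp_not_arr: "\<not> arr (g \<bullet> f) \<Longrightarrow> g \<bullet> f = Arrow (src f) None (tgt g)"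
  unfolding arr_comp by (rule arrow.expand) (auto simp: comp_def)

lemma raw_comp: "arr f \<Longrightarrow> arr g \<Longrightarrow> src g = tgt f \<Longrightarrow> raw (g \<bullet> f) = raw g \<cdot> raw f"
  by (simp add: raw_def comp_def)

lemma homsetI: "arr f \<Longrightarrow> src f = X \<Longrightarrow> tgt f = Y \<Longrightarrow> f \<in> homset X Y"
  by (simp add: homset_def)

lemma homsetD [dest]:
  assumes "f \<in> homset X Y" shows "arr f" and "src f = X" and "tgt f = Y"
  using assms by (simp_all add: homset_def)

lemma arrow_eqI:
  assumes "arr f" "arr g" "src f = src g" "tgt f = tgt g" "raw f = raw g"
  shows "f = g"
  using arrow_raw[OF assms(1)] arrow_raw[OF assms(2)] assms(3-5) by metis

lemma homset_arrow: "m \<in> carrier (Hom C X Y) \<Longrightarrow> arrow X m Y \<in> homset X Y"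
  by (simp add: homset_def)

lemma arrow_eq_iff:
  "m \<in> carrier (Hom C X Y) \<Longrightarrow> n \<in> carrier (Hom C X Y) \<Longrightarrow>
    arrow X m Y = arrow X n Y \<longleftrightarrow> m = n"
  by (metis raw_arrow)

lemma comp_arrow [simp]:
  "m \<in> carrier (Hom C X Y) \<Longrightarrow> n \<in> carrier (Hom C Y Z) \<Longrightarrow>
    arrow Y n Z \<bullet> arrow X m Y = arrow X (n \<cdot> m) Z"
  by (rule arrow_eqI) (simp_all add: raw_comp compose_in_Hom)

lemma comp_assoc [simp]: "(h \<bullet> g) \<bullet> f = h \<bullet> (g \<bullet> f)"
proof (cases "arr f \<and> arr g \<and> arr h \<and> src g = tgt f \<and> src h = tgt g")
  case True
  then show ?thesis
    using compose_assoc[of "raw f" "src f" "tgt f" "raw g" "tgt g" "raw h" "tgt h"]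
      raw_in_Hom[of f] raw_in_Hom[of g] raw_in_Hom[of h]
    by (intro arrow_eqI) (simp_all add: raw_comp)
next
  case False
  then have "\<not> arr ((h \<bullet> g) \<bullet> f)" "\<not> arr (h \<bullet> (g \<bullet> f))" by auto
  then show ?thesis by (metis comp_not_arr src_tgt(5,6))
qed

lemma comp_Id_left [simp]: "arr f \<Longrightarrow> tgt f = X \<Longrightarrow> Id X \<bullet> f = f"
  using raw_in_Hom[of f] ident_left by (intro arrow_eqI) (auto simp: raw_comp raw_Id)

lemma comp_Id_right [simp]: "arr f \<Longrightarrow> src f = X \<Longrightarrow> f \<bullet> Id X = f"
  using raw_in_Hom[of f] ident_right by (intro arrow_eqI) (auto simp: raw_comp raw_Id)

lemma comp_Id_left' [simp]: "arr g \<Longrightarrow> tgt g = X \<Longrightarrow> Id X \<bullet> (g \<bullet> f) = g \<bullet> f"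
  by (metis comp_Id_left comp_assoc)

text \<open>
  Composites are kept nested to the right, so the composite \<open>l \<bullet> l'\<close> of two adjacent layers of a diagram
  is usually hidden inside \<open>l \<bullet> (l' \<bullet> h)\<close>.  These rules lift a local equation to such a position.
\<close>

lemma reassoc: "l \<bullet> l' = r \<Longrightarrow> l \<bullet> (l' \<bullet> h) = r \<bullet> h"
  using comp_assoc by metis

lemma reassoc3: "l \<bullet> l' \<bullet> l'' = r \<Longrightarrow> l \<bullet> (l' \<bullet> (l'' \<bullet> h)) = r \<bullet> h"
  using comp_assoc by metis

section \<open>Sums and scalar multiples of arrows\<close>

lemma compose_zero_right:
  assumes h: "h \<in> carrier (Hom C Y Z)"
  shows "h \<cdot> \<zero>\<^bsub>Hom C X Y\<^esub> = \<zero>\<^bsub>Hom C X Z\<^esub>"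
proof -
  have "\<zero>\<^bsub>base C\<^esub> \<odot>\<^bsub>Hom C X Y\<^esub> \<zero>\<^bsub>Hom C X Y\<^esub> = \<zero>\<^bsub>Hom C X Y\<^esub>" by simp
  then show ?thesis
    using compose_smult_right[of "\<zero>\<^bsub>base C\<^esub>" "\<zero>\<^bsub>Hom C X Y\<^esub>" X Y h Z] h
      compose_in_Hom[of "\<zero>\<^bsub>Hom C X Y\<^esub>" X Y h Z]
    by simp
qed

lemma compose_zero_left:
  assumes h: "h \<in> carrier (Hom C X Y)"
  shows "\<zero>\<^bsub>Hom C Y Z\<^esub> \<cdot> h = \<zero>\<^bsub>Hom C X Z\<^esub>"
proof -
  have "\<zero>\<^bsub>base C\<^esub> \<odot>\<^bsub>Hom C Y Z\<^esub> \<zero>\<^bsub>Hom C Y Z\<^esub> = \<zero>\<^bsub>Hom C Y Z\<^esub>" by simp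
  then show ?thesis
    using compose_smult_left[of "\<zero>\<^bsub>base C\<^esub>" h X Y "\<zero>\<^bsub>Hom C Y Z\<^esub>" Z] h
      compose_in_Hom[of h X Y "\<zero>\<^bsub>Hom C Y Z\<^esub>" Z]
    by simp
qed

text \<open>
  To be applied to composition and to tensoring with a fixed morphism.  An additive map between groups
  respects \<open>0\<close>, hence finite sums.
\<close>

lemma additive_finsum:
  assumes closed: "\<And>x. x \<in> carrier (Hom C X Y) \<Longrightarrow> \<phi> x \<in> carrier (Hom C X' Y')"
    and add: "\<And>x y. x \<in> carrier (Hom C X Y) \<Longrightarrow> y \<in> carrier (Hom C X Y) \<Longrightarrow>
      \<phi> (x \<oplus>\<^bsub>Hom C X Y\<^esub> y) = \<phi> x \<oplus>\<^bsub>Hom C X' Y'\<^esub> \<phi> y"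
    and F: "\<And>i. i \<in> I \<Longrightarrow> F i \<in> carrier (Hom C X Y)"
  shows "\<phi> (\<Oplus>\<^bsub>Hom C X Y\<^esub>i\<in>I. F i) = (\<Oplus>\<^bsub>Hom C X' Y'\<^esub>i\<in>I. \<phi> (F i))"
proof -
  have "\<phi> \<zero>\<^bsub>Hom C X Y\<^esub> \<oplus>\<^bsub>Hom C X' Y'\<^esub> \<phi> \<zero>\<^bsub>Hom C X Y\<^esub> = \<phi> \<zero>\<^bsub>Hom C X Y\<^esub>"
    using add[of "\<zero>\<^bsub>Hom C X Y\<^esub>" "\<zero>\<^bsub>Hom C X Y\<^esub>"] by simp
  then have zero: "\<phi> \<zero>\<^bsub>Hom C X Y\<^esub> = \<zero>\<^bsub>Hom C X' Y'\<^esub>"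
    using closed[of "\<zero>\<^bsub>Hom C X Y\<^esub>"] by (simp add: Hom.M.add.l_cancel_one)
  show ?thesis
    using F
  proof (induction I rule: infinite_finite_induct)
    case (infinite I)
    then show ?case by (simp add: zero Hom.M.finsum_infinite)
  next
    case empty
    then show ?case by (simp add: zero)
  next
    case (insert i I)
    then show ?case
      using closed add by (simp add: Hom.M.finsum_insert Pi_def Hom.M.finsum_closed)
  qed
qed

lemma Sum_in_homset [simp]:
  assumes "\<And>i. i \<in> I \<Longrightarrow> F i \<in> homset X Y"
  shows "arr (Sum X Y F I)"
  using raw_in_Hom'[OF assms] by (simp add: Sum_def Pi_def Hom.M.finsum_closed)

lemma raw_Sum:
  assumes "\<And>i. i \<in> I \<Longrightarrow> F i \<in> homset X Y"
  shows "raw (Sum X Y F I) = (\<Oplus>\<^bsub>Hom C X Y\<^esub>i\<in>I. raw (F i))"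
  using raw_in_Hom'[OF assms] by (simp add: Sum_def Pi_def Hom.M.finsum_closed)

lemma Sum_cong:
  assumes "\<And>i. i \<in> I \<Longrightarrow> F i = G i" and "\<And>i. i \<in> I \<Longrightarrow> F i \<in> homset X Y"
  shows "Sum X Y F I = Sum X Y G I"
proof -
  have "(\<Oplus>\<^bsub>Hom C X Y\<^esub>i\<in>I. raw (F i)) = (\<Oplus>\<^bsub>Hom C X Y\<^esub>i\<in>I. raw (G i))"
    using assms raw_in_Hom' by (intro Hom.M.finsum_cong') (auto simp: Pi_def)
  then show ?thesis by (simp add: Sum_def)
qed

lemma arr_Zero [simp]: "arr (Zero X Y)"
  by (simp add: Zero_def)

lemma raw_Zero: "raw (Zero X Y) = \<zero>\<^bsub>Hom C X Y\<^esub>"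
  by (simp add: Zero_def)

lemma arr_scale [simp]: "arr f \<Longrightarrow> a \<in> carrier (base C) \<Longrightarrow> arr (scale a f)"
  by (simp add: scale_def raw_in_Hom)

lemma raw_scale:
  "arr f \<Longrightarrow> a \<in> carrier (base C) \<Longrightarrow> raw (scale a f) = a \<odot>\<^bsub>Hom C (src f) (tgt f)\<^esub> raw f"
  by (simp add: scale_def raw_in_Hom)

lemma comp_Sum:
  assumes "arr h" "src h = Y" and "\<And>i. i \<in> I \<Longrightarrow> F i \<in> homset X Y"
  shows "h \<bullet> Sum X Y F I = Sum X (tgt h) (\<lambda>i. h \<bullet> F i) I"
proof (rule arrow_eqI)
  have H: "\<And>i. i \<in> I \<Longrightarrow> h \<bullet> F i \<in> homset X (tgt h)"
    using assms by (force simp: homset_def)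
  note h = raw_in_Hom[OF assms(1), unfolded assms(2)]
  show "raw (h \<bullet> Sum X Y F I) = raw (Sum X (tgt h) (\<lambda>i. h \<bullet> F i) I)"
  proof -
    have "raw (h \<bullet> Sum X Y F I) = raw h \<cdot> (\<Oplus>\<^bsub>Hom C X Y\<^esub>i\<in>I. raw (F i))"
      using assms by (simp add: raw_comp raw_Sum)
    also have "\<dots> = (\<Oplus>\<^bsub>Hom C X (tgt h)\<^esub>i\<in>I. raw h \<cdot> raw (F i))"
      using h raw_in_Hom'[OF assms(3)] compose_add_right compose_in_Hom
      by (intro additive_finsum[where \<phi> = "\<lambda>x. raw h \<cdot> x"]) auto
    also have "\<dots> = (\<Oplus>\<^bsub>Hom C X (tgt h)\<^esub>i\<in>I. raw (h \<bullet> F i))"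
      using assms H raw_in_Hom'[OF H]
      by (intro Hom.M.finsum_cong') (auto simp: raw_comp homset_def)
    finally show ?thesis using H by (simp add: raw_Sum)
  qed
  show "arr (Sum X (tgt h) (\<lambda>i. h \<bullet> F i) I)" by (rule Sum_in_homset) (rule H)
qed (use assms in auto)

lemma Sum_comp:
  assumes "arr h" "tgt h = X" and "\<And>i. i \<in> I \<Longrightarrow> F i \<in> homset X Y"
  shows "Sum X Y F I \<bullet> h = Sum (src h) Y (\<lambda>i. F i \<bullet> h) I"
proof (rule arrow_eqI)
  have H: "\<And>i. i \<in> I \<Longrightarrow> F i \<bullet> h \<in> homset (src h) Y"
    using assms by (force simp: homset_def)
  note h = raw_in_Hom[OF assms(1), unfolded assms(2)]
  show "raw (Sum X Y F I \<bullet> h) = raw (Sum (src h) Y (\<lambda>i. F i \<bullet> h) I)"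
  proof -
    have "raw (Sum X Y F I \<bullet> h) = (\<Oplus>\<^bsub>Hom C X Y\<^esub>i\<in>I. raw (F i)) \<cdot> raw h"
      using assms by (simp add: raw_comp raw_Sum)
    also have "\<dots> = (\<Oplus>\<^bsub>Hom C (src h) Y\<^esub>i\<in>I. raw (F i) \<cdot> raw h)"
      using h raw_in_Hom'[OF assms(3)] compose_add_left compose_in_Hom
      by (intro additive_finsum[where \<phi> = "\<lambda>x. x \<cdot> raw h"]) auto
    also have "\<dots> = (\<Oplus>\<^bsub>Hom C (src h) Y\<^esub>i\<in>I. raw (F i \<bullet> h))"
      using assms H raw_in_Hom'[OF H]
      by (intro Hom.M.finsum_cong') (auto simp: raw_comp homset_def)
    finally show ?thesis using H by (simp add: raw_Sum)
  qed
  show "arr (Sum (src h) Y (\<lambda>i. F i \<bullet> h) I)" by (rule Sum_in_homset) (rule H)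
qed (use assms in auto)

lemma Sum_single:
  assumes "finite I" "i \<in> I" "F i \<in> homset X Y"
    and "\<And>k. k \<in> I \<Longrightarrow> k \<noteq> i \<Longrightarrow> F k = Zero X Y"
  shows "Sum X Y F I = F i"
proof (rule arrow_eqI)
  have H: "\<And>k. k \<in> I \<Longrightarrow> F k \<in> homset X Y"
    using assms by (metis arr_Zero homsetI src_tgt(7,8))
  have "(\<Oplus>\<^bsub>Hom C X Y\<^esub>k\<in>I. raw (F k))
      = (\<Oplus>\<^bsub>Hom C X Y\<^esub>k\<in>I. if i = k then raw (F k) else \<zero>\<^bsub>Hom C X Y\<^esub>)"
    using assms(4) raw_in_Hom'[OF H] by (intro Hom.M.finsum_cong') (auto simp: raw_Zero)
  also have "\<dots> = raw (F i)"
    using assms(1,2) raw_in_Hom'[OF H] by (intro Hom.M.finsum_singleton) auto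
  finally show "raw (Sum X Y F I) = raw (F i)" using H by (simp add: raw_Sum)
  show "arr (Sum X Y F I)" by (rule Sum_in_homset) (rule H)
qed (use assms in auto)

lemma Sum_zero:
  assumes "\<And>k. k \<in> I \<Longrightarrow> F k = Zero X Y"
  shows "Sum X Y F I = Zero X Y"
proof -
  have "(\<Oplus>\<^bsub>Hom C X Y\<^esub>k\<in>I. raw (F k)) = (\<Oplus>\<^bsub>Hom C X Y\<^esub>k\<in>I. \<zero>\<^bsub>Hom C X Y\<^esub>)"
    using assms by (intro Hom.M.finsum_cong') (auto simp: raw_Zero)
  then show ?thesis by (simp add: Sum_def Zero_def Hom.M.finsum_zero)
qed

lemma comp_Zero [simp]: "arr h \<Longrightarrow> src h = Y \<Longrightarrow> h \<bullet> Zero X Y = Zero X (tgt h)"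
  using raw_in_Hom[of h] compose_zero_right by (intro arrow_eqI) (auto simp: raw_comp raw_Zero)

lemma Zero_comp [simp]: "arr h \<Longrightarrow> tgt h = X \<Longrightarrow> Zero X Y \<bullet> h = Zero (src h) Y"
  using raw_in_Hom[of h] compose_zero_left by (intro arrow_eqI) (auto simp: raw_comp raw_Zero)

lemma comp_scale [simp]:
  "arr f \<Longrightarrow> arr g \<Longrightarrow> src g = tgt f \<Longrightarrow> a \<in> carrier (base C) \<Longrightarrow>
    g \<bullet> scale a f = scale a (g \<bullet> f)"
  using raw_in_Hom[of f] raw_in_Hom[of g]
  by (intro arrow_eqI) (simp_all add: raw_comp raw_scale compose_smult_right)

lemma scale_comp [simp]:
  "arr f \<Longrightarrow> arr g \<Longrightarrow> src g = tgt f \<Longrightarrow> a \<in> carrier (base C) \<Longrightarrow>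
    scale a g \<bullet> f = scale a (g \<bullet> f)"
  using raw_in_Hom[of f] raw_in_Hom[of g]
  by (intro arrow_eqI) (simp_all add: raw_comp raw_scale compose_smult_left)

lemma scale_zero [simp]: "arr f \<Longrightarrow> scale \<zero>\<^bsub>base C\<^esub> f = Zero (src f) (tgt f)"
  using raw_in_Hom[of f] by (intro arrow_eqI) (simp_all add: raw_scale raw_Zero)

lemma scale_Zero [simp]: "a \<in> carrier (base C) \<Longrightarrow> scale a (Zero X Y) = Zero X Y"
  by (intro arrow_eqI) (simp_all add: raw_scale raw_Zero)

lemma scale_scale:
  "arr f \<Longrightarrow> a \<in> carrier (base C) \<Longrightarrow> b \<in> carrier (base C) \<Longrightarrow>
    scale a (scale b f) = scale (a \<otimes>\<^bsub>base C\<^esub> b) f"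
  using raw_in_Hom[of f] by (intro arrow_eqI) (simp_all add: raw_scale Hom.smult_assoc1)

lemma scale_one [simp]: "arr f \<Longrightarrow> scale \<one>\<^bsub>base C\<^esub> f = f"
  using raw_in_Hom[of f] by (intro arrow_eqI) (simp_all add: raw_scale)

lemma scale_cancel_scalar:
  assumes f: "arr f" "f \<noteq> Zero (src f) (tgt f)"
    and ab: "a \<in> carrier (base C)" "b \<in> carrier (base C)" and eq: "scale a f = scale b f"
  shows "a = b"
proof (rule ccontr)
  interpret K: field "base C" by (rule base_field)
  let ?H = "Hom C (src f) (tgt f)" and ?c = "a \<ominus>\<^bsub>base C\<^esub> b"
  assume "a \<noteq> b"
  then have "?c \<noteq> \<zero>\<^bsub>base C\<^esub>"
    using ab Hom.R.minus_equality[of a "\<ominus>\<^bsub>base C\<^esub> b"] by (auto simp: Hom.R.minus_eq)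
  then have c: "?c \<in> Units (base C)" using ab K.field_Units by simp
  have "a \<odot>\<^bsub>?H\<^esub> raw f = b \<odot>\<^bsub>?H\<^esub> raw f"
    using eq f(1) ab by (metis raw_scale)
  then have "?c \<odot>\<^bsub>?H\<^esub> raw f = \<zero>\<^bsub>?H\<^esub>"
    using ab raw_in_Hom[OF f(1)]
    by (simp add: Hom.R.minus_eq Hom.smult_l_distr Hom.smult_l_minus Hom.M.r_neg)
  then have "inv\<^bsub>base C\<^esub> ?c \<odot>\<^bsub>?H\<^esub> (?c \<odot>\<^bsub>?H\<^esub> raw f) = \<zero>\<^bsub>?H\<^esub>"
    using c by simp
  then have "raw f = \<zero>\<^bsub>?H\<^esub>"
    using c raw_in_Hom[OF f(1)] ab by (simp flip: Hom.smult_assoc1)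
  then have "f = Zero (src f) (tgt f)"
    using f(1) by (intro arrow_eqI) (simp_all add: raw_Zero)
  then show False using f(2) by simp
qed

lemma scale_cancel_arrow:
  assumes "arr f" "arr g" "src f = src g" "tgt f = tgt g"
    and a: "a \<in> carrier (base C)" "a \<noteq> \<zero>\<^bsub>base C\<^esub>" and eq: "scale a f = scale a g"
  shows "f = g"
proof -
  interpret K: field "base C" by (rule base_field)
  have c: "a \<in> Units (base C)" using a K.field_Units by simp
  have "scale (inv\<^bsub>base C\<^esub> a) (scale a h) = h" if "arr h" for h
    using that a c by (simp add: scale_scale)
  then show ?thesis using assms(1,2) eq by metis
qed

lemma scale_Sum:
  assumes "a \<in> carrier (base C)" and "\<And>i. i \<in> I \<Longrightarrow> F i \<in> homset X Y"
  shows "scale a (Sum X Y F I) = Sum X Y (\<lambda>i. scale a (F i)) I"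
proof -
  have S: "arr (Sum X Y F I)" using assms(2) by (rule Sum_in_homset)
  have "scale a (Sum X Y F I) = scale a (Id Y) \<bullet> Sum X Y F I"
    using S assms(1) by simp
  also have "\<dots> = Sum X Y (\<lambda>i. scale a (Id Y) \<bullet> F i) I"
    using assms by (subst comp_Sum) auto
  also have "\<dots> = Sum X Y (\<lambda>i. scale a (F i)) I"
    using assms by (intro Sum_cong) (auto simp: homset_def)
  finally show ?thesis .
qed

end

section \<open>Direct sums\<close>

context linear_category
begin

definition dsum ::
    "'i set \<Rightarrow> ('i \<Rightarrow> 'o) \<Rightarrow> 'o \<Rightarrow> ('i \<Rightarrow> ('o, 'm) arrow) \<Rightarrow> ('i \<Rightarrow> ('o, 'm) arrow) \<Rightarrow> bool" where
  "dsum I F X p q \<longleftrightarrow> finite I \<and>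
     (\<forall>i\<in>I. p i \<in> homset X (F i) \<and> q i \<in> homset (F i) X) \<and>
     (\<forall>i\<in>I. \<forall>j\<in>I. p i \<bullet> q j = (if i = j then Id (F i) else Zero (F j) (F i))) \<and>
     Sum X X (\<lambda>i. q i \<bullet> p i) I = Id X"

lemma dsumD:
  assumes "dsum I F X p q"
  shows "finite I" "\<And>i. i \<in> I \<Longrightarrow> p i \<in> homset X (F i)" "\<And>i. i \<in> I \<Longrightarrow> q i \<in> homset (F i) X"
    and "\<And>i. i \<in> I \<Longrightarrow> p i \<bullet> q i = Id (F i)"
    and "\<And>i j. i \<in> I \<Longrightarrow> j \<in> I \<Longrightarrow> i \<noteq> j \<Longrightarrow> p i \<bullet> q j = Zero (F j) (F i)"
    and "Sum X X (\<lambda>i. q i \<bullet> p i) I = Id X"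
  using assms by (simp_all add: dsum_def)

lemma direct_sum_imp_dsum:
  assumes "direct_sum C I F X p q"
  shows "dsum I F X (\<lambda>i. arrow X (p i) (F i)) (\<lambda>i. arrow (F i) (q i) X)"
proof -
  have p: "p i \<in> carrier (Hom C X (F i))" and q: "q i \<in> carrier (Hom C (F i) X)" if "i \<in> I" for i
    using assms that by (auto simp: direct_sum_def)
  have "(\<Oplus>\<^bsub>Hom C X X\<^esub>i\<in>I. raw (arrow (F i) (q i) X \<bullet> arrow X (p i) (F i)))
      = (\<Oplus>\<^bsub>Hom C X X\<^esub>i\<in>I. q i \<cdot> p i)"
    using p q compose_in_Hom[OF p q] by (intro Hom.M.finsum_cong') (auto simp: Pi_def)
  with assms p q show ?thesis
    by (auto simp: dsum_def direct_sum_def homset_arrow Sum_def Id_def Zero_def)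
qed

lemma qp_homset:
  assumes "dsum I F X p q" "i \<in> I"
  shows "q i \<bullet> p i \<in> homset X X"
  using dsumD(2,3)[OF assms] by (auto simp: homset_def)

text \<open>
  The injections of a direct sum are jointly epic, its projections jointly monic.  Equations are
  verified summand by summand in this way, which avoids manipulating sums.
\<close>

lemma dsum_epi:
  assumes d: "dsum I F X p q" and f: "f \<in> homset X Y" and g: "g \<in> homset X Y"
    and eq: "\<And>i. i \<in> I \<Longrightarrow> f \<bullet> q i = g \<bullet> q i"
  shows "f = g"
proof -
  have "f = f \<bullet> Sum X X (\<lambda>i. q i \<bullet> p i) I" using homsetD[OF f] dsumD(6)[OF d] by simp
  also have "\<dots> = Sum X Y (\<lambda>i. f \<bullet> (q i \<bullet> p i)) I"
    using f by (subst comp_Sum) (auto intro: qp_homset[OF d])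
  also have "\<dots> = Sum X Y (\<lambda>i. g \<bullet> (q i \<bullet> p i)) I"
    using f g dsumD(2,3)[OF d]
    by (intro Sum_cong) (auto simp: reassoc[OF eq] homset_def)
  also have "\<dots> = g \<bullet> Sum X X (\<lambda>i. q i \<bullet> p i) I"
    using g by (subst comp_Sum) (auto intro: qp_homset[OF d])
  also have "\<dots> = g" using homsetD[OF g] dsumD(6)[OF d] by simp
  finally show ?thesis .
qed

lemma dsum_mono:
  assumes d: "dsum I F X p q" and f: "f \<in> homset Y X" and g: "g \<in> homset Y X"
    and eq: "\<And>i. i \<in> I \<Longrightarrow> p i \<bullet> f = p i \<bullet> g"
  shows "f = g"
proof -
  have "f = Sum X X (\<lambda>i. q i \<bullet> p i) I \<bullet> f" using homsetD[OF f] dsumD(6)[OF d] by simp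
  also have "\<dots> = Sum Y X (\<lambda>i. (q i \<bullet> p i) \<bullet> f) I"
    using f by (subst Sum_comp) (auto intro: qp_homset[OF d])
  also have "\<dots> = Sum Y X (\<lambda>i. (q i \<bullet> p i) \<bullet> g) I"
    using f g dsumD(2,3)[OF d] by (intro Sum_cong) (auto simp: eq homset_def)
  also have "\<dots> = Sum X X (\<lambda>i. q i \<bullet> p i) I \<bullet> g"
    using g by (subst Sum_comp) (auto intro: qp_homset[OF d])
  also have "\<dots> = g" using homsetD[OF g] dsumD(6)[OF d] by simp
  finally show ?thesis .
qed

lemma dsum_copair:
  assumes d: "dsum I F X p q" and f: "\<And>i. i \<in> I \<Longrightarrow> f i \<in> homset (F i) Y"
  shows "\<exists>r\<in>homset X Y. \<forall>i\<in>I. r \<bullet> q i = f i"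
proof -
  let ?r = "Sum X Y (\<lambda>i. f i \<bullet> p i) I"
  have fp: "f i \<bullet> p i \<in> homset X Y" if "i \<in> I" for i
    using f[OF that] dsumD(2)[OF d that] by (auto simp: homset_def)
  have "?r \<bullet> q j = f j" if j: "j \<in> I" for j
  proof -
    have q: "arr (q j)" "src (q j) = F j" "tgt (q j) = X" using dsumD(3)[OF d j] by auto
    have t: "(f i \<bullet> p i) \<bullet> q j = (if i = j then f j else Zero (F j) Y)" if "i \<in> I" for i
      using dsumD(4)[OF d j] dsumD(5)[OF d that j] f[OF that] by (auto simp: homset_def)
    have "?r \<bullet> q j = Sum (F j) Y (\<lambda>i. (f i \<bullet> p i) \<bullet> q j) I"
      using q fp by (subst Sum_comp) auto
    also have "\<dots> = (f j \<bullet> p j) \<bullet> q j"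
      using t f[OF j] dsumD(1)[OF d] j by (intro Sum_single) auto
    finally show ?thesis using t[OF j] by simp
  qed
  then show ?thesis using fp by (intro bexI[of _ ?r]) (auto simp: homset_def)
qed

end

section \<open>Whiskering\<close>

context strict_monoidal_linear_category
begin

lemmas tensor_ob_simps [simp] = tensor_ob_assoc tensor_ob_unit_left tensor_ob_unit_right

text \<open>
  Tensor products of arrows are decomposed into layers \<open>X \<rhd> (f \<lhd> Y) = id\<^sub>X \<otimes> f \<otimes> id\<^sub>Y\<close>, the horizontal slices
  of a string diagram that contain a single box.  The simplification rules below bring every diagram
  into the form of a right-nested composite of such layers; two different normal forms of the same
  diagram then differ by exchanging boxes in disjoint positions.
\<close>

definition lw :: "'o \<Rightarrow> ('o, 'm) arrow \<Rightarrow> ('o, 'm) arrow" (infixr \<open>\<rhd>\<close> 75) where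
  "X \<rhd> f = Arrow (X \<otimes>\<^sub>o src f) (if arr f then Some (\<i>\<d> X \<otimes>\<^sub>m raw f) else None) (X \<otimes>\<^sub>o tgt f)"

definition rw :: "('o, 'm) arrow \<Rightarrow> 'o \<Rightarrow> ('o, 'm) arrow" (infixl \<open>\<lhd>\<close> 76) where
  "f \<lhd> X = Arrow (src f \<otimes>\<^sub>o X) (if arr f then Some (raw f \<otimes>\<^sub>m \<i>\<d> X) else None) (tgt f \<otimes>\<^sub>o X)"

lemma src_tgt_whisker [simp]:
  "src (X \<rhd> f) = X \<otimes>\<^sub>o src f" "tgt (X \<rhd> f) = X \<otimes>\<^sub>o tgt f"
  "src (f \<lhd> X) = src f \<otimes>\<^sub>o X" "tgt (f \<lhd> X) = tgt f \<otimes>\<^sub>o X"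
  by (simp_all add: lw_def rw_def)

lemma arr_whisker [simp]: "arr (X \<rhd> f) \<longleftrightarrow> arr f" "arr (f \<lhd> X) \<longleftrightarrow> arr f"
  using tensor_in_Hom[OF ident_in_Hom[of X] raw_in_Hom[of f]]
    tensor_in_Hom[OF raw_in_Hom[of f] ident_in_Hom[of X]]
  by (auto simp: lw_def rw_def)

lemma raw_whisker:
  "arr f \<Longrightarrow> raw (X \<rhd> f) = \<i>\<d> X \<otimes>\<^sub>m raw f" "arr f \<Longrightarrow> raw (f \<lhd> X) = raw f \<otimes>\<^sub>m \<i>\<d> X"
  by (simp_all add: lw_def rw_def raw_def)

lemma whisker_not_arr:
  "\<not> arr f \<Longrightarrow> X \<rhd> f = Arrow (X \<otimes>\<^sub>o src f) None (X \<otimes>\<^sub>o tgt f)"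
  "\<not> arr f \<Longrightarrow> f \<lhd> X = Arrow (src f \<otimes>\<^sub>o X) None (tgt f \<otimes>\<^sub>o X)"
  by (simp_all add: lw_def rw_def)

lemma lw_comp [simp]: "src g = tgt f \<Longrightarrow> X \<rhd> (g \<bullet> f) = (X \<rhd> g) \<bullet> (X \<rhd> f)"
proof (cases "arr f \<and> arr g")
  case True
  assume s: "src g = tgt f"
  have "\<i>\<d> X \<otimes>\<^sub>m (raw g \<cdot> raw f) = (\<i>\<d> X \<otimes>\<^sub>m raw g) \<cdot> (\<i>\<d> X \<otimes>\<^sub>m raw f)"
    using interchange[OF ident_in_Hom ident_in_Hom raw_in_Hom[of f], of "raw g" "tgt g" X]
      raw_in_Hom[of g] s True ident_left[OF ident_in_Hom, of X] by simp
  with True s show ?thesis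
    by (intro arrow_eqI) (simp_all add: raw_comp raw_whisker)
next
  case False
  then have "\<not> arr (g \<bullet> f)" "\<not> arr ((X \<rhd> g) \<bullet> (X \<rhd> f))" by auto
  then show ?thesis by (metis comp_not_arr whisker_not_arr(1) src_tgt(5,6) src_tgt_whisker(1,2))
qed

lemma rw_comp [simp]: "src g = tgt f \<Longrightarrow> (g \<bullet> f) \<lhd> X = (g \<lhd> X) \<bullet> (f \<lhd> X)"
proof (cases "arr f \<and> arr g")
  case True
  assume s: "src g = tgt f"
  have "(raw g \<cdot> raw f) \<otimes>\<^sub>m \<i>\<d> X = (raw g \<otimes>\<^sub>m \<i>\<d> X) \<cdot> (raw f \<otimes>\<^sub>m \<i>\<d> X)"
    using interchange[OF raw_in_Hom[of f] _ ident_in_Hom ident_in_Hom, of "raw g" "tgt g" X]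
      raw_in_Hom[of g] s True ident_left[OF ident_in_Hom, of X] by simp
  with True s show ?thesis
    by (intro arrow_eqI) (simp_all add: raw_comp raw_whisker)
next
  case False
  then have "\<not> arr (g \<bullet> f)" "\<not> arr ((g \<lhd> X) \<bullet> (f \<lhd> X))" by auto
  then show ?thesis by (metis comp_not_arr whisker_not_arr(2) src_tgt(5,6) src_tgt_whisker(3,4))
qed

lemma whisker_Id [simp]: "X \<rhd> Id Y = Id (X \<otimes>\<^sub>o Y)" "Id Y \<lhd> X = Id (Y \<otimes>\<^sub>o X)"
  by (rule arrow_eqI; simp add: raw_whisker raw_Id tensor_ident)+

lemma lw_lw [simp]: "X \<rhd> Y \<rhd> f = (X \<otimes>\<^sub>o Y) \<rhd> f"
proof (cases "arr f")
  case True
  then show ?thesis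
    using tensor_assoc[OF ident_in_Hom[of X] ident_in_Hom[of Y] raw_in_Hom]
    by (intro arrow_eqI) (simp_all add: raw_whisker tensor_ident)
qed (simp add: lw_def)

lemma rw_rw [simp]: "f \<lhd> X \<lhd> Y = f \<lhd> (X \<otimes>\<^sub>o Y)"
proof (cases "arr f")
  case True
  then show ?thesis
    using tensor_assoc[OF raw_in_Hom ident_in_Hom[of X] ident_in_Hom[of Y]]
    by (intro arrow_eqI) (simp_all add: raw_whisker tensor_ident)
qed (simp add: rw_def)

lemma lw_rw [simp]: "(X \<rhd> f) \<lhd> Y = X \<rhd> (f \<lhd> Y)"
proof (cases "arr f")
  case True
  then show ?thesis
    using tensor_assoc[OF ident_in_Hom[of X] raw_in_Hom ident_in_Hom[of Y]]
    by (intro arrow_eqI) (simp_all add: raw_whisker)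
qed (simp add: lw_def rw_def)

lemma whisker_unit [simp]: "arr f \<Longrightarrow> \<I> \<rhd> f = f" "arr f \<Longrightarrow> f \<lhd> \<I> = f"
  using tensor_unit_left[OF raw_in_Hom] tensor_unit_right[OF raw_in_Hom]
  by (intro arrow_eqI; simp add: raw_whisker)+

lemma tensor_arrow:
  assumes "f \<in> carrier (Hom C X Y)" "g \<in> carrier (Hom C X' Y')"
  shows "arrow (X \<otimes>\<^sub>o X') (f \<otimes>\<^sub>m g) (Y \<otimes>\<^sub>o Y') = (arrow X f Y \<lhd> Y') \<bullet> (X \<rhd> arrow X' g Y')"
proof (rule arrow_eqI)
  have "(f \<otimes>\<^sub>m \<i>\<d> Y') \<cdot> (\<i>\<d> X \<otimes>\<^sub>m g) = f \<otimes>\<^sub>m g"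
    using interchange[OF ident_in_Hom assms(1) assms(2) ident_in_Hom] assms
    by (simp add: ident_left ident_right)
  then show "raw (arrow (X \<otimes>\<^sub>o X') (f \<otimes>\<^sub>m g) (Y \<otimes>\<^sub>o Y'))
      = raw ((arrow X f Y \<lhd> Y') \<bullet> (X \<rhd> arrow X' g Y'))"
    using assms by (simp add: raw_comp raw_whisker tensor_in_Hom)
qed (use assms in \<open>simp_all add: tensor_in_Hom\<close>)

text \<open>
  Boxes on disjoint strands can be moved past each other.  With \<open>exchange_at\<close> there may be strands \<open>X\<close> to
  the left, \<open>W\<close> in between and \<open>Z\<close> to the right.
\<close>

lemma exchange:
  assumes "arr f" "arr g"
  shows "(f \<lhd> tgt g) \<bullet> (src f \<rhd> g) = (tgt f \<rhd> g) \<bullet> (f \<lhd> src g)"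
proof (rule arrow_eqI)
  note F = raw_in_Hom[OF assms(1)] and G = raw_in_Hom[OF assms(2)]
  have "(raw f \<otimes>\<^sub>m \<i>\<d> (tgt g)) \<cdot> (\<i>\<d> (src f) \<otimes>\<^sub>m raw g) = raw f \<otimes>\<^sub>m raw g"
    using interchange[OF ident_in_Hom F G ident_in_Hom] F G by (simp add: ident_left ident_right)
  moreover have "(\<i>\<d> (tgt f) \<otimes>\<^sub>m raw g) \<cdot> (raw f \<otimes>\<^sub>m \<i>\<d> (src g)) = raw f \<otimes>\<^sub>m raw g"
    using interchange[OF F ident_in_Hom ident_in_Hom G] F G by (simp add: ident_left ident_right)
  ultimately show "raw ((f \<lhd> tgt g) \<bullet> (src f \<rhd> g)) = raw ((tgt f \<rhd> g) \<bullet> (f \<lhd> src g))"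
    using assms by (simp add: raw_comp raw_whisker)
qed (use assms in simp_all)

lemma exchange_at:
  assumes "arr f" "arr g"
  shows "(X \<rhd> (f \<lhd> (W \<otimes>\<^sub>o tgt g \<otimes>\<^sub>o Z))) \<bullet> ((X \<otimes>\<^sub>o src f \<otimes>\<^sub>o W) \<rhd> (g \<lhd> Z))
    = ((X \<otimes>\<^sub>o tgt f \<otimes>\<^sub>o W) \<rhd> (g \<lhd> Z)) \<bullet> (X \<rhd> (f \<lhd> (W \<otimes>\<^sub>o src g \<otimes>\<^sub>o Z)))"
proof -
  have "(f \<lhd> (W \<otimes>\<^sub>o tgt g \<otimes>\<^sub>o Z)) \<bullet> (src f \<rhd> (W \<rhd> (g \<lhd> Z)))
      = (tgt f \<rhd> (W \<rhd> (g \<lhd> Z))) \<bullet> (f \<lhd> (W \<otimes>\<^sub>o src g \<otimes>\<^sub>o Z))"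
    using exchange[of f "W \<rhd> (g \<lhd> Z)"] assms by simp
  from arg_cong[OF this, of "\<lambda>h. X \<rhd> h"] show ?thesis using assms by simp
qed

lemma lw_Zero [simp]: "X \<rhd> Zero Y Z = Zero (X \<otimes>\<^sub>o Y) (X \<otimes>\<^sub>o Z)"
proof -
  have "\<i>\<d> X \<otimes>\<^sub>m (\<zero>\<^bsub>base C\<^esub> \<odot>\<^bsub>Hom C Y Z\<^esub> \<zero>\<^bsub>Hom C Y Z\<^esub>) = \<zero>\<^bsub>Hom C (X \<otimes>\<^sub>o Y) (X \<otimes>\<^sub>o Z)\<^esub>"
    using tensor_in_Hom[OF ident_in_Hom, of "\<zero>\<^bsub>Hom C Y Z\<^esub>" Y Z X]
    by (subst tensor_smult_right[OF _ ident_in_Hom]) auto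
  then show ?thesis by (intro arrow_eqI) (simp_all add: raw_whisker raw_Zero)
qed

lemma rw_Zero [simp]: "Zero Y Z \<lhd> X = Zero (Y \<otimes>\<^sub>o X) (Z \<otimes>\<^sub>o X)"
proof -
  have "(\<zero>\<^bsub>base C\<^esub> \<odot>\<^bsub>Hom C Y Z\<^esub> \<zero>\<^bsub>Hom C Y Z\<^esub>) \<otimes>\<^sub>m \<i>\<d> X = \<zero>\<^bsub>Hom C (Y \<otimes>\<^sub>o X) (Z \<otimes>\<^sub>o X)\<^esub>"
    using tensor_in_Hom[OF _ ident_in_Hom, of "\<zero>\<^bsub>Hom C Y Z\<^esub>" Y Z X]
    by (subst tensor_smult_left[OF _ _ ident_in_Hom]) auto
  then show ?thesis by (intro arrow_eqI) (simp_all add: raw_whisker raw_Zero)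
qed

lemma whisker_scale [simp]:
  assumes "arr f" "a \<in> carrier (base C)"
  shows "X \<rhd> scale a f = scale a (X \<rhd> f)" "scale a f \<lhd> X = scale a (f \<lhd> X)"
  using assms raw_in_Hom[OF assms(1)] ident_in_Hom[of X]
  by (intro arrow_eqI; simp add: raw_whisker raw_scale tensor_smult_left tensor_smult_right)+

lemma lw_Sum:
  assumes "\<And>i. i \<in> I \<Longrightarrow> F i \<in> homset Y Z"
  shows "X \<rhd> Sum Y Z F I = Sum (X \<otimes>\<^sub>o Y) (X \<otimes>\<^sub>o Z) (\<lambda>i. X \<rhd> F i) I"
proof (rule arrow_eqI)
  have H: "\<And>i. i \<in> I \<Longrightarrow> X \<rhd> F i \<in> homset (X \<otimes>\<^sub>o Y) (X \<otimes>\<^sub>o Z)"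
    using assms by (force simp: homset_def)
  have "raw (X \<rhd> Sum Y Z F I) = \<i>\<d> X \<otimes>\<^sub>m (\<Oplus>\<^bsub>Hom C Y Z\<^esub>i\<in>I. raw (F i))"
    using assms by (simp add: raw_whisker raw_Sum)
  also have "\<dots> = (\<Oplus>\<^bsub>Hom C (X \<otimes>\<^sub>o Y) (X \<otimes>\<^sub>o Z)\<^esub>i\<in>I. \<i>\<d> X \<otimes>\<^sub>m raw (F i))"
    using raw_in_Hom'[OF assms] tensor_add_right[OF ident_in_Hom[of X]] tensor_in_Hom[OF ident_in_Hom[of X]]
    by (intro additive_finsum[where \<phi> = "\<lambda>x. \<i>\<d> X \<otimes>\<^sub>m x"]) auto
  also have "\<dots> = (\<Oplus>\<^bsub>Hom C (X \<otimes>\<^sub>o Y) (X \<otimes>\<^sub>o Z)\<^esub>i\<in>I. raw (X \<rhd> F i))"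
    using assms raw_in_Hom'[OF H] by (intro Hom.M.finsum_cong') (auto simp: raw_whisker homset_def)
  finally show "raw (X \<rhd> Sum Y Z F I) = raw (Sum (X \<otimes>\<^sub>o Y) (X \<otimes>\<^sub>o Z) (\<lambda>i. X \<rhd> F i) I)"
    using H by (simp add: raw_Sum)
  show "arr (Sum (X \<otimes>\<^sub>o Y) (X \<otimes>\<^sub>o Z) (\<lambda>i. X \<rhd> F i) I)" by (rule Sum_in_homset) (rule H)
qed (use assms in auto)

lemma rw_Sum:
  assumes "\<And>i. i \<in> I \<Longrightarrow> F i \<in> homset Y Z"
  shows "Sum Y Z F I \<lhd> X = Sum (Y \<otimes>\<^sub>o X) (Z \<otimes>\<^sub>o X) (\<lambda>i. F i \<lhd> X) I"
proof (rule arrow_eqI)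
  have H: "\<And>i. i \<in> I \<Longrightarrow> F i \<lhd> X \<in> homset (Y \<otimes>\<^sub>o X) (Z \<otimes>\<^sub>o X)"
    using assms by (force simp: homset_def)
  have "raw (Sum Y Z F I \<lhd> X) = (\<Oplus>\<^bsub>Hom C Y Z\<^esub>i\<in>I. raw (F i)) \<otimes>\<^sub>m \<i>\<d> X"
    using assms by (simp add: raw_whisker raw_Sum)
  also have "\<dots> = (\<Oplus>\<^bsub>Hom C (Y \<otimes>\<^sub>o X) (Z \<otimes>\<^sub>o X)\<^esub>i\<in>I. raw (F i) \<otimes>\<^sub>m \<i>\<d> X)"
    using raw_in_Hom'[OF assms] tensor_add_left[OF _ _ ident_in_Hom[of X]] tensor_in_Hom[OF _ ident_in_Hom[of X]]
    by (intro additive_finsum[where \<phi> = "\<lambda>x. x \<otimes>\<^sub>m \<i>\<d> X"]) auto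
  also have "\<dots> = (\<Oplus>\<^bsub>Hom C (Y \<otimes>\<^sub>o X) (Z \<otimes>\<^sub>o X)\<^esub>i\<in>I. raw (F i \<lhd> X))"
    using assms raw_in_Hom'[OF H] by (intro Hom.M.finsum_cong') (auto simp: raw_whisker homset_def)
  finally show "raw (Sum Y Z F I \<lhd> X) = raw (Sum (Y \<otimes>\<^sub>o X) (Z \<otimes>\<^sub>o X) (\<lambda>i. F i \<lhd> X) I)"
    using H by (simp add: raw_Sum)
  show "arr (Sum (Y \<otimes>\<^sub>o X) (Z \<otimes>\<^sub>o X) (\<lambda>i. F i \<lhd> X) I)" by (rule Sum_in_homset) (rule H)
qed (use assms in auto)

lemma dsum_lw:
  assumes d: "dsum I F X p q"
  shows "dsum I (\<lambda>i. Y \<otimes>\<^sub>o F i) (Y \<otimes>\<^sub>o X) (\<lambda>i. Y \<rhd> p i) (\<lambda>i. Y \<rhd> q i)"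
proof -
  have pq: "arr (p i)" "arr (q i)" "src (p i) = X" "tgt (p i) = F i" "src (q i) = F i" "tgt (q i) = X"
    if "i \<in> I" for i using dsumD(2,3)[OF d that] by auto
  have "Sum (Y \<otimes>\<^sub>o X) (Y \<otimes>\<^sub>o X) (\<lambda>i. (Y \<rhd> q i) \<bullet> (Y \<rhd> p i)) I = Y \<rhd> Sum X X (\<lambda>i. q i \<bullet> p i) I"
    using pq by (subst lw_Sum[OF qp_homset[OF d]]) (auto intro!: Sum_cong simp: homset_def)
  moreover have "(Y \<rhd> p i) \<bullet> (Y \<rhd> q j) = Y \<rhd> (p i \<bullet> q j)" if "i \<in> I" "j \<in> I" for i j
    using pq that by simp
  ultimately show ?thesis
    using d pq unfolding dsum_def by (auto simp: homset_def)
qed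

lemma dsum_rw:
  assumes d: "dsum I F X p q"
  shows "dsum I (\<lambda>i. F i \<otimes>\<^sub>o Y) (X \<otimes>\<^sub>o Y) (\<lambda>i. p i \<lhd> Y) (\<lambda>i. q i \<lhd> Y)"
proof -
  have pq: "arr (p i)" "arr (q i)" "src (p i) = X" "tgt (p i) = F i" "src (q i) = F i" "tgt (q i) = X"
    if "i \<in> I" for i using dsumD(2,3)[OF d that] by auto
  have "Sum (X \<otimes>\<^sub>o Y) (X \<otimes>\<^sub>o Y) (\<lambda>i. (q i \<lhd> Y) \<bullet> (p i \<lhd> Y)) I = Sum X X (\<lambda>i. q i \<bullet> p i) I \<lhd> Y"
    using pq by (subst rw_Sum[OF qp_homset[OF d]]) (auto intro!: Sum_cong simp: homset_def)
  moreover have "(p i \<lhd> Y) \<bullet> (q j \<lhd> Y) = (p i \<bullet> q j) \<lhd> Y" if "i \<in> I" "j \<in> I" for i j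
    using pq that by simp
  ultimately show ?thesis
    using d pq unfolding dsum_def by (auto simp: homset_def)
qed

end

section \<open>Duality, braiding and twist as arrows\<close>

context linear_category
begin

lemma inverse_morphisms_unique:
  assumes "inverse_morphisms C X Y f g" "inverse_morphisms C X Y f h"
  shows "g = h"
  using assms unfolding inverse_morphisms_def by (metis compose_assoc ident_left ident_right)

lemma inverse_of:
  assumes "is_iso C X Y f"
  shows "inverse_morphisms C X Y f (inverse_of C X Y f)"
  using assms inverse_morphisms_unique unfolding is_iso_def inverse_of_def by (metis theI)

lemma arrow_inverse_of:
  assumes "is_iso C X Y f"
  shows "arr (arrow X f Y)" "arr (arrow Y (inverse_of C X Y f) X)"
    and "arrow Y (inverse_of C X Y f) X \<bullet> arrow X f Y = Id X"
    and "arrow X f Y \<bullet> arrow Y (inverse_of C X Y f) X = Id Y"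
  using inverse_of[OF assms] by (auto simp: inverse_morphisms_def Id_def)

lemma left_inverse_eq_right_inverse:
  assumes "g \<bullet> f = Id X" "f \<bullet> h = Id Y" "arr h" "arr g" "tgt h = X" "src g = Y"
  shows "g = h"
  using assms by (metis comp_Id_left comp_Id_right comp_assoc)

end

context ribbon_linear_category
begin

definition EV where "EV X = arrow (X\<^sup>\<star> \<otimes>\<^sub>o X) (ev C X) \<I>"
definition COEV where "COEV X = arrow \<I> (coev C X) (X \<otimes>\<^sub>o X\<^sup>\<star>)"
definition BR where "BR X Y = arrow (X \<otimes>\<^sub>o Y) (braid C X Y) (Y \<otimes>\<^sub>o X)"
definition BRi where
  "BRi X Y = arrow (Y \<otimes>\<^sub>o X) (inverse_of C (X \<otimes>\<^sub>o Y) (Y \<otimes>\<^sub>o X) (braid C X Y)) (X \<otimes>\<^sub>o Y)"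
definition TW where "TW X = arrow X (twist C X) X"
definition TWi where "TWi X = arrow X (inverse_of C X X (twist C X)) X"

lemma src_tgt_gen [simp]:
  "src (EV X) = X\<^sup>\<star> \<otimes>\<^sub>o X" "tgt (EV X) = \<I>" "src (COEV X) = \<I>" "tgt (COEV X) = X \<otimes>\<^sub>o X\<^sup>\<star>"
  "src (BR X Y) = X \<otimes>\<^sub>o Y" "tgt (BR X Y) = Y \<otimes>\<^sub>o X"
  "src (BRi X Y) = Y \<otimes>\<^sub>o X" "tgt (BRi X Y) = X \<otimes>\<^sub>o Y"
  "src (TW X) = X" "tgt (TW X) = X" "src (TWi X) = X" "tgt (TWi X) = X"
  by (simp_all add: EV_def COEV_def BR_def BRi_def TW_def TWi_def)

lemma arr_gen [simp]:
  "arr (EV X)" "arr (COEV X)" "arr (BR X Y)" "arr (BRi X Y)" "arr (TW X)" "arr (TWi X)"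
  using arrow_inverse_of[OF braid_iso] arrow_inverse_of[OF twist_iso]
  by (simp_all add: EV_def COEV_def BR_def BRi_def TW_def TWi_def ev_in_Hom coev_in_Hom)

lemma BR_inverse [simp]: "BRi X Y \<bullet> BR X Y = Id (X \<otimes>\<^sub>o Y)" "BR X Y \<bullet> BRi X Y = Id (Y \<otimes>\<^sub>o X)"
  using arrow_inverse_of[OF braid_iso] by (simp_all add: BR_def BRi_def)

lemma TW_inverse [simp]: "TWi X \<bullet> TW X = Id X" "TW X \<bullet> TWi X = Id X"
  using arrow_inverse_of[OF twist_iso] by (simp_all add: TW_def TWi_def)

lemma zigzag_arrow: "(X \<rhd> EV X) \<bullet> (COEV X \<lhd> X) = Id X"
proof (rule arrow_eqI)
  show "raw ((X \<rhd> EV X) \<bullet> (COEV X \<lhd> X)) = raw (Id X)"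
    using zigzag[of X] ev_in_Hom[of X] coev_in_Hom[of X]
    by (simp add: raw_comp raw_whisker raw_Id) (simp add: EV_def COEV_def)
qed simp_all

lemma zigzag_dual_arrow: "(EV X \<lhd> X\<^sup>\<star>) \<bullet> (X\<^sup>\<star> \<rhd> COEV X) = Id (X\<^sup>\<star>)"
proof (rule arrow_eqI)
  show "raw ((EV X \<lhd> X\<^sup>\<star>) \<bullet> (X\<^sup>\<star> \<rhd> COEV X)) = raw (Id (X\<^sup>\<star>))"
    using zigzag_dual[of X] ev_in_Hom[of X] coev_in_Hom[of X]
    by (simp add: raw_comp raw_whisker raw_Id) (simp add: EV_def COEV_def)
qed simp_all

text \<open>
  The transpose of \<open>f\<close>.  It is characterised by \<open>ev_dual\<close> since a map into \<open>X\<^sup>\<star>\<close> can be recovered from its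
  pairing with \<open>X\<close> (\<open>ev_inject\<close>); functoriality and naturality statements about duals are
  all reduced to identities between pairings.
\<close>

definition dual_arrow :: "('o, 'm) arrow \<Rightarrow> ('o, 'm) arrow" where
  "dual_arrow f = (EV (tgt f) \<lhd> (src f)\<^sup>\<star>) \<bullet> ((tgt f)\<^sup>\<star> \<rhd> (f \<lhd> (src f)\<^sup>\<star>)) \<bullet> ((tgt f)\<^sup>\<star> \<rhd> COEV (src f))"

lemma src_tgt_dual [simp]: "src (dual_arrow f) = (tgt f)\<^sup>\<star>" "tgt (dual_arrow f) = (src f)\<^sup>\<star>"
  by (simp_all add: dual_arrow_def)

lemma arr_dual [simp]: "arr (dual_arrow f) \<longleftrightarrow> arr f"
  by (simp add: dual_arrow_def)

lemma dual_mor_in_Hom: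
  assumes "f \<in> carrier (Hom C X Y)"
  shows "dual_mor C X Y f \<in> carrier (Hom C (Y\<^sup>\<star>) (X\<^sup>\<star>))"
    and "dual_arrow (arrow X f Y) = arrow (Y\<^sup>\<star>) (dual_mor C X Y f) (X\<^sup>\<star>)"
proof -
  have r: "raw (EV Y) = ev C Y" "raw (COEV X) = coev C X"
    using ev_in_Hom[of Y] coev_in_Hom[of X] by (simp_all add: EV_def COEV_def)
  have "raw (dual_arrow (arrow X f Y)) = dual_mor C X Y f"
    using assms r by (simp add: dual_arrow_def raw_comp raw_whisker dual_mor_def)
  with assms show "dual_mor C X Y f \<in> carrier (Hom C (Y\<^sup>\<star>) (X\<^sup>\<star>))"
    and "dual_arrow (arrow X f Y) = arrow (Y\<^sup>\<star>) (dual_mor C X Y f) (X\<^sup>\<star>)"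
    using raw_in_Hom[of "dual_arrow (arrow X f Y)"] arrow_raw[of "dual_arrow (arrow X f Y)"]
    by simp_all
qed

lemma ev_dual:
  assumes "arr f" "src f = X" "tgt f = Y"
  shows "EV X \<bullet> (dual_arrow f \<lhd> X) = EV Y \<bullet> (Y\<^sup>\<star> \<rhd> f)"
proof -
  have 1: "EV X \<bullet> (EV Y \<lhd> (X\<^sup>\<star> \<otimes>\<^sub>o X)) = EV Y \<bullet> ((Y\<^sup>\<star> \<otimes>\<^sub>o Y) \<rhd> EV X)"
    using exchange[of "EV Y" "EV X"] by simp
  have 2: "((Y\<^sup>\<star> \<otimes>\<^sub>o Y) \<rhd> EV X) \<bullet> (Y\<^sup>\<star> \<rhd> (f \<lhd> (X\<^sup>\<star> \<otimes>\<^sub>o X))) = (Y\<^sup>\<star> \<rhd> f) \<bullet> ((Y\<^sup>\<star> \<otimes>\<^sub>o X) \<rhd> EV X)"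
    using exchange_at[of f "EV X" "Y\<^sup>\<star>" \<I> \<I>] assms by simp
  have 3: "((Y\<^sup>\<star> \<otimes>\<^sub>o X) \<rhd> EV X) \<bullet> (Y\<^sup>\<star> \<rhd> (COEV X \<lhd> X)) = Id (Y\<^sup>\<star> \<otimes>\<^sub>o X)"
    using arg_cong[OF zigzag_arrow[of X], of "\<lambda>h. Y\<^sup>\<star> \<rhd> h"] by simp
  show ?thesis
    using assms by (simp add: dual_arrow_def reassoc[OF 1] reassoc[OF 2] 3)
qed

lemma coev_dual:
  assumes "arr f" "src f = X" "tgt f = Y"
  shows "(f \<lhd> X\<^sup>\<star>) \<bullet> COEV X = (Y \<rhd> dual_arrow f) \<bullet> COEV Y"
proof -
  have 1: "((Y \<otimes>\<^sub>o Y\<^sup>\<star>) \<rhd> COEV X) \<bullet> COEV Y = (COEV Y \<lhd> (X \<otimes>\<^sub>o X\<^sup>\<star>)) \<bullet> COEV X"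
    using exchange[of "COEV Y" "COEV X"] by simp
  have 2: "((Y \<otimes>\<^sub>o Y\<^sup>\<star>) \<rhd> (f \<lhd> X\<^sup>\<star>)) \<bullet> (COEV Y \<lhd> (X \<otimes>\<^sub>o X\<^sup>\<star>)) = (COEV Y \<lhd> (Y \<otimes>\<^sub>o X\<^sup>\<star>)) \<bullet> (f \<lhd> X\<^sup>\<star>)"
    using exchange_at[of "COEV Y" f \<I> \<I> "X\<^sup>\<star>"] assms by simp
  have 3: "(Y \<rhd> (EV Y \<lhd> X\<^sup>\<star>)) \<bullet> (COEV Y \<lhd> (Y \<otimes>\<^sub>o X\<^sup>\<star>)) = Id (Y \<otimes>\<^sub>o X\<^sup>\<star>)"
    using arg_cong[OF zigzag_arrow[of Y], of "\<lambda>h. h \<lhd> X\<^sup>\<star>"]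
    by simp
  show ?thesis
    using assms by (simp add: dual_arrow_def 1 reassoc[OF 2] reassoc[OF 3])
qed

text \<open>
  Bending the strand \<open>X\<close> back with \<open>coev\<^sub>X\<close> recovers \<open>f\<close> from \<open>ev\<^sub>X (f \<otimes> id\<^sub>X)\<close> by the zigzag identity.
\<close>

lemma ev_inject:
  assumes f: "f \<in> homset Z (X\<^sup>\<star>)" and g: "g \<in> homset Z (X\<^sup>\<star>)"
    and eq: "EV X \<bullet> (f \<lhd> X) = EV X \<bullet> (g \<lhd> X)"
  shows "f = g"
proof -
  have "((EV X \<bullet> (h \<lhd> X)) \<lhd> X\<^sup>\<star>) \<bullet> (Z \<rhd> COEV X) = h" if h: "h \<in> homset Z (X\<^sup>\<star>)" for h
  proof -
    have "(h \<lhd> (X \<otimes>\<^sub>o X\<^sup>\<star>)) \<bullet> (Z \<rhd> COEV X) = (X\<^sup>\<star> \<rhd> COEV X) \<bullet> h"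
      using exchange[of h "COEV X"] homsetD[OF h] by simp
    then show ?thesis using homsetD[OF h] by (simp add: reassoc[OF zigzag_dual_arrow])
  qed
  with f g eq show ?thesis by metis
qed

lemma dual_comp:
  assumes "arr f" "arr g" "src g = tgt f"
  shows "dual_arrow (g \<bullet> f) = dual_arrow f \<bullet> dual_arrow g"
proof (rule ev_inject)
  let ?X = "src f" and ?Y = "tgt f" and ?Z = "tgt g"
  show "dual_arrow (g \<bullet> f) \<in> homset (?Z\<^sup>\<star>) (?X\<^sup>\<star>)" "dual_arrow f \<bullet> dual_arrow g \<in> homset (?Z\<^sup>\<star>) (?X\<^sup>\<star>)"
    using assms by (simp_all add: homset_def)
  have "(?Y\<^sup>\<star> \<rhd> f) \<bullet> (dual_arrow g \<lhd> ?X) = (dual_arrow g \<lhd> ?Y) \<bullet> (?Z\<^sup>\<star> \<rhd> f)"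
    using exchange[of "dual_arrow g" f] assms by simp
  then show "EV ?X \<bullet> (dual_arrow (g \<bullet> f) \<lhd> ?X) = EV ?X \<bullet> ((dual_arrow f \<bullet> dual_arrow g) \<lhd> ?X)"
    using assms reassoc[OF ev_dual[of f ?X ?Y]] ev_dual[of "g \<bullet> f" ?X ?Z]
      reassoc[OF ev_dual[of g ?Y ?Z]]
    by simp
qed

lemma dual_Id [simp]: "dual_arrow (Id X) = Id (X\<^sup>\<star>)"
  by (simp add: dual_arrow_def zigzag_dual_arrow)

lemma dual_Zero [simp]: "dual_arrow (Zero X Y) = Zero (Y\<^sup>\<star>) (X\<^sup>\<star>)"
  by (simp add: dual_arrow_def)

lemma dual_scale [simp]:
  "arr f \<Longrightarrow> a \<in> carrier (base C) \<Longrightarrow> dual_arrow (scale a f) = scale a (dual_arrow f)"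
  by (simp add: dual_arrow_def)

lemma raw_BR: "raw (BR X Y) = braid C X Y"
  using arr_gen(3)[of X Y] by (simp add: BR_def)

lemma BR_natural_left:
  assumes "arr f" "src f = X" "tgt f = X'"
  shows "BR X' Y \<bullet> (f \<lhd> Y) = (Y \<rhd> f) \<bullet> BR X Y"
proof (rule arrow_eqI)
  show "raw (BR X' Y \<bullet> (f \<lhd> Y)) = raw ((Y \<rhd> f) \<bullet> BR X Y)"
    using assms braid_natural[of "raw f" X X' "\<i>\<d> Y" Y Y] raw_in_Hom[of f] ident_in_Hom[of Y]
    by (simp add: raw_comp raw_whisker raw_BR)
qed (use assms in simp_all)

lemma BR_natural_right:
  assumes "arr g" "src g = Y" "tgt g = Y'"
  shows "BR X Y' \<bullet> (X \<rhd> g) = (g \<lhd> X) \<bullet> BR X Y"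
proof (rule arrow_eqI)
  show "raw (BR X Y' \<bullet> (X \<rhd> g)) = raw ((g \<lhd> X) \<bullet> BR X Y)"
    using assms braid_natural[of "\<i>\<d> X" X X "raw g" Y Y'] raw_in_Hom[of g] ident_in_Hom[of X]
    by (simp add: raw_comp raw_whisker raw_BR)
qed (use assms in simp_all)

lemma BRi_natural_left:
  assumes "arr f" "src f = X" "tgt f = X'"
  shows "(f \<lhd> Y) \<bullet> BRi X Y = BRi X' Y \<bullet> (Y \<rhd> f)"
proof -
  have "(f \<lhd> Y) \<bullet> BRi X Y = BRi X' Y \<bullet> (BR X' Y \<bullet> (f \<lhd> Y)) \<bullet> BRi X Y"
    using assms by (simp add: reassoc[OF BR_inverse(1)] del: comp_assoc flip: comp_assoc)
  then show ?thesis using assms by (simp add: BR_natural_left)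
qed

lemma BRi_natural_right:
  assumes "arr g" "src g = Y" "tgt g = Y'"
  shows "(X \<rhd> g) \<bullet> BRi X Y = BRi X Y' \<bullet> (g \<lhd> X)"
proof -
  have "(X \<rhd> g) \<bullet> BRi X Y = BRi X Y' \<bullet> (BR X Y' \<bullet> (X \<rhd> g)) \<bullet> BRi X Y"
    using assms by (simp add: reassoc[OF BR_inverse(1)] del: comp_assoc flip: comp_assoc)
  then show ?thesis using assms by (simp add: BR_natural_right)
qed

lemma BR_tensor_right: "BR X (Y \<otimes>\<^sub>o Z) = (Y \<rhd> BR X Z) \<bullet> (BR X Y \<lhd> Z)"
proof (rule arrow_eqI)
  show "raw (BR X (Y \<otimes>\<^sub>o Z)) = raw ((Y \<rhd> BR X Z) \<bullet> (BR X Y \<lhd> Z))"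
    by (simp add: raw_comp raw_whisker raw_BR braid_tensor_right)
qed simp_all

lemma BR_tensor_left: "BR (X \<otimes>\<^sub>o Y) Z = (BR X Z \<lhd> Y) \<bullet> (X \<rhd> BR Y Z)"
proof (rule arrow_eqI)
  show "raw (BR (X \<otimes>\<^sub>o Y) Z) = raw ((BR X Z \<lhd> Y) \<bullet> (X \<rhd> BR Y Z))"
    by (simp add: raw_comp raw_whisker raw_BR braid_tensor_left)
qed simp_all

lemma whisker_inverse:
  assumes "g \<bullet> f = Id X" "src g = tgt f"
  shows "(Y \<rhd> g) \<bullet> (Y \<rhd> f) = Id (Y \<otimes>\<^sub>o X)" "(g \<lhd> Y) \<bullet> (f \<lhd> Y) = Id (X \<otimes>\<^sub>o Y)"
    and "(Y \<rhd> g) \<bullet> (Y \<rhd> f) \<bullet> h = Id (Y \<otimes>\<^sub>o X) \<bullet> h"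
    and "(g \<lhd> Y) \<bullet> (f \<lhd> Y) \<bullet> h = Id (X \<otimes>\<^sub>o Y) \<bullet> h"
    and "(Y \<rhd> (g \<lhd> Z)) \<bullet> (Y \<rhd> (f \<lhd> Z)) = Id (Y \<otimes>\<^sub>o X \<otimes>\<^sub>o Z)"
    and "(Y \<rhd> (g \<lhd> Z)) \<bullet> (Y \<rhd> (f \<lhd> Z)) \<bullet> h = Id (Y \<otimes>\<^sub>o X \<otimes>\<^sub>o Z) \<bullet> h"
proof -
  show 1: "(Y \<rhd> g) \<bullet> (Y \<rhd> f) = Id (Y \<otimes>\<^sub>o X)"
    using lw_comp[OF assms(2), of Y] assms(1) by simp
  show 2: "(g \<lhd> Y) \<bullet> (f \<lhd> Y) = Id (X \<otimes>\<^sub>o Y)"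
    using rw_comp[OF assms(2), of Y] assms(1) by simp
  show 3: "(Y \<rhd> (g \<lhd> Z)) \<bullet> (Y \<rhd> (f \<lhd> Z)) = Id (Y \<otimes>\<^sub>o X \<otimes>\<^sub>o Z)"
    using arg_cong[OF rw_comp[OF assms(2), of Z], of "\<lambda>h. Y \<rhd> h"] assms by (simp del: rw_comp)
  show "(Y \<rhd> g) \<bullet> (Y \<rhd> f) \<bullet> h = Id (Y \<otimes>\<^sub>o X) \<bullet> h" by (rule reassoc[OF 1])
  show "(g \<lhd> Y) \<bullet> (f \<lhd> Y) \<bullet> h = Id (X \<otimes>\<^sub>o Y) \<bullet> h" by (rule reassoc[OF 2])
  show "(Y \<rhd> (g \<lhd> Z)) \<bullet> (Y \<rhd> (f \<lhd> Z)) \<bullet> h = Id (Y \<otimes>\<^sub>o X \<otimes>\<^sub>o Z) \<bullet> h" by (rule reassoc[OF 3])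
qed

lemmas cancel_inverses [simp] =
  reassoc[OF BR_inverse(1)] reassoc[OF BR_inverse(2)]
  reassoc[OF TW_inverse(1)] reassoc[OF TW_inverse(2)]
  whisker_inverse[OF BR_inverse(1)] whisker_inverse[OF BR_inverse(2)]
  whisker_inverse[OF TW_inverse(1)] whisker_inverse[OF TW_inverse(2)]

lemma BRi_tensor_left: "BRi (X \<otimes>\<^sub>o Y) Z = (X \<rhd> BRi Y Z) \<bullet> (BRi X Z \<lhd> Y)"
  by (rule left_inverse_eq_right_inverse[OF BR_inverse(1)]) (simp_all add: BR_tensor_left)

lemma BRi_tensor_right: "BRi X (Y \<otimes>\<^sub>o Z) = (BRi X Y \<lhd> Z) \<bullet> (Y \<rhd> BRi X Z)"
  by (rule left_inverse_eq_right_inverse[OF BR_inverse(1)]) (simp_all add: BR_tensor_right)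

text \<open>
  This is how unit coherence is obtained: the hexagon identities and the twist axiom make \<open>c\<^bsub>\<I>,X\<^esub>\<close>, \<open>c\<^bsub>X,\<I>\<^esub>\<close> and
  \<open>\<theta>\<^sub>\<I>\<close> idempotent, and they are invertible.
\<close>

lemma idempotent_iso:
  assumes "g \<bullet> f = Id X" "f \<bullet> f = f" "arr f" "src f = X" "tgt f = X"
  shows "f = Id X"
  using assms by (metis comp_Id_left comp_assoc)

lemma BR_unit [simp]: "BR \<I> X = Id X" "BR X \<I> = Id X" "BRi \<I> X = Id X" "BRi X \<I> = Id X"
proof -
  show 1: "BR \<I> X = Id X"
  proof (rule idempotent_iso[of "BRi \<I> X"])
    have "BR \<I> X = BR (\<I> \<otimes>\<^sub>o \<I>) X" by simp
    also have "\<dots> = BR \<I> X \<bullet> BR \<I> X" by (subst BR_tensor_left) simp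
    finally show "BR \<I> X \<bullet> BR \<I> X = BR \<I> X" by (rule sym)
    show "BRi \<I> X \<bullet> BR \<I> X = Id X" by (subst BR_inverse) simp
  qed simp_all
  show 2: "BR X \<I> = Id X"
  proof (rule idempotent_iso[of "BRi X \<I>"])
    have "BR X \<I> = BR X (\<I> \<otimes>\<^sub>o \<I>)" by simp
    also have "\<dots> = BR X \<I> \<bullet> BR X \<I>" by (subst BR_tensor_right) simp
    finally show "BR X \<I> \<bullet> BR X \<I> = BR X \<I>" by (rule sym)
    show "BRi X \<I> \<bullet> BR X \<I> = Id X" by (subst BR_inverse) simp
  qed simp_all
  show "BRi \<I> X = Id X" using BR_inverse(1)[of \<I> X] 1 by simp
  show "BRi X \<I> = Id X" using BR_inverse(1)[of X \<I>] 2 by simp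
qed

lemma TW_natural:
  assumes "arr f" "src f = X" "tgt f = Y"
  shows "TW Y \<bullet> f = f \<bullet> TW X"
proof (rule arrow_eqI)
  have r: "raw (TW X) = twist C X" for X
    using arr_gen(5)[of X] by (simp add: TW_def)
  show "raw (TW Y \<bullet> f) = raw (f \<bullet> TW X)"
    using assms twist_natural[of "raw f" X Y] raw_in_Hom[of f] by (simp add: raw_comp r)
qed (use assms in simp_all)

lemma TWi_natural:
  assumes "arr f" "src f = X" "tgt f = Y"
  shows "TWi Y \<bullet> f = f \<bullet> TWi X"
proof -
  have "TWi Y \<bullet> f = TWi Y \<bullet> (f \<bullet> TW X) \<bullet> TWi X" using assms by simp
  then show ?thesis using TW_natural[OF assms, symmetric] assms by simp
qed

lemma TW_tensor: "TW (X \<otimes>\<^sub>o Y) = BR Y X \<bullet> BR X Y \<bullet> (TW X \<lhd> Y) \<bullet> (X \<rhd> TW Y)"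
proof -
  have "twist C X \<in> carrier (Hom C X X)" "twist C Y \<in> carrier (Hom C Y Y)"
    using twist_iso by (auto simp: is_iso_def inverse_morphisms_def)
  note t = tensor_in_Hom[OF this]
  have b: "braid C X Y \<in> carrier (Hom C (X \<otimes>\<^sub>o Y) (Y \<otimes>\<^sub>o X))" "braid C Y X \<in> carrier (Hom C (Y \<otimes>\<^sub>o X) (X \<otimes>\<^sub>o Y))"
    using braid_iso by (auto simp: is_iso_def inverse_morphisms_def)
  note c = compose_in_Hom[OF t b(1)]
  have "TW (X \<otimes>\<^sub>o Y) = BR Y X \<bullet> BR X Y \<bullet> arrow (X \<otimes>\<^sub>o Y) (twist C X \<otimes>\<^sub>m twist C Y) (X \<otimes>\<^sub>o Y)"
    by (simp only: BR_def TW_def twist_tensor comp_arrow[OF t b(1)] comp_arrow[OF c b(2)])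
  also have "arrow (X \<otimes>\<^sub>o Y) (twist C X \<otimes>\<^sub>m twist C Y) (X \<otimes>\<^sub>o Y) = (TW X \<lhd> Y) \<bullet> (X \<rhd> TW Y)"
    unfolding TW_def using twist_iso
    by (intro tensor_arrow) (auto simp: is_iso_def inverse_morphisms_def)
  finally show ?thesis .
qed

lemma TW_unit [simp]: "TW \<I> = Id \<I>"
proof (rule idempotent_iso)
  have "TW \<I> = TW (\<I> \<otimes>\<^sub>o \<I>)" by simp
  also have "\<dots> = TW \<I> \<bullet> TW \<I>" by (subst TW_tensor) simp
  finally show "TW \<I> \<bullet> TW \<I> = TW \<I>" by (rule sym)
  show "TWi \<I> \<bullet> TW \<I> = Id \<I>" by simp
  show "arr (TW \<I>)" by simp
  show "src (TW \<I>) = \<I>" by simp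
  show "tgt (TW \<I>) = \<I>" by simp
qed

lemma TW_dual: "TW (X\<^sup>\<star>) = dual_arrow (TW X)"
proof -
  have "twist C X \<in> carrier (Hom C X X)"
    using twist_iso by (auto simp: is_iso_def inverse_morphisms_def)
  from dual_mor_in_Hom(2)[OF this] show ?thesis by (simp only: TW_def twist_dual)
qed

end

section \<open>The right duality\<close>

context ribbon_linear_category
begin

text \<open>
  The right duality of a ribbon category is a twisted version of the pair \<open>(bev, bcoev)\<close>, which only
  involves the braiding.  A zigzag of \<open>bev\<close> and \<open>bcoev\<close> has one crossing of each sign, and they cancel.
\<close>

definition bev where "bev X = EV X \<bullet> BR X (X\<^sup>\<star>)"
definition bcoev where "bcoev X = BRi (X\<^sup>\<star>) X \<bullet> COEV X"
definition EVT where "EVT X = bev X \<bullet> (TW X \<lhd> X\<^sup>\<star>)"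
definition COEVT where "COEVT X = (X\<^sup>\<star> \<rhd> TWi X) \<bullet> bcoev X"

lemma src_tgt_evt [simp]:
  "src (bev X) = X \<otimes>\<^sub>o X\<^sup>\<star>" "tgt (bev X) = \<I>" "src (bcoev X) = \<I>" "tgt (bcoev X) = X\<^sup>\<star> \<otimes>\<^sub>o X"
  "src (EVT X) = X \<otimes>\<^sub>o X\<^sup>\<star>" "tgt (EVT X) = \<I>" "src (COEVT X) = \<I>" "tgt (COEVT X) = X\<^sup>\<star> \<otimes>\<^sub>o X"
  by (simp_all add: bev_def bcoev_def EVT_def COEVT_def)

lemma arr_evt [simp]: "arr (bev X)" "arr (bcoev X)" "arr (EVT X)" "arr (COEVT X)"
  by (simp_all add: bev_def bcoev_def EVT_def COEVT_def)

text \<open>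
  Naturality of \<open>c\<^sub>X\<close> slides the strand \<open>X\<close> over \<open>bcoev\<close>, at the price of an inverse crossing
  \<open>c\<^bsub>X,X\<^esub>\<^sup>-\<^sup>1\<close>; naturality of \<open>c\<^sup>-\<^sup>1\<close> slides it back under \<open>ev\<close>, and what is left is the zigzag of \<open>ev\<close> and \<open>coev\<close>.
\<close>

lemma braided_zigzag: "(bev X \<lhd> X) \<bullet> (X \<rhd> bcoev X) = Id X"
proof -
  have "(X\<^sup>\<star> \<rhd> BR X X) \<bullet> (BR X (X\<^sup>\<star>) \<lhd> X) \<bullet> (X \<rhd> bcoev X) = bcoev X \<lhd> X"
    using BR_natural_right[of "bcoev X" \<I> "X\<^sup>\<star> \<otimes>\<^sub>o X" X] by (simp add: BR_tensor_right)
  then have "(X\<^sup>\<star> \<rhd> BRi X X) \<bullet> (X\<^sup>\<star> \<rhd> BR X X) \<bullet> (BR X (X\<^sup>\<star>) \<lhd> X) \<bullet> (X \<rhd> bcoev X)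
      = (X\<^sup>\<star> \<rhd> BRi X X) \<bullet> (bcoev X \<lhd> X)"
    by simp
  then have 1: "(BR X (X\<^sup>\<star>) \<lhd> X) \<bullet> (X \<rhd> bcoev X) = (X\<^sup>\<star> \<rhd> BRi X X) \<bullet> (bcoev X \<lhd> X)"
    by simp
  have 2: "(EV X \<lhd> X) \<bullet> (X\<^sup>\<star> \<rhd> BRi X X) \<bullet> (BRi (X\<^sup>\<star>) X \<lhd> X) = X \<rhd> EV X"
    using BRi_natural_left[of "EV X" "X\<^sup>\<star> \<otimes>\<^sub>o X" \<I> X] by (simp add: BRi_tensor_left)
  have "(bev X \<lhd> X) \<bullet> (X \<rhd> bcoev X) = (EV X \<lhd> X) \<bullet> (BR X (X\<^sup>\<star>) \<lhd> X) \<bullet> (X \<rhd> bcoev X)"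
    by (simp add: bev_def)
  also have "\<dots> = (EV X \<lhd> X) \<bullet> (X\<^sup>\<star> \<rhd> BRi X X) \<bullet> (BRi (X\<^sup>\<star>) X \<lhd> X) \<bullet> (COEV X \<lhd> X)"
    by (subst 1) (simp add: bcoev_def)
  also have "\<dots> = Id X" by (simp add: reassoc3[OF 2] zigzag_arrow)
  finally show ?thesis .
qed

lemma braided_zigzag_dual: "(X\<^sup>\<star> \<rhd> bev X) \<bullet> (bcoev X \<lhd> X\<^sup>\<star>) = Id (X\<^sup>\<star>)"
proof -
  let ?D = "X\<^sup>\<star>"
  have 1: "(BR ?D ?D \<lhd> X) \<bullet> (?D \<rhd> BR X ?D) \<bullet> (bcoev X \<lhd> ?D) = ?D \<rhd> bcoev X"
    using BR_natural_left[of "bcoev X" \<I> "?D \<otimes>\<^sub>o X" ?D] by (simp add: BR_tensor_left)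
  have "(BRi ?D ?D \<lhd> X) \<bullet> (BR ?D ?D \<lhd> X) \<bullet> (?D \<rhd> BR X ?D) \<bullet> (bcoev X \<lhd> ?D)
      = (BRi ?D ?D \<lhd> X) \<bullet> (?D \<rhd> bcoev X)"
    by (simp only: 1)
  then have 2: "(?D \<rhd> BR X ?D) \<bullet> (bcoev X \<lhd> ?D) = (BRi ?D ?D \<lhd> X) \<bullet> (?D \<rhd> bcoev X)"
    by simp
  have 3: "(?D \<rhd> EV X) \<bullet> (BRi ?D ?D \<lhd> X) \<bullet> (?D \<rhd> BRi ?D X) = EV X \<lhd> ?D"
    using BRi_natural_right[of "EV X" "?D \<otimes>\<^sub>o X" \<I> ?D] by (simp add: BRi_tensor_right)
  have "(?D \<rhd> bev X) \<bullet> (bcoev X \<lhd> ?D) = (?D \<rhd> EV X) \<bullet> (?D \<rhd> BR X ?D) \<bullet> (bcoev X \<lhd> ?D)"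
    by (simp add: bev_def)
  also have "\<dots> = (?D \<rhd> EV X) \<bullet> (BRi ?D ?D \<lhd> X) \<bullet> (?D \<rhd> BRi ?D X) \<bullet> (?D \<rhd> COEV X)"
    by (subst 2) (simp add: bcoev_def)
  also have "\<dots> = Id ?D" by (simp add: reassoc3[OF 3] zigzag_dual_arrow)
  finally show ?thesis .
qed

text \<open>
  The twist in \<open>evt\<close> and the inverse twist in \<open>coevt\<close> slide to the two ends of the strand and cancel.
\<close>

lemma evt_zigzag: "(EVT X \<lhd> X) \<bullet> (X \<rhd> COEVT X) = Id X"
proof -
  have 1: "(TW X \<lhd> (X\<^sup>\<star> \<otimes>\<^sub>o X)) \<bullet> (X \<rhd> COEVT X) = (X \<rhd> COEVT X) \<bullet> TW X"
    using exchange[of "TW X" "COEVT X"] by simp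
  have 2: "(bev X \<lhd> X) \<bullet> ((X \<otimes>\<^sub>o X\<^sup>\<star>) \<rhd> TWi X) = TWi X \<bullet> (bev X \<lhd> X)"
    using exchange[of "bev X" "TWi X"] by simp
  have "(EVT X \<lhd> X) \<bullet> (X \<rhd> COEVT X) = (bev X \<lhd> X) \<bullet> (X \<rhd> COEVT X) \<bullet> TW X"
    by (simp add: EVT_def 1)
  also have "\<dots> = TWi X \<bullet> (bev X \<lhd> X) \<bullet> (X \<rhd> bcoev X) \<bullet> TW X"
    by (simp add: COEVT_def reassoc[OF 2])
  also have "\<dots> = Id X" by (simp add: reassoc[OF braided_zigzag])
  finally show ?thesis .
qed

lemma evt_zigzag_dual: "(X\<^sup>\<star> \<rhd> EVT X) \<bullet> (COEVT X \<lhd> X\<^sup>\<star>) = Id (X\<^sup>\<star>)"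
  by (simp add: EVT_def COEVT_def braided_zigzag_dual)

text \<open>
  A copairing is determined by the pairing to which it is dual: both \<open>f\<close> and \<open>g\<close> are obtained from the
  composite of \<open>f \<otimes> g\<close> with \<open>e\<close> applied to the two middle strands.  This is the tool for identifying
  right coevaluations of duals and of tensor products.
\<close>

lemma coev_unique:
  assumes "arr e" "src e = U \<otimes>\<^sub>o V" "tgt e = \<I>" and f: "f \<in> homset \<I> (V \<otimes>\<^sub>o U)" and g: "g \<in> homset \<I> (V \<otimes>\<^sub>o U)"
    and zf: "(V \<rhd> e) \<bullet> (f \<lhd> V) = Id V" and zg: "(e \<lhd> U) \<bullet> (U \<rhd> g) = Id U"
  shows "f = g"
proof -
  note [simp] = assms(1-3) homsetD[OF f] homsetD[OF g]
  have 1: "((V \<otimes>\<^sub>o U) \<rhd> g) \<bullet> f = (f \<lhd> (V \<otimes>\<^sub>o U)) \<bullet> g"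
    using exchange[of f g] by simp
  have 2: "(V \<rhd> (e \<lhd> U)) \<bullet> ((V \<otimes>\<^sub>o U) \<rhd> g) = Id (V \<otimes>\<^sub>o U)"
    using arg_cong[OF zg, of "\<lambda>h. V \<rhd> h"] by simp
  have 3: "(V \<rhd> (e \<lhd> U)) \<bullet> (f \<lhd> (V \<otimes>\<^sub>o U)) = Id (V \<otimes>\<^sub>o U)"
    using arg_cong[OF zf, of "\<lambda>h. h \<lhd> U"] by simp
  have "f = (V \<rhd> (e \<lhd> U)) \<bullet> ((V \<otimes>\<^sub>o U) \<rhd> g) \<bullet> f" by (simp add: reassoc[OF 2])
  also have "\<dots> = (V \<rhd> (e \<lhd> U)) \<bullet> (f \<lhd> (V \<otimes>\<^sub>o U)) \<bullet> g" by (simp add: 1)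
  also have "\<dots> = g" by (simp add: reassoc[OF 3])
  finally show ?thesis .
qed

lemma evt_natural:
  assumes "arr f" "src f = X" "tgt f = Y"
  shows "EVT X \<bullet> (X \<rhd> dual_arrow f) = EVT Y \<bullet> (f \<lhd> Y\<^sup>\<star>)"
proof -
  have 1: "(TW X \<lhd> X\<^sup>\<star>) \<bullet> (X \<rhd> dual_arrow f) = (X \<rhd> dual_arrow f) \<bullet> (TW X \<lhd> Y\<^sup>\<star>)"
    using exchange[of "TW X" "dual_arrow f"] assms by simp
  have 2: "BR X (X\<^sup>\<star>) \<bullet> (X \<rhd> dual_arrow f) = (dual_arrow f \<lhd> X) \<bullet> BR X (Y\<^sup>\<star>)"
    using assms by (intro BR_natural_right) simp_all
  have 3: "(Y\<^sup>\<star> \<rhd> f) \<bullet> BR X (Y\<^sup>\<star>) = BR Y (Y\<^sup>\<star>) \<bullet> (f \<lhd> Y\<^sup>\<star>)"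
    using assms by (intro BR_natural_left[symmetric]) simp_all
  have 4: "(f \<lhd> Y\<^sup>\<star>) \<bullet> (TW X \<lhd> Y\<^sup>\<star>) = (TW Y \<lhd> Y\<^sup>\<star>) \<bullet> (f \<lhd> Y\<^sup>\<star>)"
    using arg_cong[OF TW_natural[OF assms], of "\<lambda>h. h \<lhd> Y\<^sup>\<star>"] assms by simp
  show ?thesis
    by (simp add: EVT_def bev_def 1 reassoc[OF 2] reassoc[OF ev_dual[OF assms]] reassoc[OF 3] 4)
qed

lemma coevt_natural:
  assumes "arr f" "src f = X" "tgt f = Y"
  shows "(dual_arrow f \<lhd> Y) \<bullet> COEVT Y = (X\<^sup>\<star> \<rhd> f) \<bullet> COEVT X"
proof -
  have 1: "(dual_arrow f \<lhd> Y) \<bullet> (Y\<^sup>\<star> \<rhd> TWi Y) = (X\<^sup>\<star> \<rhd> TWi Y) \<bullet> (dual_arrow f \<lhd> Y)"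
    using exchange[of "dual_arrow f" "TWi Y"] assms by simp
  have 2: "(dual_arrow f \<lhd> Y) \<bullet> BRi (Y\<^sup>\<star>) Y = BRi (X\<^sup>\<star>) Y \<bullet> (Y \<rhd> dual_arrow f)"
    using assms by (intro BRi_natural_left) simp_all
  have 3: "BRi (X\<^sup>\<star>) Y \<bullet> (f \<lhd> X\<^sup>\<star>) = (X\<^sup>\<star> \<rhd> f) \<bullet> BRi (X\<^sup>\<star>) X"
    using assms by (intro BRi_natural_right[symmetric]) simp_all
  have 4: "(X\<^sup>\<star> \<rhd> TWi Y) \<bullet> (X\<^sup>\<star> \<rhd> f) = (X\<^sup>\<star> \<rhd> f) \<bullet> (X\<^sup>\<star> \<rhd> TWi X)"
    using arg_cong[OF TWi_natural[OF assms], of "\<lambda>h. X\<^sup>\<star> \<rhd> h"] assms by simp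
  show ?thesis
    by (simp add: COEVT_def bcoev_def reassoc[OF 1] reassoc[OF 2] coev_dual[OF assms, symmetric]
      reassoc[OF 3] reassoc[OF 4])
qed

text \<open>
  The double braiding and the twists on the left assemble to \<open>\<theta>\<close> of \<open>X\<^sup>\<star> \<otimes> X\<close>, which by naturality passes
  through \<open>ev\<^sub>X\<close> and becomes \<open>\<theta>\<^sub>\<I> = id\<close>.
\<close>

lemma evt_braid_twist: "EVT X \<bullet> BR (X\<^sup>\<star>) X \<bullet> (TW (X\<^sup>\<star>) \<lhd> X) = EV X"
proof -
  have 1: "(TW X \<lhd> X\<^sup>\<star>) \<bullet> BR (X\<^sup>\<star>) X = BR (X\<^sup>\<star>) X \<bullet> (X\<^sup>\<star> \<rhd> TW X)"
    by (rule BR_natural_right[symmetric]) simp_all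
  have 2: "(X\<^sup>\<star> \<rhd> TW X) \<bullet> (TW (X\<^sup>\<star>) \<lhd> X) = (TW (X\<^sup>\<star>) \<lhd> X) \<bullet> (X\<^sup>\<star> \<rhd> TW X)"
    using exchange[of "TW (X\<^sup>\<star>)" "TW X"] by simp
  have "EVT X \<bullet> BR (X\<^sup>\<star>) X \<bullet> (TW (X\<^sup>\<star>) \<lhd> X) = EV X \<bullet> TW (X\<^sup>\<star> \<otimes>\<^sub>o X)"
    by (simp add: EVT_def bev_def reassoc[OF 1] 2 TW_tensor)
  also have "\<dots> = EV X" using TW_natural[of "EV X" "X\<^sup>\<star> \<otimes>\<^sub>o X" \<I>] by simp
  finally show ?thesis .
qed

text \<open>
  The axiom \<open>\<theta>\<^bsub>X\<^sup>\<star>\<^esub> = (\<theta>\<^sub>X)\<^sup>\<star>\<close> allows the twist to be moved from one leg of \<open>coev\<^sub>X\<close> to the other, where it meets the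
  inverse twist of \<open>coevt\<^sub>X\<close>.
\<close>

lemma braid_twist_coevt: "(X \<rhd> TW (X\<^sup>\<star>)) \<bullet> BR (X\<^sup>\<star>) X \<bullet> COEVT X = COEV X"
proof -
  have 1: "BR (X\<^sup>\<star>) X \<bullet> (X\<^sup>\<star> \<rhd> TWi X) = (TWi X \<lhd> X\<^sup>\<star>) \<bullet> BR (X\<^sup>\<star>) X"
    by (rule BR_natural_right) simp_all
  have 2: "(X \<rhd> TW (X\<^sup>\<star>)) \<bullet> (TWi X \<lhd> X\<^sup>\<star>) = (TWi X \<lhd> X\<^sup>\<star>) \<bullet> (X \<rhd> TW (X\<^sup>\<star>))"
    using exchange[of "TWi X" "TW (X\<^sup>\<star>)"] by simp
  have 3: "(X \<rhd> TW (X\<^sup>\<star>)) \<bullet> COEV X = (TW X \<lhd> X\<^sup>\<star>) \<bullet> COEV X"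
    using coev_dual[of "TW X" X X] by (simp add: TW_dual)
  show ?thesis by (simp add: COEVT_def bcoev_def reassoc[OF 1] reassoc[OF 2] 3)
qed

text \<open>
  Equality of the left and the right quantum dimension: composition with \<open>c\<^bsub>X\<^sup>\<star>,X\<^esub>\<close> and \<open>\<theta>\<^bsub>X\<^sup>\<star>\<^esub>\<close> turns \<open>evt\<^sub>X\<close> into
  \<open>ev\<^sub>X\<close> and \<open>coevt\<^sub>X\<close> into \<open>coev\<^sub>X\<close>.
\<close>

lemma ev_coevt: "EV X \<bullet> COEVT X = EVT X \<bullet> COEV X"
proof -
  have 1: "BR (X\<^sup>\<star>) X \<bullet> (TW (X\<^sup>\<star>) \<lhd> X) = (X \<rhd> TW (X\<^sup>\<star>)) \<bullet> BR (X\<^sup>\<star>) X"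
    by (rule BR_natural_left) simp_all
  have "EV X \<bullet> COEVT X = (EVT X \<bullet> BR (X\<^sup>\<star>) X \<bullet> (TW (X\<^sup>\<star>) \<lhd> X)) \<bullet> COEVT X"
    by (simp only: evt_braid_twist)
  also have "\<dots> = EVT X \<bullet> COEV X"
    by (simp add: reassoc[OF 1] braid_twist_coevt)
  finally show ?thesis .
qed

text \<open>
  The map \<open>Z \<rightarrow> W\<^sup>\<star>\<close> corresponding to a pairing \<open>h : Z \<otimes> W \<rightarrow> \<I>\<close>.  Both \<open>\<beta>\<close> and \<open>\<gamma>\<close> are of this kind, for
  \<open>evt\<^sub>X\<close> and for \<open>ev\<^sub>X (id \<otimes> ev\<^sub>Y \<otimes> id)\<close>.
\<close>

lemma ev_mate:
  assumes "arr h" "src h = Z \<otimes>\<^sub>o W" "tgt h = \<I>"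
  shows "EV W \<bullet> (((h \<lhd> W\<^sup>\<star>) \<bullet> (Z \<rhd> COEV W)) \<lhd> W) = h"
proof -
  have 1: "EV W \<bullet> (h \<lhd> (W\<^sup>\<star> \<otimes>\<^sub>o W)) = h \<bullet> ((Z \<otimes>\<^sub>o W) \<rhd> EV W)"
    using exchange[of h "EV W"] assms by simp
  have 2: "((Z \<otimes>\<^sub>o W) \<rhd> EV W) \<bullet> (Z \<rhd> (COEV W \<lhd> W)) = Id (Z \<otimes>\<^sub>o W)"
    using arg_cong[OF zigzag_arrow[of W], of "\<lambda>h. Z \<rhd> h"] by simp
  show ?thesis using assms by (simp add: reassoc[OF 1] 2)
qed

definition BETA where "BETA X = (EVT X \<lhd> (X\<^sup>\<star>)\<^sup>\<star>) \<bullet> (X \<rhd> COEV (X\<^sup>\<star>))"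

definition GAMMA where
  "GAMMA X Y = ((EV X \<bullet> (X\<^sup>\<star> \<rhd> (EV Y \<lhd> X))) \<lhd> (Y \<otimes>\<^sub>o X)\<^sup>\<star>) \<bullet> ((X\<^sup>\<star> \<otimes>\<^sub>o Y\<^sup>\<star>) \<rhd> COEV (Y \<otimes>\<^sub>o X))"

lemma src_tgt_mates [simp]:
  "src (BETA X) = X" "tgt (BETA X) = (X\<^sup>\<star>)\<^sup>\<star>"
  "src (GAMMA X Y) = X\<^sup>\<star> \<otimes>\<^sub>o Y\<^sup>\<star>" "tgt (GAMMA X Y) = (Y \<otimes>\<^sub>o X)\<^sup>\<star>"
  by (simp_all add: BETA_def GAMMA_def)

lemma arr_mates [simp]: "arr (BETA X)" "arr (GAMMA X Y)"
  by (simp_all add: BETA_def GAMMA_def)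

lemma ev_beta: "EV (X\<^sup>\<star>) \<bullet> (BETA X \<lhd> X\<^sup>\<star>) = EVT X"
  unfolding BETA_def by (rule ev_mate) simp_all

lemma ev_gamma:
  "EV (Y \<otimes>\<^sub>o X) \<bullet> (GAMMA X Y \<lhd> (Y \<otimes>\<^sub>o X)) = EV X \<bullet> (X\<^sup>\<star> \<rhd> (EV Y \<lhd> X))"
  unfolding GAMMA_def by (rule ev_mate) simp_all

lemma beta_natural:
  assumes "arr f" "src f = X" "tgt f = Y"
  shows "dual_arrow (dual_arrow f) \<bullet> BETA X = BETA Y \<bullet> f"
proof (rule ev_inject)
  note [simp] = assms
  show "dual_arrow (dual_arrow f) \<bullet> BETA X \<in> homset X ((Y\<^sup>\<star>)\<^sup>\<star>)" "BETA Y \<bullet> f \<in> homset X ((Y\<^sup>\<star>)\<^sup>\<star>)"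
    by (simp_all add: homset_def)
  have 1: "EV (Y\<^sup>\<star>) \<bullet> (dual_arrow (dual_arrow f) \<lhd> Y\<^sup>\<star>) = EV (X\<^sup>\<star>) \<bullet> ((X\<^sup>\<star>)\<^sup>\<star> \<rhd> dual_arrow f)"
    by (rule ev_dual) simp_all
  have 2: "((X\<^sup>\<star>)\<^sup>\<star> \<rhd> dual_arrow f) \<bullet> (BETA X \<lhd> Y\<^sup>\<star>) = (BETA X \<lhd> X\<^sup>\<star>) \<bullet> (X \<rhd> dual_arrow f)"
    using exchange[of "BETA X" "dual_arrow f"] by simp
  show "EV (Y\<^sup>\<star>) \<bullet> ((dual_arrow (dual_arrow f) \<bullet> BETA X) \<lhd> Y\<^sup>\<star>) = EV (Y\<^sup>\<star>) \<bullet> ((BETA Y \<bullet> f) \<lhd> Y\<^sup>\<star>)"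
    by (simp add: reassoc[OF 1] 2 reassoc[OF ev_beta] evt_natural[OF assms])
qed

lemma evt_beta: "EVT (X\<^sup>\<star>) \<bullet> (X\<^sup>\<star> \<rhd> BETA X) = EV X"
proof -
  have 1: "(TW (X\<^sup>\<star>) \<lhd> (X\<^sup>\<star>)\<^sup>\<star>) \<bullet> (X\<^sup>\<star> \<rhd> BETA X) = (X\<^sup>\<star> \<rhd> BETA X) \<bullet> (TW (X\<^sup>\<star>) \<lhd> X)"
    using exchange[of "TW (X\<^sup>\<star>)" "BETA X"] by simp
  have 2: "BR (X\<^sup>\<star>) ((X\<^sup>\<star>)\<^sup>\<star>) \<bullet> (X\<^sup>\<star> \<rhd> BETA X) = (BETA X \<lhd> X\<^sup>\<star>) \<bullet> BR (X\<^sup>\<star>) X"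
    by (rule BR_natural_right) simp_all
  have "EVT (X\<^sup>\<star>) \<bullet> (X\<^sup>\<star> \<rhd> BETA X) = EVT X \<bullet> BR (X\<^sup>\<star>) X \<bullet> (TW (X\<^sup>\<star>) \<lhd> X)"
    unfolding EVT_def[of "X\<^sup>\<star>"] bev_def by (simp add: 1 reassoc[OF 2] reassoc[OF ev_beta])
  then show ?thesis by (simp add: evt_braid_twist)
qed

text \<open>
  By \<open>evt_beta\<close> the right-hand side is a copairing for \<open>evt\<close> of \<open>X\<^sup>\<star>\<close>, because \<open>coev\<^sub>X\<close> is one for \<open>ev\<^sub>X\<close>.
\<close>

lemma coevt_dual: "COEVT (X\<^sup>\<star>) = (BETA X \<lhd> X\<^sup>\<star>) \<bullet> COEV X"
proof (rule coev_unique[of "EVT (X\<^sup>\<star>)"])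
  show "((X\<^sup>\<star>)\<^sup>\<star> \<rhd> EVT (X\<^sup>\<star>)) \<bullet> (COEVT (X\<^sup>\<star>) \<lhd> (X\<^sup>\<star>)\<^sup>\<star>) = Id ((X\<^sup>\<star>)\<^sup>\<star>)"
    by (rule evt_zigzag_dual)
  have "(EVT (X\<^sup>\<star>) \<lhd> X\<^sup>\<star>) \<bullet> (X\<^sup>\<star> \<rhd> (BETA X \<lhd> X\<^sup>\<star>)) = EV X \<lhd> X\<^sup>\<star>"
    using arg_cong[OF evt_beta[of X], of "\<lambda>h. h \<lhd> X\<^sup>\<star>"] by simp
  then show "(EVT (X\<^sup>\<star>) \<lhd> X\<^sup>\<star>) \<bullet> (X\<^sup>\<star> \<rhd> ((BETA X \<lhd> X\<^sup>\<star>) \<bullet> COEV X)) = Id (X\<^sup>\<star>)"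
    by (simp add: reassoc[of "EVT (X\<^sup>\<star>) \<lhd> X\<^sup>\<star>"] zigzag_dual_arrow)
qed (simp_all add: homset_def)

lemma gamma_natural_left:
  assumes "arr f" "src f = X" "tgt f = X'"
  shows "GAMMA X Y \<bullet> (dual_arrow f \<lhd> Y\<^sup>\<star>) = dual_arrow (Y \<rhd> f) \<bullet> GAMMA X' Y"
proof (rule ev_inject)
  note [simp] = assms
  show "GAMMA X Y \<bullet> (dual_arrow f \<lhd> Y\<^sup>\<star>) \<in> homset (X'\<^sup>\<star> \<otimes>\<^sub>o Y\<^sup>\<star>) ((Y \<otimes>\<^sub>o X)\<^sup>\<star>)"
    "dual_arrow (Y \<rhd> f) \<bullet> GAMMA X' Y \<in> homset (X'\<^sup>\<star> \<otimes>\<^sub>o Y\<^sup>\<star>) ((Y \<otimes>\<^sub>o X)\<^sup>\<star>)"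
    by (simp_all add: homset_def)
  have 1: "(X\<^sup>\<star> \<rhd> (EV Y \<lhd> X)) \<bullet> (dual_arrow f \<lhd> (Y\<^sup>\<star> \<otimes>\<^sub>o Y \<otimes>\<^sub>o X)) = (dual_arrow f \<lhd> X) \<bullet> (X'\<^sup>\<star> \<rhd> (EV Y \<lhd> X))"
    using exchange[of "dual_arrow f" "EV Y \<lhd> X"] by simp
  have 2: "EV (Y \<otimes>\<^sub>o X) \<bullet> (dual_arrow (Y \<rhd> f) \<lhd> (Y \<otimes>\<^sub>o X)) = EV (Y \<otimes>\<^sub>o X') \<bullet> (((Y \<otimes>\<^sub>o X')\<^sup>\<star> \<otimes>\<^sub>o Y) \<rhd> f)"
    using ev_dual[of "Y \<rhd> f" "Y \<otimes>\<^sub>o X" "Y \<otimes>\<^sub>o X'"] by simp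
  have 3: "(((Y \<otimes>\<^sub>o X')\<^sup>\<star> \<otimes>\<^sub>o Y) \<rhd> f) \<bullet> (GAMMA X' Y \<lhd> (Y \<otimes>\<^sub>o X)) = (GAMMA X' Y \<lhd> (Y \<otimes>\<^sub>o X')) \<bullet> ((X'\<^sup>\<star> \<otimes>\<^sub>o Y\<^sup>\<star> \<otimes>\<^sub>o Y) \<rhd> f)"
    using exchange[of "GAMMA X' Y" "Y \<rhd> f"] by simp
  have 4: "(X'\<^sup>\<star> \<rhd> (EV Y \<lhd> X')) \<bullet> ((X'\<^sup>\<star> \<otimes>\<^sub>o Y\<^sup>\<star> \<otimes>\<^sub>o Y) \<rhd> f) = (X'\<^sup>\<star> \<rhd> f) \<bullet> (X'\<^sup>\<star> \<rhd> (EV Y \<lhd> X))"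
    using exchange_at[of "EV Y" f "X'\<^sup>\<star>" \<I> \<I>] by simp
  show "EV (Y \<otimes>\<^sub>o X) \<bullet> ((GAMMA X Y \<bullet> (dual_arrow f \<lhd> Y\<^sup>\<star>)) \<lhd> (Y \<otimes>\<^sub>o X))
      = EV (Y \<otimes>\<^sub>o X) \<bullet> ((dual_arrow (Y \<rhd> f) \<bullet> GAMMA X' Y) \<lhd> (Y \<otimes>\<^sub>o X))"
    by (simp add: reassoc[OF ev_gamma] 1 reassoc[OF ev_dual[OF assms]] reassoc[OF 2] 3 4)
qed

lemma gamma_natural_right:
  assumes "arr g" "src g = Y" "tgt g = Y'"
  shows "GAMMA X Y \<bullet> (X\<^sup>\<star> \<rhd> dual_arrow g) = dual_arrow (g \<lhd> X) \<bullet> GAMMA X Y'"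
proof (rule ev_inject)
  note [simp] = assms
  show "GAMMA X Y \<bullet> (X\<^sup>\<star> \<rhd> dual_arrow g) \<in> homset (X\<^sup>\<star> \<otimes>\<^sub>o Y'\<^sup>\<star>) ((Y \<otimes>\<^sub>o X)\<^sup>\<star>)"
    "dual_arrow (g \<lhd> X) \<bullet> GAMMA X Y' \<in> homset (X\<^sup>\<star> \<otimes>\<^sub>o Y'\<^sup>\<star>) ((Y \<otimes>\<^sub>o X)\<^sup>\<star>)"
    by (simp_all add: homset_def)
  have 1: "(X\<^sup>\<star> \<rhd> (EV Y \<lhd> X)) \<bullet> (X\<^sup>\<star> \<rhd> (dual_arrow g \<lhd> (Y \<otimes>\<^sub>o X)))
      = (X\<^sup>\<star> \<rhd> (EV Y' \<lhd> X)) \<bullet> ((X\<^sup>\<star> \<otimes>\<^sub>o Y'\<^sup>\<star>) \<rhd> (g \<lhd> X))"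
    using arg_cong[OF ev_dual[OF assms], of "\<lambda>h. X\<^sup>\<star> \<rhd> (h \<lhd> X)"] by simp
  have 2: "EV (Y \<otimes>\<^sub>o X) \<bullet> (dual_arrow (g \<lhd> X) \<lhd> (Y \<otimes>\<^sub>o X)) = EV (Y' \<otimes>\<^sub>o X) \<bullet> ((Y' \<otimes>\<^sub>o X)\<^sup>\<star> \<rhd> (g \<lhd> X))"
    by (rule ev_dual) simp_all
  have 3: "((Y' \<otimes>\<^sub>o X)\<^sup>\<star> \<rhd> (g \<lhd> X)) \<bullet> (GAMMA X Y' \<lhd> (Y \<otimes>\<^sub>o X)) = (GAMMA X Y' \<lhd> (Y' \<otimes>\<^sub>o X)) \<bullet> ((X\<^sup>\<star> \<otimes>\<^sub>o Y'\<^sup>\<star>) \<rhd> (g \<lhd> X))"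
    using exchange[of "GAMMA X Y'" "g \<lhd> X"] by simp
  show "EV (Y \<otimes>\<^sub>o X) \<bullet> ((GAMMA X Y \<bullet> (X\<^sup>\<star> \<rhd> dual_arrow g)) \<lhd> (Y \<otimes>\<^sub>o X))
      = EV (Y \<otimes>\<^sub>o X) \<bullet> ((dual_arrow (g \<lhd> X) \<bullet> GAMMA X Y') \<lhd> (Y \<otimes>\<^sub>o X))"
    by (simp add: reassoc[OF ev_gamma] 1 reassoc[OF 2] 3)
qed

text \<open>
  Compatibility of \<open>bev\<close> with tensor products up to the double braiding.  The crossing \<open>c\<^bsub>X,Y\<^esub>\<close> slides
  through the braiding with \<open>X\<^sup>\<star> \<otimes> Y\<^sup>\<star>\<close> and is absorbed by \<open>ev\<^sub>Y\<close>; the other crossing \<open>c\<^bsub>Y,X\<^esub>\<close> completes a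
  crossing of \<open>Y\<close> with \<open>X \<otimes> X\<^sup>\<star>\<close>, which disappears when \<open>bev\<^sub>X\<close> is slid through.
\<close>

lemma double_braiding_ev:
  "EV X \<bullet> (X\<^sup>\<star> \<rhd> (EV Y \<lhd> X)) \<bullet> BR (Y \<otimes>\<^sub>o X) (X\<^sup>\<star> \<otimes>\<^sub>o Y\<^sup>\<star>) \<bullet> (BR X Y \<lhd> (X\<^sup>\<star> \<otimes>\<^sub>o Y\<^sup>\<star>)) \<bullet> (BR Y X \<lhd> (X\<^sup>\<star> \<otimes>\<^sub>o Y\<^sup>\<star>))
    = bev Y \<bullet> (Y \<rhd> (bev X \<lhd> Y\<^sup>\<star>))"
proof -
  let ?Z = "X\<^sup>\<star> \<otimes>\<^sub>o Y\<^sup>\<star>"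
  have a: "BR (Y \<otimes>\<^sub>o X) ?Z \<bullet> (BR X Y \<lhd> ?Z) = (?Z \<rhd> BR X Y) \<bullet> BR (X \<otimes>\<^sub>o Y) ?Z"
    by (rule BR_natural_left) simp_all
  have "(EV Y \<lhd> X) \<bullet> (Y\<^sup>\<star> \<rhd> BR X Y) \<bullet> (BR X (Y\<^sup>\<star>) \<lhd> Y) = X \<rhd> EV Y"
    using BR_natural_right[of "EV Y" "Y\<^sup>\<star> \<otimes>\<^sub>o Y" \<I> X] by (simp add: BR_tensor_right)
  from arg_cong[OF this, of "\<lambda>h. X\<^sup>\<star> \<rhd> h"]
  have b: "(X\<^sup>\<star> \<rhd> (EV Y \<lhd> X)) \<bullet> (?Z \<rhd> BR X Y) \<bullet> (X\<^sup>\<star> \<rhd> (BR X (Y\<^sup>\<star>) \<lhd> Y)) = (X\<^sup>\<star> \<otimes>\<^sub>o X) \<rhd> EV Y"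
    by simp
  have c: "BR (X \<otimes>\<^sub>o Y) ?Z = (X\<^sup>\<star> \<rhd> (BR X (Y\<^sup>\<star>) \<lhd> Y)) \<bullet> (BR X (X\<^sup>\<star>) \<lhd> (Y\<^sup>\<star> \<otimes>\<^sub>o Y)) \<bullet> (X \<rhd> BR Y ?Z)"
    unfolding BR_tensor_left[of X Y] BR_tensor_right[of X] by simp
  have d: "((X\<^sup>\<star> \<otimes>\<^sub>o X) \<rhd> EV Y) \<bullet> (BR X (X\<^sup>\<star>) \<lhd> (Y\<^sup>\<star> \<otimes>\<^sub>o Y)) = BR X (X\<^sup>\<star>) \<bullet> ((X \<otimes>\<^sub>o X\<^sup>\<star>) \<rhd> EV Y)"
    using exchange[of "BR X (X\<^sup>\<star>)" "EV Y"] by simp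
  have e: "(X \<rhd> BR Y ?Z) \<bullet> (BR Y X \<lhd> ?Z) = ((X \<otimes>\<^sub>o X\<^sup>\<star>) \<rhd> BR Y (Y\<^sup>\<star>)) \<bullet> (BR Y (X \<otimes>\<^sub>o X\<^sup>\<star>) \<lhd> Y\<^sup>\<star>)"
    unfolding BR_tensor_right by simp
  have f: "bev X \<bullet> ((X \<otimes>\<^sub>o X\<^sup>\<star>) \<rhd> bev Y) = bev Y \<bullet> (bev X \<lhd> (Y \<otimes>\<^sub>o Y\<^sup>\<star>))"
    using exchange[of "bev X" "bev Y"] by simp
  have "(bev X \<lhd> Y) \<bullet> BR Y (X \<otimes>\<^sub>o X\<^sup>\<star>) = Y \<rhd> bev X"
    using BR_natural_right[of "bev X" "X \<otimes>\<^sub>o X\<^sup>\<star>" \<I> Y] by simp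
  from arg_cong[OF this, of "\<lambda>h. h \<lhd> Y\<^sup>\<star>"]
  have g: "(bev X \<lhd> (Y \<otimes>\<^sub>o Y\<^sup>\<star>)) \<bullet> (BR Y (X \<otimes>\<^sub>o X\<^sup>\<star>) \<lhd> Y\<^sup>\<star>) = Y \<rhd> (bev X \<lhd> Y\<^sup>\<star>)"
    by simp
  have "EV X \<bullet> (X\<^sup>\<star> \<rhd> (EV Y \<lhd> X)) \<bullet> BR (Y \<otimes>\<^sub>o X) ?Z \<bullet> (BR X Y \<lhd> ?Z) \<bullet> (BR Y X \<lhd> ?Z)
      = EV X \<bullet> BR X (X\<^sup>\<star>) \<bullet> ((X \<otimes>\<^sub>o X\<^sup>\<star>) \<rhd> EV Y) \<bullet> (X \<rhd> BR Y ?Z) \<bullet> (BR Y X \<lhd> ?Z)"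
    by (simp add: reassoc[OF a] c reassoc3[OF b] reassoc[OF d])
  also have "\<dots> = (EV X \<bullet> BR X (X\<^sup>\<star>)) \<bullet> ((X \<otimes>\<^sub>o X\<^sup>\<star>) \<rhd> (EV Y \<bullet> BR Y (Y\<^sup>\<star>))) \<bullet> (BR Y (X \<otimes>\<^sub>o X\<^sup>\<star>) \<lhd> Y\<^sup>\<star>)"
    by (simp add: e)
  also have "\<dots> = bev Y \<bullet> (Y \<rhd> (bev X \<lhd> Y\<^sup>\<star>))"
    by (simp only: bev_def[symmetric] reassoc[OF f] comp_assoc g)
  finally show ?thesis .
qed

text \<open>
  The twist of \<open>Y \<otimes> X\<close> contributes exactly the double braiding removed by \<open>double_braiding_ev\<close>; with \<open>\<gamma>\<close> as
  identification of the duals, \<open>evt\<close> is therefore strictly monoidal.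
\<close>

lemma evt_gamma: "EVT (Y \<otimes>\<^sub>o X) \<bullet> ((Y \<otimes>\<^sub>o X) \<rhd> GAMMA X Y) = EVT Y \<bullet> (Y \<rhd> (EVT X \<lhd> Y\<^sup>\<star>))"
proof -
  let ?Z = "X\<^sup>\<star> \<otimes>\<^sub>o Y\<^sup>\<star>"
  have 1: "(TW (Y \<otimes>\<^sub>o X) \<lhd> (Y \<otimes>\<^sub>o X)\<^sup>\<star>) \<bullet> ((Y \<otimes>\<^sub>o X) \<rhd> GAMMA X Y) = ((Y \<otimes>\<^sub>o X) \<rhd> GAMMA X Y) \<bullet> (TW (Y \<otimes>\<^sub>o X) \<lhd> ?Z)"
    using exchange[of "TW (Y \<otimes>\<^sub>o X)" "GAMMA X Y"] by simp
  have 2: "BR (Y \<otimes>\<^sub>o X) ((Y \<otimes>\<^sub>o X)\<^sup>\<star>) \<bullet> ((Y \<otimes>\<^sub>o X) \<rhd> GAMMA X Y) = (GAMMA X Y \<lhd> (Y \<otimes>\<^sub>o X)) \<bullet> BR (Y \<otimes>\<^sub>o X) ?Z"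
    by (rule BR_natural_right) simp_all
  have 3: "TW (Y \<otimes>\<^sub>o X) \<lhd> ?Z = (BR X Y \<lhd> ?Z) \<bullet> (BR Y X \<lhd> ?Z) \<bullet> (TW Y \<lhd> (X \<otimes>\<^sub>o ?Z)) \<bullet> (Y \<rhd> (TW X \<lhd> ?Z))"
    by (simp add: TW_tensor)
  have 4: "(Y \<rhd> (bev X \<lhd> Y\<^sup>\<star>)) \<bullet> (TW Y \<lhd> (X \<otimes>\<^sub>o ?Z)) = (TW Y \<lhd> Y\<^sup>\<star>) \<bullet> (Y \<rhd> (bev X \<lhd> Y\<^sup>\<star>))"
    using exchange[of "TW Y" "bev X \<lhd> Y\<^sup>\<star>"] by simp
  have "EVT (Y \<otimes>\<^sub>o X) \<bullet> ((Y \<otimes>\<^sub>o X) \<rhd> GAMMA X Y)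
      = EV X \<bullet> (X\<^sup>\<star> \<rhd> (EV Y \<lhd> X)) \<bullet> BR (Y \<otimes>\<^sub>o X) ?Z \<bullet> (TW (Y \<otimes>\<^sub>o X) \<lhd> ?Z)"
    unfolding EVT_def[of "Y \<otimes>\<^sub>o X"] bev_def by (simp add: 1 reassoc[OF 2] reassoc[OF ev_gamma])
  also have "\<dots> = (EV X \<bullet> (X\<^sup>\<star> \<rhd> (EV Y \<lhd> X)) \<bullet> BR (Y \<otimes>\<^sub>o X) ?Z \<bullet> (BR X Y \<lhd> ?Z) \<bullet> (BR Y X \<lhd> ?Z))
      \<bullet> (TW Y \<lhd> (X \<otimes>\<^sub>o ?Z)) \<bullet> (Y \<rhd> (TW X \<lhd> ?Z))"
    by (simp only: 3 comp_assoc)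
  also have "\<dots> = bev Y \<bullet> (TW Y \<lhd> Y\<^sup>\<star>) \<bullet> (Y \<rhd> (bev X \<lhd> Y\<^sup>\<star>)) \<bullet> (Y \<rhd> (TW X \<lhd> ?Z))"
    by (simp only: double_braiding_ev reassoc[OF 4] comp_assoc)
  also have "\<dots> = EVT Y \<bullet> (Y \<rhd> (EVT X \<lhd> Y\<^sup>\<star>))"
    by (simp add: EVT_def)
  finally show ?thesis .
qed

lemma coevt_tensor:
  "COEVT (Y \<otimes>\<^sub>o X) = (GAMMA X Y \<lhd> (Y \<otimes>\<^sub>o X)) \<bullet> (X\<^sup>\<star> \<rhd> (COEVT Y \<lhd> X)) \<bullet> COEVT X"
proof (rule coev_unique[of "EVT (Y \<otimes>\<^sub>o X)"])
  show "((Y \<otimes>\<^sub>o X)\<^sup>\<star> \<rhd> EVT (Y \<otimes>\<^sub>o X)) \<bullet> (COEVT (Y \<otimes>\<^sub>o X) \<lhd> (Y \<otimes>\<^sub>o X)\<^sup>\<star>) = Id ((Y \<otimes>\<^sub>o X)\<^sup>\<star>)"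
    by (rule evt_zigzag_dual)
  have 1: "(EVT (Y \<otimes>\<^sub>o X) \<lhd> (Y \<otimes>\<^sub>o X)) \<bullet> ((Y \<otimes>\<^sub>o X) \<rhd> (GAMMA X Y \<lhd> (Y \<otimes>\<^sub>o X)))
      = (EVT Y \<lhd> (Y \<otimes>\<^sub>o X)) \<bullet> (Y \<rhd> (EVT X \<lhd> (Y\<^sup>\<star> \<otimes>\<^sub>o Y \<otimes>\<^sub>o X)))"
    using arg_cong[OF evt_gamma[of Y X], of "\<lambda>h. h \<lhd> (Y \<otimes>\<^sub>o X)"] by simp
  have 2: "(Y \<rhd> (EVT X \<lhd> (Y\<^sup>\<star> \<otimes>\<^sub>o Y \<otimes>\<^sub>o X))) \<bullet> ((Y \<otimes>\<^sub>o X \<otimes>\<^sub>o X\<^sup>\<star>) \<rhd> (COEVT Y \<lhd> X))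
      = (Y \<rhd> (COEVT Y \<lhd> X)) \<bullet> (Y \<rhd> (EVT X \<lhd> X))"
    using exchange_at[of "EVT X" "COEVT Y" Y \<I> X] by simp
  have 3: "(EVT Y \<lhd> (Y \<otimes>\<^sub>o X)) \<bullet> (Y \<rhd> (COEVT Y \<lhd> X)) = Id (Y \<otimes>\<^sub>o X)"
    using arg_cong[OF evt_zigzag[of Y], of "\<lambda>h. h \<lhd> X"] by simp
  have 4: "(Y \<rhd> (EVT X \<lhd> X)) \<bullet> ((Y \<otimes>\<^sub>o X) \<rhd> COEVT X) = Id (Y \<otimes>\<^sub>o X)"
    using arg_cong[OF evt_zigzag[of X], of "\<lambda>h. Y \<rhd> h"] by simp
  show "(EVT (Y \<otimes>\<^sub>o X) \<lhd> (Y \<otimes>\<^sub>o X)) \<bullet>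
      ((Y \<otimes>\<^sub>o X) \<rhd> ((GAMMA X Y \<lhd> (Y \<otimes>\<^sub>o X)) \<bullet> (X\<^sup>\<star> \<rhd> (COEVT Y \<lhd> X)) \<bullet> COEVT X)) = Id (Y \<otimes>\<^sub>o X)"
    by (simp add: reassoc[OF 1] reassoc[OF 2] reassoc[OF 3] 3 4)
qed (simp_all add: homset_def)

end

section \<open>Simple objects and isomorphism classes\<close>

context linear_category
begin

text \<open>
  The kernel \<open>k\<close> of \<open>f\<close> is a subobject of the simple object \<open>X\<close>.  It cannot be all of \<open>X\<close> since \<open>f \<noteq> 0\<close>, so it
  vanishes and \<open>f\<close> is monic; as a nonzero subobject of the simple object \<open>Y\<close>, it is an isomorphism.
\<close>

lemma schur:
  assumes ab: "abelian_category C" and X: "simple_object C X" and Y: "simple_object C Y"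
    and f: "f \<in> carrier (Hom C X Y)" and nz: "f \<noteq> \<zero>\<^bsub>Hom C X Y\<^esub>"
  shows "is_iso C X Y f"
proof -
  obtain N k where ker: "is_kernel C X Y f N k"
    using ab f unfolding abelian_category_def by blast
  then have k: "k \<in> carrier (Hom C N X)" and fk: "f \<cdot> k = \<zero>\<^bsub>Hom C N Y\<^esub>"
    and univ: "\<And>W h. h \<in> carrier (Hom C W X) \<Longrightarrow> f \<cdot> h = \<zero>\<^bsub>Hom C W Y\<^esub> \<Longrightarrow>
      \<exists>!u. u \<in> carrier (Hom C W N) \<and> k \<cdot> u = h"
    unfolding is_kernel_def by blast+
  have "monic C N X k"
    unfolding monic_def
  proof (intro conjI allI ballI impI k)
    fix W g h
    assume g: "g \<in> carrier (Hom C W N)" and h: "h \<in> carrier (Hom C W N)" and eq: "k \<cdot> g = k \<cdot> h"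
    have "f \<cdot> (k \<cdot> g) = \<zero>\<^bsub>Hom C W Y\<^esub>"
      using compose_assoc[OF g k f] fk compose_zero_left[OF g] by simp
    from univ[OF compose_in_Hom[OF g k] this] g h eq show "g = h" by metis
  qed
  with X consider "zero_object C N" | "is_iso C N X k" unfolding simple_object_def by blast
  then show ?thesis
  proof cases
    case 1
    have "monic C X Y f"
      unfolding monic_def
    proof (intro conjI allI ballI impI f)
      fix W g h
      assume g: "g \<in> carrier (Hom C W X)" and h: "h \<in> carrier (Hom C W X)" and eq: "f \<cdot> g = f \<cdot> h"
      let ?d = "g \<oplus>\<^bsub>Hom C W X\<^esub> (\<ominus>\<^bsub>Hom C W X\<^esub> h)"
      have "f \<cdot> ?d = \<zero>\<^bsub>Hom C W Y\<^esub>"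
      proof -
        have "f \<cdot> ?d = (f \<cdot> h) \<oplus>\<^bsub>Hom C W Y\<^esub> (f \<cdot> (\<ominus>\<^bsub>Hom C W X\<^esub> h))"
          using compose_add_right[OF g _ f] h eq by simp
        also have "\<dots> = f \<cdot> (h \<oplus>\<^bsub>Hom C W X\<^esub> (\<ominus>\<^bsub>Hom C W X\<^esub> h))"
          using compose_add_right[OF h _ f] h by simp
        also have "\<dots> = \<zero>\<^bsub>Hom C W Y\<^esub>"
          using h by (simp add: Hom.M.r_neg compose_zero_right[OF f])
        finally show ?thesis .
      qed
      then obtain u where u: "u \<in> carrier (Hom C W N)" "k \<cdot> u = ?d"
        using univ[of ?d W] g h by auto
      then have "u = \<zero>\<^bsub>Hom C W N\<^esub>" using 1 Hom.M.zero_closed unfolding zero_object_def by blast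
      then have "?d = \<zero>\<^bsub>Hom C W X\<^esub>" using u(2) compose_zero_right[OF k] by simp
      then show "g = h" using g h Hom.M.minus_equality[of W X g "\<ominus>\<^bsub>Hom C W X\<^esub> h"] by simp
    qed
    with X Y show ?thesis unfolding simple_object_def by blast
  next
    case 2
    then obtain g where g: "g \<in> carrier (Hom C X N)" "k \<cdot> g = \<i>\<d> X"
      unfolding is_iso_def inverse_morphisms_def by blast
    have "f = f \<cdot> (k \<cdot> g)" using g(2) ident_right[OF f] by simp
    also have "\<dots> = \<zero>\<^bsub>Hom C X Y\<^esub>"
      using compose_assoc[OF g(1) k f] fk compose_zero_left[OF g(1)] by simp
    finally show ?thesis using nz by contradiction
  qed
qed

lemma isomorphicI:
  assumes "f \<in> homset X Y" "g \<in> homset Y X" "g \<bullet> f = Id X" "f \<bullet> g = Id Y"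
  shows "isomorphic C X Y"
proof -
  have "raw g \<cdot> raw f = \<i>\<d> X" "raw f \<cdot> raw g = \<i>\<d> Y"
    using assms by (metis homsetD raw_comp raw_Id)+
  then show ?thesis
    using raw_in_Hom'[OF assms(1)] raw_in_Hom'[OF assms(2)]
    unfolding isomorphic_def is_iso_def inverse_morphisms_def by blast
qed

lemma isomorphicE:
  assumes "isomorphic C X Y"
  obtains f g where "f \<in> homset X Y" "g \<in> homset Y X" "g \<bullet> f = Id X" "f \<bullet> g = Id Y"
proof -
  obtain f where f: "is_iso C X Y f" using assms unfolding isomorphic_def by blast
  show ?thesis
    using that[of "arrow X f Y" "arrow Y (inverse_of C X Y f) X"] arrow_inverse_of[OF f]
    by (simp add: homset_def)
qed

lemma isomorphic_refl: "isomorphic C X X"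
  by (rule isomorphicI[of "Id X" _ _ "Id X"]) (simp_all add: homset_def)

lemma isomorphic_sym: "isomorphic C X Y \<Longrightarrow> isomorphic C Y X"
  by (metis isomorphicE isomorphicI)

lemma isomorphic_trans:
  assumes "isomorphic C X Y" "isomorphic C Y Z"
  shows "isomorphic C X Z"
proof -
  obtain f g where fg: "f \<in> homset X Y" "g \<in> homset Y X" "g \<bullet> f = Id X" "f \<bullet> g = Id Y"
    using assms(1) by (rule isomorphicE)
  obtain f' g' where fg': "f' \<in> homset Y Z" "g' \<in> homset Z Y" "g' \<bullet> f' = Id Y" "f' \<bullet> g' = Id Z"
    using assms(2) by (rule isomorphicE)
  note [simp] = homsetD[OF fg(1)] homsetD[OF fg(2)] homsetD[OF fg'(1)] homsetD[OF fg'(2)]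
  show ?thesis
    by (rule isomorphicI[of "f' \<bullet> f" _ _ "g \<bullet> g'"])
      (simp_all add: homset_def reassoc[OF fg'(3)] reassoc[OF fg(4)] fg fg')
qed

lemma zero_objectI:
  assumes "Id X = Zero X X"
  shows "zero_object C X"
proof -
  have id: "\<i>\<d> X = \<zero>\<^bsub>Hom C X X\<^esub>" using assms by (metis raw_Id raw_Zero)
  have "f = \<zero>\<^bsub>Hom C Y X\<^esub>" if "f \<in> carrier (Hom C Y X)" for f Y
    using ident_left[OF that] compose_zero_left[OF that] id by simp
  moreover have "f = \<zero>\<^bsub>Hom C X Y\<^esub>" if "f \<in> carrier (Hom C X Y)" for f Y
    using ident_right[OF that] compose_zero_right[OF that] id by simp
  ultimately show ?thesis unfolding zero_object_def by (metis Hom.M.zero_closed)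
qed

lemma dsum_imp_direct_sum:
  assumes d: "dsum I F X P Q"
  shows "direct_sum C I F X (\<lambda>i. raw (P i)) (\<lambda>i. raw (Q i))"
proof -
  have pq: "raw (P i) \<cdot> raw (Q j) = (if i = j then \<i>\<d> (F i) else \<zero>\<^bsub>Hom C (F j) (F i)\<^esub>)"
    if "i \<in> I" "j \<in> I" for i j
  proof -
    have "raw (P i) \<cdot> raw (Q j) = raw (P i \<bullet> Q j)"
      using dsumD(2)[OF d that(1)] dsumD(3)[OF d that(2)] by (subst raw_comp) auto
    also have "P i \<bullet> Q j = (if i = j then Id (F i) else Zero (F j) (F i))"
      using dsumD(4,5)[OF d] that by auto
    finally show ?thesis by (simp add: raw_Id raw_Zero)
  qed
  have "(\<Oplus>\<^bsub>Hom C X X\<^esub>i\<in>I. raw (Q i) \<cdot> raw (P i)) = (\<Oplus>\<^bsub>Hom C X X\<^esub>i\<in>I. raw (Q i \<bullet> P i))"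
  proof (rule Hom.M.finsum_cong')
    show "(\<lambda>i. raw (Q i \<bullet> P i)) \<in> I \<rightarrow> carrier (Hom C X X)"
      using raw_in_Hom'[OF qp_homset[OF d]] by auto
    show "raw (Q i) \<cdot> raw (P i) = raw (Q i \<bullet> P i)" if "i \<in> I" for i
      using homsetD[OF dsumD(2)[OF d that]] homsetD[OF dsumD(3)[OF d that]] by (simp add: raw_comp)
  qed simp
  also have "\<dots> = raw (Sum X X (\<lambda>i. Q i \<bullet> P i) I)"
    using qp_homset[OF d] by (simp add: raw_Sum)
  also have "\<dots> = \<i>\<d> X" using dsumD(6)[OF d] by (simp add: raw_Id)
  finally show ?thesis
    using pq dsumD(1)[OF d] raw_in_Hom'[OF dsumD(2)[OF d]] raw_in_Hom'[OF dsumD(3)[OF d]]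
    by (simp add: direct_sum_def)
qed

lemma dsum_replace_summands:
  assumes d: "dsum I F X P Q" and u: "\<And>i. i \<in> I \<Longrightarrow> u i \<in> homset (F i) (G i)"
    and v: "\<And>i. i \<in> I \<Longrightarrow> v i \<in> homset (G i) (F i)"
    and vu: "\<And>i. i \<in> I \<Longrightarrow> v i \<bullet> u i = Id (F i)" and uv: "\<And>i. i \<in> I \<Longrightarrow> u i \<bullet> v i = Id (G i)"
  shows "dsum I G X (\<lambda>i. u i \<bullet> P i) (\<lambda>i. Q i \<bullet> v i)"
proof -
  have t: "arr (u i)" "src (u i) = F i" "tgt (u i) = G i" "arr (v i)" "src (v i) = G i" "tgt (v i) = F i"
    "arr (P i)" "src (P i) = X" "tgt (P i) = F i" "arr (Q i)" "src (Q i) = F i" "tgt (Q i) = X" if "i \<in> I" for i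
    using u[OF that] v[OF that] dsumD(2,3)[OF d that] by auto
  have 1: "(u i \<bullet> P i) \<bullet> (Q j \<bullet> v j) = (if i = j then Id (G i) else Zero (G j) (G i))"
    if ij: "i \<in> I" "j \<in> I" for i j
  proof -
    have "(u i \<bullet> P i) \<bullet> (Q j \<bullet> v j) = u i \<bullet> (P i \<bullet> Q j) \<bullet> v j" by simp
    then show ?thesis
      using dsumD(4)[OF d] dsumD(5)[OF d] ij t uv by (cases "i = j") simp_all
  qed
  have "Sum X X (\<lambda>i. (Q i \<bullet> v i) \<bullet> (u i \<bullet> P i)) I = Sum X X (\<lambda>i. Q i \<bullet> P i) I"
    using t by (intro Sum_cong) (auto simp: reassoc[OF vu] homset_def)
  with 1 t d show ?thesis
    unfolding dsum_def by (auto simp: homset_def)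
qed

end

section \<open>Dual direct sums and dinatural families\<close>

context ribbon_linear_category
begin

lemma dual_Sum:
  assumes F: "\<And>i. i \<in> I \<Longrightarrow> F i \<in> homset X Y"
  shows "dual_arrow (Sum X Y F I) = Sum (Y\<^sup>\<star>) (X\<^sup>\<star>) (\<lambda>i. dual_arrow (F i)) I"
proof -
  have t: "arr (F i)" "src (F i) = X" "tgt (F i) = Y" if "i \<in> I" for i using F[OF that] by auto
  have "dual_arrow (Sum X Y F I) = (EV Y \<lhd> X\<^sup>\<star>) \<bullet> (Y\<^sup>\<star> \<rhd> (Sum X Y F I \<lhd> X\<^sup>\<star>)) \<bullet> (Y\<^sup>\<star> \<rhd> COEV X)"
    by (simp add: dual_arrow_def)
  also have "Y\<^sup>\<star> \<rhd> (Sum X Y F I \<lhd> X\<^sup>\<star>)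
      = Sum (Y\<^sup>\<star> \<otimes>\<^sub>o X \<otimes>\<^sub>o X\<^sup>\<star>) (Y\<^sup>\<star> \<otimes>\<^sub>o Y \<otimes>\<^sub>o X\<^sup>\<star>) (\<lambda>i. Y\<^sup>\<star> \<rhd> (F i \<lhd> X\<^sup>\<star>)) I"
    using t by (simp add: rw_Sum[OF F] lw_Sum homset_def)
  also have "\<dots> \<bullet> (Y\<^sup>\<star> \<rhd> COEV X) = Sum (Y\<^sup>\<star>) (Y\<^sup>\<star> \<otimes>\<^sub>o Y \<otimes>\<^sub>o X\<^sup>\<star>)
      (\<lambda>i. (Y\<^sup>\<star> \<rhd> (F i \<lhd> X\<^sup>\<star>)) \<bullet> (Y\<^sup>\<star> \<rhd> COEV X)) I"
    using t by (subst Sum_comp) (auto simp: homset_def)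
  also have "(EV Y \<lhd> X\<^sup>\<star>) \<bullet> \<dots> = Sum (Y\<^sup>\<star>) (X\<^sup>\<star>)
      (\<lambda>i. (EV Y \<lhd> X\<^sup>\<star>) \<bullet> (Y\<^sup>\<star> \<rhd> (F i \<lhd> X\<^sup>\<star>)) \<bullet> (Y\<^sup>\<star> \<rhd> COEV X)) I"
    using t by (subst comp_Sum) (auto simp: homset_def)
  also have "\<dots> = Sum (Y\<^sup>\<star>) (X\<^sup>\<star>) (\<lambda>i. dual_arrow (F i)) I"
    using t by (intro Sum_cong) (auto simp: homset_def dual_arrow_def)
  finally show ?thesis .
qed

lemma dsum_dual:
  assumes d: "dsum I F X P Q"
  shows "dsum I (\<lambda>i. (F i)\<^sup>\<star>) (X\<^sup>\<star>) (\<lambda>i. dual_arrow (Q i)) (\<lambda>i. dual_arrow (P i))"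
proof -
  have t: "arr (P i)" "src (P i) = X" "tgt (P i) = F i" "arr (Q i)" "src (Q i) = F i" "tgt (Q i) = X" if "i \<in> I" for i
    using dsumD(2,3)[OF d that] by auto
  have "Id (X\<^sup>\<star>) = dual_arrow (Sum X X (\<lambda>i. Q i \<bullet> P i) I)" by (simp add: dsumD(6)[OF d])
  also have "\<dots> = Sum (X\<^sup>\<star>) (X\<^sup>\<star>) (\<lambda>i. dual_arrow (Q i \<bullet> P i)) I"
    by (rule dual_Sum) (rule qp_homset[OF d])
  also have "\<dots> = Sum (X\<^sup>\<star>) (X\<^sup>\<star>) (\<lambda>i. dual_arrow (P i) \<bullet> dual_arrow (Q i)) I"
    using t by (intro Sum_cong) (auto simp: homset_def dual_comp)
  finally have s: "Sum (X\<^sup>\<star>) (X\<^sup>\<star>) (\<lambda>i. dual_arrow (P i) \<bullet> dual_arrow (Q i)) I = Id (X\<^sup>\<star>)" ..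
  have "dual_arrow (Q i) \<bullet> dual_arrow (P j) = (if i = j then Id ((F i)\<^sup>\<star>) else Zero ((F j)\<^sup>\<star>) ((F i)\<^sup>\<star>))"
    if ij: "i \<in> I" "j \<in> I" for i j
  proof -
    have "dual_arrow (Q i) \<bullet> dual_arrow (P j) = dual_arrow (P j \<bullet> Q i)"
      using t ij by (simp add: dual_comp)
    then show ?thesis using dsumD(4,5)[OF d] ij by auto
  qed
  with s t dsumD(1)[OF d] show ?thesis by (auto simp: dsum_def homset_def)
qed

text \<open>
  The tensor product of two arrows, used only to translate morphisms of the category into arrows;
  computations take place with its factorisation into layers.
\<close>

definition tens :: "('o, 'm) arrow \<Rightarrow> ('o, 'm) arrow \<Rightarrow> ('o, 'm) arrow" where
  "tens f g = (f \<lhd> tgt g) \<bullet> (src f \<rhd> g)"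

lemma src_tgt_tens [simp]: "src (tens f g) = src f \<otimes>\<^sub>o src g" "tgt (tens f g) = tgt f \<otimes>\<^sub>o tgt g"
  by (simp_all add: tens_def)

lemma arr_tens [simp]: "arr (tens f g) \<longleftrightarrow> arr f \<and> arr g"
  by (auto simp: tens_def)

lemma tens_Id: "arr f \<Longrightarrow> tens (Id X) f = X \<rhd> f" "arr f \<Longrightarrow> tens f (Id X) = f \<lhd> X"
  by (simp_all add: tens_def)

lemma raw_tens: "arr f \<Longrightarrow> arr g \<Longrightarrow> raw (tens f g) = raw f \<otimes>\<^sub>m raw g"
  using tensor_arrow[OF raw_in_Hom[of f] raw_in_Hom[of g]] tensor_in_Hom[OF raw_in_Hom[of f] raw_in_Hom[of g]]
  by (simp add: arrow_raw tens_def) (metis raw_arrow)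

lemma raw_generators:
  "\<i>\<d> X = raw (Id X)" "ev C X = raw (EV X)" "coev C X = raw (COEV X)" "braid C X Y = raw (BR X Y)"
  "twist C X = raw (TW X)" "inverse_of C X X (twist C X) = raw (TWi X)"
  "inverse_of C (X \<otimes>\<^sub>o Y) (Y \<otimes>\<^sub>o X) (braid C X Y) = raw (BRi X Y)"
  using arr_gen arr_Id by (simp_all add: Id_def EV_def COEV_def BR_def TW_def TWi_def BRi_def)

text \<open>
  Rewriting with these rules collects an expression in the operations of the category into a single
  arrow, so that its definition can be compared with the layered form.
\<close>

lemmas raw_fold = raw_comp[symmetric] raw_tens[symmetric] tens_Id

lemma raw_derived:
  "evt C X = raw (EVT X)" "coevt C X = raw (COEVT X)"
  "gamma_mor C X Y = raw (GAMMA X Y)" "beta_mor C X = raw (BETA X)"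
  unfolding evt_def coevt_def gamma_mor_def beta_mor_def EVT_def COEVT_def bev_def bcoev_def GAMMA_def BETA_def
  unfolding raw_generators(6,7) unfolding raw_generators(1-5)
  by (simp_all add: raw_fold)

lemma raw_dual_arrow: "arr f \<Longrightarrow> raw (dual_arrow f) = dual_mor C (src f) (tgt f) (raw f)"
  using dual_mor_in_Hom[OF raw_in_Hom[of f]] by (simp add: arrow_raw)

definition dinat :: "'o \<Rightarrow> ('o \<Rightarrow> ('o, 'm) arrow) \<Rightarrow> bool" where
  "dinat Z d \<longleftrightarrow> (\<forall>X. d X \<in> homset (X\<^sup>\<star> \<otimes>\<^sub>o X) Z) \<and>
     (\<forall>f X Y. arr f \<longrightarrow> src f = X \<longrightarrow> tgt f = Y \<longrightarrow>
        d X \<bullet> (dual_arrow f \<lhd> X) = d Y \<bullet> (Y\<^sup>\<star> \<rhd> f))"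

lemma dinatD:
  assumes "dinat Z d" "arr f" "src f = X" "tgt f = Y"
  shows "d X \<bullet> (dual_arrow f \<lhd> X) = d Y \<bullet> (Y\<^sup>\<star> \<rhd> f)"
  using assms unfolding dinat_def by blast

lemma dinat_raw:
  assumes d: "dinat Z d"
  shows "dinatural C Z (\<lambda>X. raw (d X))"
  unfolding dinatural_def
proof (intro conjI allI ballI)
  have D: "d X \<in> homset (X\<^sup>\<star> \<otimes>\<^sub>o X) Z" for X using d by (auto simp: dinat_def)
  show "raw (d X) \<in> carrier (Hom C (X\<^sup>\<star> \<otimes>\<^sub>o X) Z)" for X using raw_in_Hom'[OF D] .
  fix X Y f assume f: "f \<in> carrier (Hom C X Y)"
  let ?f = "arrow X f Y"
  have e: "dual_mor C X Y f = raw (dual_arrow ?f)" "f = raw ?f"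
    using f raw_dual_arrow[of ?f] by simp_all
  have "d X \<bullet> (dual_arrow ?f \<lhd> X) = d Y \<bullet> (Y\<^sup>\<star> \<rhd> ?f)"
    by (rule dinatD[OF d]) (use f in simp_all)
  from arg_cong[OF this, of raw]
  show "raw (d X) \<cdot> (dual_mor C X Y f \<otimes>\<^sub>m \<i>\<d> X) = raw (d Y) \<cdot> (\<i>\<d> (Y\<^sup>\<star>) \<otimes>\<^sub>m f)"
    using homsetD[OF D[of X]] homsetD[OF D[of Y]] f
    by (simp add: raw_comp raw_whisker e(1))
qed

lemma dinat_arrow:
  assumes d: "dinatural C Z d"
  shows "dinat Z (\<lambda>X. arrow (X\<^sup>\<star> \<otimes>\<^sub>o X) (d X) Z)"
  unfolding dinat_def
proof (intro conjI allI impI)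
  have D: "d X \<in> carrier (Hom C (X\<^sup>\<star> \<otimes>\<^sub>o X) Z)" for X using d by (auto simp: dinatural_def)
  show "arrow (X\<^sup>\<star> \<otimes>\<^sub>o X) (d X) Z \<in> homset (X\<^sup>\<star> \<otimes>\<^sub>o X) Z" for X using D by (rule homset_arrow)
  fix f X Y assume f: "arr f" "src f = X" "tgt f = Y"
  have "d X \<cdot> (dual_mor C X Y (raw f) \<otimes>\<^sub>m \<i>\<d> X) = d Y \<cdot> (\<i>\<d> (Y\<^sup>\<star>) \<otimes>\<^sub>m raw f)"
    using d f raw_in_Hom[of f] by (simp add: dinatural_def)
  then show "arrow (X\<^sup>\<star> \<otimes>\<^sub>o X) (d X) Z \<bullet> (dual_arrow f \<lhd> X) = arrow (Y\<^sup>\<star> \<otimes>\<^sub>o Y) (d Y) Z \<bullet> (Y\<^sup>\<star> \<rhd> f)"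
    using f D by (intro arrow_eqI) (simp_all add: raw_comp raw_whisker raw_dual_arrow)
qed

end

section \<open>The coend of a semisimple ribbon category\<close>

locale semisimple_ribbon_category = ribbon_linear_category C
  for C :: "('o, 'm, 'k, 'z) ribbon_cat_scheme" (structure) +
  fixes \<Lambda> :: "'o set" and B :: 'o and p q :: "'o \<Rightarrow> 'm"
  assumes semisimple: "finitely_semisimple C"
    and simple_scalar: "simple_object C X \<Longrightarrow> scalar_object C X"
    and representatives: "simple_representatives C \<Lambda>"
    and unit_in: "\<I> \<in> \<Lambda>"
    and B_sum: "direct_sum C \<Lambda> (\<lambda>l. l\<^sup>\<star> \<otimes>\<^sub>o l) B p q"
begin

lemma simple_rep: "l \<in> \<Lambda> \<Longrightarrow> simple_object C l"
  using representatives by (simp add: simple_representatives_def)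

lemma rep_unique: "l \<in> \<Lambda> \<Longrightarrow> m \<in> \<Lambda> \<Longrightarrow> isomorphic C l m \<Longrightarrow> l = m"
  using representatives simple_rep[of l] isomorphic_refl[of l]
  unfolding simple_representatives_def by blast

lemma schur_zero:
  assumes "l \<in> \<Lambda>" "m \<in> \<Lambda>" "l \<noteq> m" "f \<in> homset l m"
  shows "f = Zero l m"
proof (rule ccontr)
  assume "f \<noteq> Zero l m"
  then have "raw f \<noteq> \<zero>\<^bsub>Hom C l m\<^esub>"
    using assms(4) arrow_eqI[of f "Zero l m"] by (auto simp: raw_Zero)
  then have "is_iso C l m (raw f)"
    using schur semisimple simple_rep assms raw_in_Hom' by (auto simp: finitely_semisimple_def)
  then show False using rep_unique[OF assms(1,2)] assms(3) by (auto simp: isomorphic_def)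
qed

lemma schur_scalar:
  assumes "l \<in> \<Lambda>" "f \<in> homset l l"
  shows "\<exists>a\<in>carrier (base C). f = scale a (Id l)"
proof -
  have "raw f \<in> (\<lambda>a. a \<odot>\<^bsub>Hom C l l\<^esub> \<i>\<d> l) ` carrier (base C)"
    using simple_scalar[OF simple_rep[OF assms(1)]] raw_in_Hom'[OF assms(2)]
    by (simp add: scalar_object_def bij_betw_def)
  then obtain a where a: "a \<in> carrier (base C)" "raw f = a \<odot>\<^bsub>Hom C l l\<^esub> \<i>\<d> l" by blast
  then have "f = scale a (Id l)"
    using homsetD[OF assms(2)] by (intro arrow_eqI) (simp_all add: raw_scale raw_Id)
  with a(1) show ?thesis by blast
qed

lemma Id_rep_nonzero: "l \<in> \<Lambda> \<Longrightarrow> Id l \<noteq> Zero l l"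
  using zero_objectI simple_rep by (auto simp: simple_object_def)

lemma decomposition:
  obtains n l P Q where "\<And>k. k < n \<Longrightarrow> l k \<in> \<Lambda>" "dsum {..<n::nat} l X P Q"
proof -
  obtain n F p' q' where s: "\<And>k. k < n \<Longrightarrow> simple_object C (F k)" "direct_sum C {..<n::nat} F X p' q'"
    using semisimple unfolding finitely_semisimple_def by metis
  have "\<exists>l. l \<in> \<Lambda> \<and> isomorphic C (F k) l" if "k < n" for k
    using representatives s(1)[OF that] unfolding simple_representatives_def by blast
  then obtain l where l: "\<And>k. k < n \<Longrightarrow> l k \<in> \<Lambda> \<and> isomorphic C (F k) (l k)" by metis
  have "\<exists>u v. u \<in> homset (F k) (l k) \<and> v \<in> homset (l k) (F k) \<and> v \<bullet> u = Id (F k) \<and> u \<bullet> v = Id (l k)" if "k < n" for k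
    using l[OF that] by (metis isomorphicE)
  then obtain u v where uv: "\<And>k. k < n \<Longrightarrow> u k \<in> homset (F k) (l k) \<and> v k \<in> homset (l k) (F k) \<and> v k \<bullet> u k = Id (F k) \<and> u k \<bullet> v k = Id (l k)"
    by metis
  have "dsum {..<n} l X (\<lambda>i. u i \<bullet> arrow X (p' i) (F i)) (\<lambda>i. arrow (F i) (q' i) X \<bullet> v i)"
    by (rule dsum_replace_summands[OF direct_sum_imp_dsum[OF s(2)]]) (use uv in auto)
  with l that show ?thesis by blast
qed

definition J where "J X = arrow (X\<^sup>\<star> \<otimes>\<^sub>o X) (ss_coend_map C \<Lambda> B q X) B"
definition QB where "QB l = arrow (l\<^sup>\<star> \<otimes>\<^sub>o l) (q l) B"
definition PB where "PB l = arrow B (p l) (l\<^sup>\<star> \<otimes>\<^sub>o l)"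

lemma dsum_B: "dsum \<Lambda> (\<lambda>l. l\<^sup>\<star> \<otimes>\<^sub>o l) B PB QB"
  unfolding PB_def QB_def by (rule direct_sum_imp_dsum[OF B_sum])

lemma src_tgt_B [simp]:
  "src (J X) = X\<^sup>\<star> \<otimes>\<^sub>o X" "tgt (J X) = B" "src (QB l) = l\<^sup>\<star> \<otimes>\<^sub>o l" "tgt (QB l) = B"
  "src (PB l) = B" "tgt (PB l) = l\<^sup>\<star> \<otimes>\<^sub>o l"
  by (simp_all add: J_def QB_def PB_def)

lemma arr_B [simp]: "l \<in> \<Lambda> \<Longrightarrow> arr (QB l)" "l \<in> \<Lambda> \<Longrightarrow> arr (PB l)"
  using dsumD(2,3)[OF dsum_B] by (auto simp: homset_def)

text \<open>
  Obtains the decomposition of \<open>X\<close> that the choice operator in \<open>j\<^sub>X\<close> has selected.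
\<close>

lemma J_Sum:
  obtains n l P Q where "\<And>k. k < n \<Longrightarrow> l k \<in> \<Lambda>" "dsum {..<n::nat} l X P Q"
    "J X = Sum (X\<^sup>\<star> \<otimes>\<^sub>o X) B (\<lambda>k. QB (l k) \<bullet> (dual_arrow (Q k) \<lhd> l k) \<bullet> (X\<^sup>\<star> \<rhd> P k)) {..<n}"
    "ss_coend_map C \<Lambda> B q X \<in> carrier (Hom C (X\<^sup>\<star> \<otimes>\<^sub>o X) B)"
proof -
  define H where "H h \<longleftrightarrow> (\<exists>(n::nat) l p' q'.
     (\<forall>k<n. l k \<in> \<Lambda>) \<and> direct_sum C {..<n} l X p' q' \<and>
     h = (\<Oplus>\<^bsub>Hom C (X\<^sup>\<star> \<otimes>\<^sub>o X) B\<^esub>k\<in>{..<n}. q (l k) \<cdot> (dual_mor C (l k) X (q' k) \<otimes>\<^sub>m p' k)))" for h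
  obtain n l P Q where "\<And>k. k < n \<Longrightarrow> l k \<in> \<Lambda>" "dsum {..<n::nat} l X P Q"
    by (rule decomposition[of X]) blast
  then have "\<exists>h. H h" unfolding H_def by (blast dest: dsum_imp_direct_sum)
  then have "H (ss_coend_map C \<Lambda> B q X)" unfolding ss_coend_map_def H_def[symmetric] by (rule someI_ex)
  then obtain n l p' q' where l: "\<And>k. k < n \<Longrightarrow> l k \<in> \<Lambda>" and d: "direct_sum C {..<n::nat} l X p' q'"
    and h: "ss_coend_map C \<Lambda> B q X
      = (\<Oplus>\<^bsub>Hom C (X\<^sup>\<star> \<otimes>\<^sub>o X) B\<^esub>k\<in>{..<n}. q (l k) \<cdot> (dual_mor C (l k) X (q' k) \<otimes>\<^sub>m p' k))"
    unfolding H_def by blast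
  define P where "P i = arrow X (p' i) (l i)" for i
  define Q where "Q i = arrow (l i) (q' i) X" for i
  have ds: "dsum {..<n} l X P Q" unfolding P_def Q_def by (rule direct_sum_imp_dsum[OF d])
  have pq: "p' k \<in> carrier (Hom C X (l k))" "q' k \<in> carrier (Hom C (l k) X)" if "k < n" for k
    using d that by (auto simp: direct_sum_def)
  let ?T = "\<lambda>k. QB (l k) \<bullet> (dual_arrow (Q k) \<lhd> l k) \<bullet> (X\<^sup>\<star> \<rhd> P k)"
  have T: "?T k \<in> homset (X\<^sup>\<star> \<otimes>\<^sub>o X) B" if "k < n" for k
    using that l dsumD(2,3)[OF ds] by (simp add: homset_def)
  have "q (l k) \<cdot> (dual_mor C (l k) X (q' k) \<otimes>\<^sub>m p' k) = raw (?T k)" if k: "k < n" for k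
  proof -
    have "q (l k) = raw (QB (l k))" using arr_B(1)[OF l[OF k]] by (simp add: QB_def)
    moreover have "dual_mor C (l k) X (q' k) = raw (dual_arrow (Q k))" "p' k = raw (P k)"
      using pq[OF k] raw_dual_arrow[of "Q k"] by (simp_all add: Q_def P_def)
    moreover have "arr (Q k)" "src (Q k) = l k" "tgt (Q k) = X" "arr (P k)" "src (P k) = X" "tgt (P k) = l k"
      using dsumD(2,3)[OF ds] k by auto
    moreover have "tens (dual_arrow (Q k)) (P k) = (dual_arrow (Q k) \<lhd> l k) \<bullet> (X\<^sup>\<star> \<rhd> P k)"
      using calculation by (simp add: tens_def)
    ultimately show ?thesis using l[OF k] by (simp add: raw_fold)
  qed
  then have h': "ss_coend_map C \<Lambda> B q X = (\<Oplus>\<^bsub>Hom C (X\<^sup>\<star> \<otimes>\<^sub>o X) B\<^esub>k\<in>{..<n}. raw (?T k))"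
    unfolding h using raw_in_Hom'[OF T] by (intro Hom.M.finsum_cong') (auto simp: Pi_def)
  then have "J X = Sum (X\<^sup>\<star> \<otimes>\<^sub>o X) B ?T {..<n}" by (simp add: J_def Sum_def)
  moreover have "ss_coend_map C \<Lambda> B q X \<in> carrier (Hom C (X\<^sup>\<star> \<otimes>\<^sub>o X) B)"
    unfolding h' using raw_in_Hom'[OF T] by (intro Hom.M.finsum_closed) auto
  ultimately show ?thesis using that l ds by blast
qed

lemma coend_map_in_Hom: "ss_coend_map C \<Lambda> B q X \<in> carrier (Hom C (X\<^sup>\<star> \<otimes>\<^sub>o X) B)"
  by (rule J_Sum[of X]) blast

lemma arr_J [simp]: "arr (J X)"
  by (simp add: J_def coend_map_in_Hom)

text \<open>
  The value of \<open>j\<^sub>X\<close> on the \<open>(\<nu>, \<mu>)\<close> component of \<open>X\<^sup>\<star> \<otimes> X\<close>.  In each summand of \<open>j\<^sub>X\<close> the maps \<open>g q\<^sub>k\<close> and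
  \<open>p\<^sub>k h\<close> run between simple objects with scalar endomorphisms, so they are scalars or zero and the
  scalar \<open>g q\<^sub>k\<close> can be moved from the factor \<open>\<nu>\<^sup>\<star>\<close> to the factor \<open>\<mu>\<close>; then \<open>\<Sum> q\<^sub>k p\<^sub>k = id\<close> removes the
  decomposition of \<open>X\<close>.  In this way the choice of decomposition in \<open>j\<^sub>X\<close> becomes irrelevant, \<open>j\<^sub>l\<close> is the
  injection of the summand \<open>l\<close>, and \<open>j\<close> is dinatural.
\<close>

lemma J_between_simples:
  assumes mu: "\<mu> \<in> \<Lambda>" and nu: "\<nu> \<in> \<Lambda>" and g: "g \<in> homset X \<nu>" and h: "h \<in> homset \<mu> X"
  shows "J X \<bullet> (dual_arrow g \<lhd> X) \<bullet> (\<nu>\<^sup>\<star> \<rhd> h)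
    = (if \<mu> = \<nu> then QB \<mu> \<bullet> (\<mu>\<^sup>\<star> \<rhd> (g \<bullet> h)) else Zero (\<nu>\<^sup>\<star> \<otimes>\<^sub>o \<mu>) B)"
proof -
  obtain n l P Q where l: "\<And>k. k < n \<Longrightarrow> l k \<in> \<Lambda>" and d: "dsum {..<n::nat} l X P Q"
    and J: "J X = Sum (X\<^sup>\<star> \<otimes>\<^sub>o X) B (\<lambda>k. QB (l k) \<bullet> (dual_arrow (Q k) \<lhd> l k) \<bullet> (X\<^sup>\<star> \<rhd> P k)) {..<n}"
    by (rule J_Sum[of X]) blast
  have t: "arr (P i)" "src (P i) = X" "tgt (P i) = l i" "arr (Q i)" "src (Q i) = l i" "tgt (Q i) = X" if "i < n" for i
    using dsumD(2,3)[OF d] that by auto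
  note gh = homsetD[OF g] homsetD[OF h]
  let ?v = "(dual_arrow g \<lhd> X) \<bullet> (\<nu>\<^sup>\<star> \<rhd> h)"
  let ?T = "\<lambda>k. QB (l k) \<bullet> (dual_arrow (Q k) \<lhd> l k) \<bullet> (X\<^sup>\<star> \<rhd> P k)"
  let ?R = "\<lambda>k. if \<mu> = \<nu> then QB \<mu> \<bullet> (\<mu>\<^sup>\<star> \<rhd> (g \<bullet> Q k \<bullet> P k \<bullet> h)) else Zero (\<nu>\<^sup>\<star> \<otimes>\<^sub>o \<mu>) B"
  have summand: "?T k \<bullet> ?v = ?R k" if k: "k < n" for k
  proof -
    have 1: "(X\<^sup>\<star> \<rhd> P k) \<bullet> (dual_arrow g \<lhd> X) = (dual_arrow g \<lhd> l k) \<bullet> (\<nu>\<^sup>\<star> \<rhd> P k)"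
      using exchange[of "dual_arrow g" "P k"] t[OF k] gh by simp
    have 2: "?T k \<bullet> ?v = QB (l k) \<bullet> (dual_arrow (g \<bullet> Q k) \<lhd> l k) \<bullet> (\<nu>\<^sup>\<star> \<rhd> (P k \<bullet> h))"
      using t[OF k] gh by (simp add: reassoc[OF 1] dual_comp)
    \<comment> \<open>both maps run between representatives of simple objects, so Schur's lemma applies to them\<close>
    have gQ: "g \<bullet> Q k \<in> homset (l k) \<nu>" and Ph: "P k \<bullet> h \<in> homset \<mu> (l k)"
      using t[OF k] gh by (simp_all add: homset_def)
    note lk = l[OF k]
    show ?thesis
    proof (cases "l k = \<nu>")
      case True
      then obtain c where c: "c \<in> carrier (base C)" "g \<bullet> Q k = scale c (Id \<nu>)"
        using schur_scalar[OF nu] gQ by auto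
      have Z: "P k \<bullet> h = Zero \<mu> \<nu>" if "\<mu> \<noteq> \<nu>"
        using schur_zero[OF mu nu that] Ph True by simp
      have "g \<bullet> Q k \<bullet> P k \<bullet> h = scale c (P k \<bullet> h)"
        unfolding reassoc[OF c(2)] using c(1) t[OF k] gh True by simp
      then show ?thesis
        unfolding 2 c(2) using c(1) True lk t[OF k] gh Z by (auto simp del: lw_comp)
    next
      case False
      then have z: "g \<bullet> Q k = Zero (l k) \<nu>" using schur_zero[OF lk nu _ gQ] by simp
      have "g \<bullet> Q k \<bullet> P k \<bullet> h = Zero \<mu> \<nu>" unfolding reassoc[OF z] using t[OF k] gh by simp
      then show ?thesis unfolding 2 z using lk mu t[OF k] gh by (auto simp del: lw_comp)
    qed
  qed
  have T: "?T k \<in> homset (X\<^sup>\<star> \<otimes>\<^sub>o X) B" if "k \<in> {..<n}" for k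
    using that l t by (simp add: homset_def)
  have "J X \<bullet> ?v = Sum (\<nu>\<^sup>\<star> \<otimes>\<^sub>o \<mu>) B (\<lambda>k. ?T k \<bullet> ?v) {..<n}"
    unfolding J using Sum_comp[of ?v "X\<^sup>\<star> \<otimes>\<^sub>o X" "{..<n}" ?T B] T gh by simp
  also have "\<dots> = Sum (\<nu>\<^sup>\<star> \<otimes>\<^sub>o \<mu>) B ?R {..<n}"
  proof (rule Sum_cong)
    fix k assume k: "k \<in> {..<n}"
    show "?T k \<bullet> ?v = ?R k" by (rule summand) (use k in simp)
    show "?T k \<bullet> ?v \<in> homset (\<nu>\<^sup>\<star> \<otimes>\<^sub>o \<mu>) B"
      using homsetD[OF T[OF k]] gh by (simp add: homset_def)
  qed
  also have "\<dots> = (if \<mu> = \<nu> then QB \<mu> \<bullet> (\<mu>\<^sup>\<star> \<rhd> (g \<bullet> h)) else Zero (\<nu>\<^sup>\<star> \<otimes>\<^sub>o \<mu>) B)"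
  proof (cases "\<mu> = \<nu>")
    case True
    have QP: "Q k \<bullet> P k \<in> homset X X" if "k \<in> {..<n}" for k using qp_homset[OF d that] .
    have "g \<bullet> h = g \<bullet> Sum X X (\<lambda>k. Q k \<bullet> P k) {..<n} \<bullet> h" using dsumD(6)[OF d] gh by simp
    also have "\<dots> = g \<bullet> Sum \<mu> X (\<lambda>k. (Q k \<bullet> P k) \<bullet> h) {..<n}"
      using Sum_comp[of h X "{..<n}" "\<lambda>k. Q k \<bullet> P k" X] QP gh by simp
    also have "\<dots> = Sum \<mu> \<nu> (\<lambda>k. g \<bullet> (Q k \<bullet> P k) \<bullet> h) {..<n}"
      using gh t by (subst comp_Sum) (auto simp: homset_def)
    finally have gh': "g \<bullet> h = Sum \<mu> \<nu> (\<lambda>k. g \<bullet> (Q k \<bullet> P k) \<bullet> h) {..<n}" .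
    have "QB \<mu> \<bullet> (\<mu>\<^sup>\<star> \<rhd> (g \<bullet> h))
        = QB \<mu> \<bullet> Sum (\<mu>\<^sup>\<star> \<otimes>\<^sub>o \<mu>) (\<mu>\<^sup>\<star> \<otimes>\<^sub>o \<nu>) (\<lambda>k. \<mu>\<^sup>\<star> \<rhd> (g \<bullet> (Q k \<bullet> P k) \<bullet> h)) {..<n}"
      unfolding gh' using gh t by (subst lw_Sum) (auto simp: homset_def)
    also have "\<dots> = Sum (\<mu>\<^sup>\<star> \<otimes>\<^sub>o \<mu>) B (\<lambda>k. QB \<mu> \<bullet> (\<mu>\<^sup>\<star> \<rhd> (g \<bullet> (Q k \<bullet> P k) \<bullet> h))) {..<n}"
      using gh t mu True by (subst comp_Sum) (auto simp: homset_def)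
    finally show ?thesis using True by simp
  next
    case False
    then show ?thesis by (simp add: Sum_zero)
  qed
  finally show ?thesis .
qed

lemma J_rep: "l \<in> \<Lambda> \<Longrightarrow> J l = QB l"
  using J_between_simples[of l l "Id l" l "Id l"] by (simp add: homset_def)

text \<open>
  Both sides are compared on the components of \<open>Y\<^sup>\<star> \<otimes> X\<close>, where \<open>J_between_simples\<close> only sees the composite
  \<open>p' f q\<close>.
\<close>

lemma J_dinatural:
  assumes f: "arr f" "src f = X" "tgt f = Y"
  shows "J X \<bullet> (dual_arrow f \<lhd> X) = J Y \<bullet> (Y\<^sup>\<star> \<rhd> f)"
proof -
  obtain n l P Q where l: "\<And>k. k < n \<Longrightarrow> l k \<in> \<Lambda>" and d: "dsum {..<n::nat} l X P Q"
    by (rule decomposition[of X]) blast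
  obtain n' l' P' Q' where l': "\<And>k. k < n' \<Longrightarrow> l' k \<in> \<Lambda>" and d': "dsum {..<n'::nat} l' Y P' Q'"
    by (rule decomposition[of Y]) blast
  show ?thesis
  proof (rule dsum_epi[OF dsum_rw[OF dsum_dual[OF d'], of X]])
    show "J X \<bullet> (dual_arrow f \<lhd> X) \<in> homset (Y\<^sup>\<star> \<otimes>\<^sub>o X) B" "J Y \<bullet> (Y\<^sup>\<star> \<rhd> f) \<in> homset (Y\<^sup>\<star> \<otimes>\<^sub>o X) B"
      using f by (simp_all add: homset_def)
    fix i assume i: "i \<in> {..<n'}"
    then have P': "arr (P' i)" "src (P' i) = Y" "tgt (P' i) = l' i" using dsumD(2)[OF d'] by auto
    show "(J X \<bullet> (dual_arrow f \<lhd> X)) \<bullet> (dual_arrow (P' i) \<lhd> X) = (J Y \<bullet> (Y\<^sup>\<star> \<rhd> f)) \<bullet> (dual_arrow (P' i) \<lhd> X)"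
    proof (rule dsum_epi[OF dsum_lw[OF d, of "(l' i)\<^sup>\<star>"]])
      show "(J X \<bullet> (dual_arrow f \<lhd> X)) \<bullet> (dual_arrow (P' i) \<lhd> X) \<in> homset ((l' i)\<^sup>\<star> \<otimes>\<^sub>o X) B"
        "(J Y \<bullet> (Y\<^sup>\<star> \<rhd> f)) \<bullet> (dual_arrow (P' i) \<lhd> X) \<in> homset ((l' i)\<^sup>\<star> \<otimes>\<^sub>o X) B"
        using f P' by (simp_all add: homset_def)
      fix k assume k: "k \<in> {..<n}"
      then have Q: "arr (Q k)" "src (Q k) = l k" "tgt (Q k) = X" using dsumD(3)[OF d] by auto
      have 1: "(Y\<^sup>\<star> \<rhd> f) \<bullet> (dual_arrow (P' i) \<lhd> X) = (dual_arrow (P' i) \<lhd> Y) \<bullet> ((l' i)\<^sup>\<star> \<rhd> f)"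
        using exchange[of "dual_arrow (P' i)" f] f P' by simp
      have "((J X \<bullet> (dual_arrow f \<lhd> X)) \<bullet> (dual_arrow (P' i) \<lhd> X)) \<bullet> ((l' i)\<^sup>\<star> \<rhd> Q k)
          = J X \<bullet> (dual_arrow (P' i \<bullet> f) \<lhd> X) \<bullet> ((l' i)\<^sup>\<star> \<rhd> Q k)"
        using f P' by (simp add: dual_comp)
      also have "\<dots> = J Y \<bullet> (dual_arrow (P' i) \<lhd> Y) \<bullet> ((l' i)\<^sup>\<star> \<rhd> (f \<bullet> Q k))"
        using l[of k] l'[of i] i k f P' Q
          J_between_simples[of "l k" "l' i" "P' i \<bullet> f" X "Q k"]
          J_between_simples[of "l k" "l' i" "P' i" Y "f \<bullet> Q k"]
        by (simp add: homset_def)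
      also have "\<dots> = ((J Y \<bullet> (Y\<^sup>\<star> \<rhd> f)) \<bullet> (dual_arrow (P' i) \<lhd> X)) \<bullet> ((l' i)\<^sup>\<star> \<rhd> Q k)"
        using f Q by (simp add: reassoc[OF 1])
      finally show "((J X \<bullet> (dual_arrow f \<lhd> X)) \<bullet> (dual_arrow (P' i) \<lhd> X)) \<bullet> ((l' i)\<^sup>\<star> \<rhd> Q k)
          = ((J Y \<bullet> (Y\<^sup>\<star> \<rhd> f)) \<bullet> (dual_arrow (P' i) \<lhd> X)) \<bullet> ((l' i)\<^sup>\<star> \<rhd> Q k)" .
    qed
  qed
qed

lemma dinat_J: "dinat B J"
  using J_dinatural by (simp add: dinat_def homset_def)

lemma from_B_eqI:
  assumes "f \<in> homset B Z" "g \<in> homset B Z" "\<And>l. l \<in> \<Lambda> \<Longrightarrow> f \<bullet> J l = g \<bullet> J l"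
  shows "f = g"
  using dsum_epi[OF dsum_B assms(1,2)] assms(3) by (simp add: J_rep)

text \<open>
  The factorisation is forced on the summands of \<open>B\<close> by \<open>j\<^sub>l = q\<^sub>l\<close>.  For general \<open>X\<close> dinaturality of \<open>j\<close> and of
  \<open>d\<close> along the injections \<open>q\<^sub>k\<close> of simple summands reduces the claim to simple objects.
\<close>

lemma factor_through_B:
  assumes d: "dinat Z d"
  shows "\<exists>r\<in>homset B Z. \<forall>X. r \<bullet> J X = d X"
proof -
  have D: "arr (d X)" "src (d X) = X\<^sup>\<star> \<otimes>\<^sub>o X" "tgt (d X) = Z" for X using d by (auto simp: dinat_def)
  obtain r where r: "r \<in> homset B Z" "\<And>l. l \<in> \<Lambda> \<Longrightarrow> r \<bullet> QB l = d l"
    using dsum_copair[OF dsum_B, of d Z] D by (auto simp: homset_def)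
  have "r \<bullet> J X = d X" for X
  proof -
    obtain n l P Q where l: "\<And>k. k < n \<Longrightarrow> l k \<in> \<Lambda>" and ds: "dsum {..<n::nat} l X P Q"
      by (rule decomposition[of X]) blast
    show ?thesis
    proof (rule dsum_epi[OF dsum_lw[OF ds, of "X\<^sup>\<star>"]])
      show "r \<bullet> J X \<in> homset (X\<^sup>\<star> \<otimes>\<^sub>o X) Z" "d X \<in> homset (X\<^sup>\<star> \<otimes>\<^sub>o X) Z"
        using homsetD[OF r(1)] D by (simp_all add: homset_def)
      fix k assume k: "k \<in> {..<n}"
      then have Q: "arr (Q k)" "src (Q k) = l k" "tgt (Q k) = X" using dsumD(3)[OF ds] by auto
      have lk: "l k \<in> \<Lambda>" using l k by simp
      have "d (l k) \<bullet> (dual_arrow (Q k) \<lhd> l k) = d X \<bullet> (X\<^sup>\<star> \<rhd> Q k)" by (rule dinatD[OF d Q])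
      then show "(r \<bullet> J X) \<bullet> (X\<^sup>\<star> \<rhd> Q k) = d X \<bullet> (X\<^sup>\<star> \<rhd> Q k)"
        using r(2)[OF lk] J_dinatural[OF Q, symmetric] by (simp add: J_rep[OF lk] reassoc)
    qed
  qed
  with r(1) show ?thesis by blast
qed

lemma is_coend_B: "is_coend C B (ss_coend_map C \<Lambda> B q)"
proof -
  have j: "raw (J X) = ss_coend_map C \<Lambda> B q X" for X by (simp add: J_def coend_map_in_Hom)
  have "\<exists>!r. r \<in> carrier (Hom C B Z) \<and> (\<forall>X. r \<cdot> ss_coend_map C \<Lambda> B q X = d X)"
    if d: "dinatural C Z d" for Z d
  proof -
    have D: "d X \<in> carrier (Hom C (X\<^sup>\<star> \<otimes>\<^sub>o X) Z)" for X using d by (simp add: dinatural_def)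
    obtain r where r: "r \<in> homset B Z" "\<And>X. r \<bullet> J X = arrow (X\<^sup>\<star> \<otimes>\<^sub>o X) (d X) Z"
      using factor_through_B[OF dinat_arrow[OF d]] by blast
    show ?thesis
    proof (rule ex1I[of _ "raw r"])
      have "raw r \<cdot> ss_coend_map C \<Lambda> B q X = d X" for X
        using arg_cong[OF r(2)[of X], of raw] homsetD[OF r(1)] D by (simp add: raw_comp j)
      then show "raw r \<in> carrier (Hom C B Z) \<and> (\<forall>X. raw r \<cdot> ss_coend_map C \<Lambda> B q X = d X)"
        using raw_in_Hom'[OF r(1)] by blast
      fix s assume s: "s \<in> carrier (Hom C B Z) \<and> (\<forall>X. s \<cdot> ss_coend_map C \<Lambda> B q X = d X)"
      have "arrow B s Z = r"
      proof (rule from_B_eqI)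
        show "arrow B s Z \<in> homset B Z" using s by (simp add: homset_arrow)
        show "r \<in> homset B Z" by (rule r(1))
        show "arrow B s Z \<bullet> J l = r \<bullet> J l" for l
          using s coend_map_in_Hom comp_arrow unfolding r(2) unfolding J_def by metis
      qed
      moreover have "raw (arrow B s Z) = s" using s by (intro raw_arrow) blast
      ultimately show "s = raw r" by simp
    qed
  qed
  moreover have "dinatural C B (ss_coend_map C \<Lambda> B q)" using dinat_raw[OF dinat_J] by (simp add: j)
  ultimately show ?thesis unfolding is_coend_def by blast
qed

end

section \<open>Transposes of morphisms between simple objects, and dimensions\<close>

context ribbon_linear_category
begin

text \<open>
  Transports Schur's lemma from simple objects to their duals.
\<close>

lemma dual_full:
  assumes f: "f \<in> homset (Y\<^sup>\<star>) (X\<^sup>\<star>)"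
  shows "\<exists>g\<in>homset X Y. f = dual_arrow g"
proof
  note [simp] = homsetD[OF f]
  let ?g = "(Y \<rhd> EV X) \<bullet> (Y \<rhd> (f \<lhd> X)) \<bullet> (COEV Y \<lhd> X)"
  show g: "?g \<in> homset X Y" by (simp add: homset_def)
  show "f = dual_arrow ?g"
  proof (rule ev_inject[OF f])
    show "dual_arrow ?g \<in> homset (Y\<^sup>\<star>) (X\<^sup>\<star>)" by (simp add: homset_def)
    have 1: "EV Y \<bullet> ((Y\<^sup>\<star> \<otimes>\<^sub>o Y) \<rhd> EV X) = EV X \<bullet> (EV Y \<lhd> (X\<^sup>\<star> \<otimes>\<^sub>o X))"
      using exchange[of "EV Y" "EV X"] by simp
    have 2: "(EV Y \<lhd> (X\<^sup>\<star> \<otimes>\<^sub>o X)) \<bullet> ((Y\<^sup>\<star> \<otimes>\<^sub>o Y) \<rhd> (f \<lhd> X)) = (f \<lhd> X) \<bullet> (EV Y \<lhd> (Y\<^sup>\<star> \<otimes>\<^sub>o X))"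
      using exchange[of "EV Y" "f \<lhd> X"] by simp
    have 3: "(EV Y \<lhd> (Y\<^sup>\<star> \<otimes>\<^sub>o X)) \<bullet> (Y\<^sup>\<star> \<rhd> (COEV Y \<lhd> X)) = Id (Y\<^sup>\<star> \<otimes>\<^sub>o X)"
      using arg_cong[OF zigzag_dual_arrow[of Y], of "\<lambda>h. h \<lhd> X"] by simp
    have "EV X \<bullet> (dual_arrow ?g \<lhd> X) = EV Y \<bullet> (Y\<^sup>\<star> \<rhd> ?g)"
      using homsetD[OF g] by (intro ev_dual) simp_all
    also have "\<dots> = EV X \<bullet> (f \<lhd> X)" by (simp add: reassoc[OF 1] reassoc[OF 2] 3)
    finally show "EV X \<bullet> (f \<lhd> X) = EV X \<bullet> (dual_arrow ?g \<lhd> X)" ..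
  qed
qed

lemma dual_nonzero:
  assumes "Id (X\<^sup>\<star>) = Zero (X\<^sup>\<star>) (X\<^sup>\<star>)"
  shows "Id X = Zero X X"
proof -
  have "EV X = EV X \<bullet> (Id (X\<^sup>\<star>) \<lhd> X)" by simp
  also have "\<dots> = Zero (X\<^sup>\<star> \<otimes>\<^sub>o X) \<I>" by (simp only: assms) simp
  finally show ?thesis using zigzag_arrow[of X] by simp
qed

text \<open>
  Bending with \<open>evt\<^sub>X\<close> recovers \<open>f\<close>.
\<close>

lemma coevt_inject:
  assumes f: "f \<in> homset X Z" and g: "g \<in> homset X Z"
    and eq: "(X\<^sup>\<star> \<rhd> f) \<bullet> COEVT X = (X\<^sup>\<star> \<rhd> g) \<bullet> COEVT X"
  shows "f = g"
proof -
  have "(EVT X \<lhd> Z) \<bullet> (X \<rhd> ((X\<^sup>\<star> \<rhd> h) \<bullet> COEVT X)) = h" if h: "h \<in> homset X Z" for h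
  proof -
    have "(EVT X \<lhd> Z) \<bullet> ((X \<otimes>\<^sub>o X\<^sup>\<star>) \<rhd> h) = h \<bullet> (EVT X \<lhd> X)"
      using exchange[of "EVT X" h] homsetD[OF h] by simp
    from reassoc[OF this] show ?thesis using homsetD[OF h] by (simp add: evt_zigzag)
  qed
  with f g eq show ?thesis by metis
qed

lemma coevt_nonzero:
  assumes "COEVT X = Zero \<I> (X\<^sup>\<star> \<otimes>\<^sub>o X)"
  shows "Id X = Zero X X"
  by (rule coevt_inject[of _ X X]) (simp_all add: homset_def assms)

lemma unit_transpose:
  assumes f: "f \<in> homset \<I> (Y \<otimes>\<^sub>o X)"
  shows "\<exists>g\<in>homset (X\<^sup>\<star>) Y. f = (g \<lhd> X) \<bullet> COEVT X"
proof
  note [simp] = homsetD[OF f]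
  let ?g = "(Y \<rhd> EVT X) \<bullet> (f \<lhd> X\<^sup>\<star>)"
  show "?g \<in> homset (X\<^sup>\<star>) Y" by (simp add: homset_def)
  have 1: "(f \<lhd> (X\<^sup>\<star> \<otimes>\<^sub>o X)) \<bullet> COEVT X = ((Y \<otimes>\<^sub>o X) \<rhd> COEVT X) \<bullet> f"
    using exchange[of f "COEVT X"] by simp
  have 2: "(Y \<rhd> (EVT X \<lhd> X)) \<bullet> ((Y \<otimes>\<^sub>o X) \<rhd> COEVT X) = Id (Y \<otimes>\<^sub>o X)"
    using arg_cong[OF evt_zigzag[of X], of "\<lambda>h. Y \<rhd> h"] by simp
  show "f = (?g \<lhd> X) \<bullet> COEVT X" by (simp add: 1 reassoc[OF 2])
qed

lemma transpose_inject:
  assumes g: "g \<in> homset (X\<^sup>\<star>) Y" and z: "(g \<lhd> X) \<bullet> COEVT X = Zero \<I> (Y \<otimes>\<^sub>o X)"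
  shows "g = Zero (X\<^sup>\<star>) Y"
proof -
  note [simp] = homsetD[OF g]
  have 1: "(Y \<rhd> EVT X) \<bullet> (g \<lhd> (X \<otimes>\<^sub>o X\<^sup>\<star>)) = g \<bullet> (X\<^sup>\<star> \<rhd> EVT X)"
    using exchange[of g "EVT X"] by simp
  have "g = (Y \<rhd> EVT X) \<bullet> (((g \<lhd> X) \<bullet> COEVT X) \<lhd> X\<^sup>\<star>)"
    by (simp add: reassoc[OF 1] evt_zigzag_dual)
  then show ?thesis unfolding z by simp
qed

lemma EVT_COEV_dim:
  "dim_q C X \<in> carrier (base C)" "EVT X \<bullet> COEV X = scale (dim_q C X) (Id \<I>)"
proof -
  let ?t = "evt C X \<cdot> (\<i>\<d> X \<otimes>\<^sub>m \<i>\<d> (X\<^sup>\<star>)) \<cdot> coev C X"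
  have t: "?t = raw (EVT X \<bullet> COEV X)"
    unfolding raw_derived raw_generators(1,3) by (simp add: raw_fold)
  have h: "raw (EVT X \<bullet> COEV X) \<in> carrier (Hom C \<I> \<I>)"
    using raw_in_Hom[of "EVT X \<bullet> COEV X"] by simp
  let ?P = "\<lambda>b. b \<in> carrier (base C) \<and> raw (EVT X \<bullet> COEV X) = b \<odot>\<^bsub>Hom C \<I> \<I>\<^esub> \<i>\<d> \<I>"
  have "\<exists>!b. ?P b"
  proof (rule ex_ex1I)
    show "\<exists>b. ?P b"
      using h bij_betw_imp_surj_on[OF unit_scalar[unfolded scalar_object_def]] by blast
    show "b = c" if "?P b" "?P c" for b c
      using that inj_onD[OF bij_betw_imp_inj_on[OF unit_scalar[unfolded scalar_object_def]], of b c] by argo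
  qed
  from theI'[OF this] have d: "?P (dim_q C X)" unfolding dim_q_def tr_q_def t .
  then show c: "dim_q C X \<in> carrier (base C)" by blast
  show "EVT X \<bullet> COEV X = scale (dim_q C X) (Id \<I>)"
  proof (rule arrow_eqI)
    show "raw (EVT X \<bullet> COEV X) = raw (scale (dim_q C X) (Id \<I>))"
      using d by (simp add: raw_scale raw_Id)
  qed (use c in simp_all)
qed

declare dual_unit [simp]

lemma dim_q_unit: "dim_q C \<I> = \<one>\<^bsub>base C\<^esub>"
proof -
  have "EVT \<I> \<bullet> COEV \<I> = Id \<I>"
    using zigzag_arrow[of \<I>] by (simp add: EVT_def bev_def)
  then have "\<i>\<d> \<I> = dim_q C \<I> \<odot>\<^bsub>Hom C \<I> \<I>\<^esub> \<i>\<d> \<I>"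
    using EVT_COEV_dim[of \<I>] by (metis arr_Id raw_Id raw_scale src_tgt(3,4))
  moreover have "\<i>\<d> \<I> = \<one>\<^bsub>base C\<^esub> \<odot>\<^bsub>Hom C \<I> \<I>\<^esub> \<i>\<d> \<I>" by (simp add: ident_in_Hom)
  ultimately show ?thesis
    using inj_onD[OF bij_betw_imp_inj_on[OF unit_scalar[unfolded scalar_object_def]],
        of "dim_q C \<I>" "\<one>\<^bsub>base C\<^esub>"] EVT_COEV_dim(1)[of \<I>] by simp
qed

end

section \<open>The structure maps of the coend\<close>

context semisimple_ribbon_category
begin

abbreviation j where "j \<equiv> ss_coend_map C \<Lambda> B q"

lemma raw_J: "raw (J X) = j X"
  by (simp add: J_def coend_map_in_Hom)

lemma coend_factor_arrow:
  assumes d: "dinat Z d"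
  shows "arr (arrow B (coend_factor C B j Z (\<lambda>X. raw (d X))) Z)"
    and "arrow B (coend_factor C B j Z (\<lambda>X. raw (d X))) Z \<bullet> J X = d X"
proof -
  have D: "d X \<in> homset (X\<^sup>\<star> \<otimes>\<^sub>o X) Z" using d by (auto simp: dinat_def)
  note c = coend_factor[OF is_coend_B dinat_raw[OF d]]
  show "arr (arrow B (coend_factor C B j Z (\<lambda>X. raw (d X))) Z)" using c(1) by simp
  then show "arrow B (coend_factor C B j Z (\<lambda>X. raw (d X))) Z \<bullet> J X = d X"
    using c homsetD[OF D] by (intro arrow_eqI) (simp_all add: raw_comp raw_J)
qed

definition comult_family where
  "comult_family X = (J X \<lhd> B) \<bullet> ((X\<^sup>\<star> \<otimes>\<^sub>o X) \<rhd> J X) \<bullet> (X\<^sup>\<star> \<rhd> (COEV X \<lhd> X))"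

lemma comult_dinat: "dinat (B \<otimes>\<^sub>o B) comult_family"
  unfolding dinat_def
proof (intro conjI allI impI)
  show "comult_family X \<in> homset (X\<^sup>\<star> \<otimes>\<^sub>o X) (B \<otimes>\<^sub>o B)" for X
    by (simp add: comult_family_def homset_def)
  fix f X Y assume f: "arr f" "src f = X" "tgt f = Y"
  have 1: "(X\<^sup>\<star> \<rhd> (COEV X \<lhd> X)) \<bullet> (dual_arrow f \<lhd> X) = (dual_arrow f \<lhd> (X \<otimes>\<^sub>o X\<^sup>\<star> \<otimes>\<^sub>o X)) \<bullet> (Y\<^sup>\<star> \<rhd> (COEV X \<lhd> X))"
    using exchange[of "dual_arrow f" "COEV X \<lhd> X"] f by simp
  have 2: "((X\<^sup>\<star> \<otimes>\<^sub>o X) \<rhd> J X) \<bullet> (dual_arrow f \<lhd> (X \<otimes>\<^sub>o X\<^sup>\<star> \<otimes>\<^sub>o X)) = (dual_arrow f \<lhd> (X \<otimes>\<^sub>o B)) \<bullet> ((Y\<^sup>\<star> \<otimes>\<^sub>o X) \<rhd> J X)"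
    using exchange[of "dual_arrow f" "X \<rhd> J X"] f by simp
  have 3: "(J X \<lhd> B) \<bullet> (dual_arrow f \<lhd> (X \<otimes>\<^sub>o B)) = (J Y \<lhd> B) \<bullet> (Y\<^sup>\<star> \<rhd> (f \<lhd> B))"
    using arg_cong[OF J_dinatural[OF f], of "\<lambda>h. h \<lhd> B"] f by simp
  have 4: "(Y\<^sup>\<star> \<rhd> (f \<lhd> B)) \<bullet> ((Y\<^sup>\<star> \<otimes>\<^sub>o X) \<rhd> J X) = ((Y\<^sup>\<star> \<otimes>\<^sub>o Y) \<rhd> J X) \<bullet> (Y\<^sup>\<star> \<rhd> (f \<lhd> (X\<^sup>\<star> \<otimes>\<^sub>o X)))"
    using arg_cong[OF exchange[of f "J X"], of "\<lambda>h. Y\<^sup>\<star> \<rhd> h"] f by simp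
  have 5: "(Y\<^sup>\<star> \<rhd> (f \<lhd> (X\<^sup>\<star> \<otimes>\<^sub>o X))) \<bullet> (Y\<^sup>\<star> \<rhd> (COEV X \<lhd> X))
      = ((Y\<^sup>\<star> \<otimes>\<^sub>o Y) \<rhd> (dual_arrow f \<lhd> X)) \<bullet> (Y\<^sup>\<star> \<rhd> (COEV Y \<lhd> X))"
    using arg_cong[OF coev_dual[OF f], of "\<lambda>h. Y\<^sup>\<star> \<rhd> (h \<lhd> X)"] f by simp
  have 6: "((Y\<^sup>\<star> \<otimes>\<^sub>o Y) \<rhd> J X) \<bullet> ((Y\<^sup>\<star> \<otimes>\<^sub>o Y) \<rhd> (dual_arrow f \<lhd> X))
      = ((Y\<^sup>\<star> \<otimes>\<^sub>o Y) \<rhd> J Y) \<bullet> ((Y\<^sup>\<star> \<otimes>\<^sub>o Y \<otimes>\<^sub>o Y\<^sup>\<star>) \<rhd> f)"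
    using arg_cong[OF J_dinatural[OF f], of "\<lambda>h. (Y\<^sup>\<star> \<otimes>\<^sub>o Y) \<rhd> h"] f by simp
  have 7: "((Y\<^sup>\<star> \<otimes>\<^sub>o Y \<otimes>\<^sub>o Y\<^sup>\<star>) \<rhd> f) \<bullet> (Y\<^sup>\<star> \<rhd> (COEV Y \<lhd> X)) = (Y\<^sup>\<star> \<rhd> (COEV Y \<lhd> Y)) \<bullet> (Y\<^sup>\<star> \<rhd> f)"
    using exchange_at[of "COEV Y" f "Y\<^sup>\<star>" \<I> \<I>] f by simp
  show "comult_family X \<bullet> (dual_arrow f \<lhd> X) = comult_family Y \<bullet> (Y\<^sup>\<star> \<rhd> f)"
    unfolding comult_family_def comp_assoc 1 reassoc[OF 2] reassoc[OF 3] reassoc[OF 4] 5 reassoc[OF 6] 7 ..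
qed

definition COM where "COM = arrow B (coend_comult C B j) (B \<otimes>\<^sub>o B)"

lemma COM: "arr COM" "src COM = B" "tgt COM = B \<otimes>\<^sub>o B" "COM \<bullet> J X = comult_family X"
proof -
  have "(\<lambda>X. (j X \<otimes>\<^sub>m j X) \<cdot> (\<i>\<d> (X\<^sup>\<star>) \<otimes>\<^sub>m coev C X \<otimes>\<^sub>m \<i>\<d> X)) = (\<lambda>X. raw (comult_family X))"
    unfolding raw_J[symmetric] raw_generators(1,3)
    by (rule ext) (simp add: raw_fold comult_family_def tens_def[of "J _" "J _"])
  then have "COM = arrow B (coend_factor C B j (B \<otimes>\<^sub>o B) (\<lambda>X. raw (comult_family X))) (B \<otimes>\<^sub>o B)"
    by (simp add: COM_def coend_comult_def)
  then show "arr COM" "src COM = B" "tgt COM = B \<otimes>\<^sub>o B" "COM \<bullet> J X = comult_family X"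
    using coend_factor_arrow[OF comult_dinat] by simp_all
qed

definition antipode_family where
  "antipode_family X = J (X\<^sup>\<star>) \<bullet> (BETA X \<lhd> X\<^sup>\<star>) \<bullet> (X \<rhd> TW (X\<^sup>\<star>)) \<bullet> BR (X\<^sup>\<star>) X"

lemma antipode_dinat: "dinat B antipode_family"
  unfolding dinat_def
proof (intro conjI allI impI)
  show "antipode_family X \<in> homset (X\<^sup>\<star> \<otimes>\<^sub>o X) B" for X
    by (simp add: antipode_family_def homset_def)
  fix f X Y assume f: "arr f" "src f = X" "tgt f = Y"
  have 1: "BR (X\<^sup>\<star>) X \<bullet> (dual_arrow f \<lhd> X) = (X \<rhd> dual_arrow f) \<bullet> BR (Y\<^sup>\<star>) X"
    using f by (intro BR_natural_left) simp_all
  have 2: "(X \<rhd> TW (X\<^sup>\<star>)) \<bullet> (X \<rhd> dual_arrow f) = (X \<rhd> dual_arrow f) \<bullet> (X \<rhd> TW (Y\<^sup>\<star>))"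
    using arg_cong[OF TW_natural[of "dual_arrow f" "Y\<^sup>\<star>" "X\<^sup>\<star>"], of "\<lambda>h. X \<rhd> h"] f by simp
  have 3: "(BETA X \<lhd> X\<^sup>\<star>) \<bullet> (X \<rhd> dual_arrow f) = ((X\<^sup>\<star>)\<^sup>\<star> \<rhd> dual_arrow f) \<bullet> (BETA X \<lhd> Y\<^sup>\<star>)"
    using exchange[of "BETA X" "dual_arrow f"] f by simp
  have 4: "J (X\<^sup>\<star>) \<bullet> ((X\<^sup>\<star>)\<^sup>\<star> \<rhd> dual_arrow f) = J (Y\<^sup>\<star>) \<bullet> (dual_arrow (dual_arrow f) \<lhd> Y\<^sup>\<star>)"
    using f by (intro J_dinatural[symmetric]) simp_all
  have 5: "(dual_arrow (dual_arrow f) \<lhd> Y\<^sup>\<star>) \<bullet> (BETA X \<lhd> Y\<^sup>\<star>) = (BETA Y \<lhd> Y\<^sup>\<star>) \<bullet> (f \<lhd> Y\<^sup>\<star>)"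
    using arg_cong[OF beta_natural[OF f], of "\<lambda>h. h \<lhd> Y\<^sup>\<star>"] f by simp
  have 6: "(f \<lhd> Y\<^sup>\<star>) \<bullet> (X \<rhd> TW (Y\<^sup>\<star>)) = (Y \<rhd> TW (Y\<^sup>\<star>)) \<bullet> (f \<lhd> Y\<^sup>\<star>)"
    using exchange[of f "TW (Y\<^sup>\<star>)"] f by simp
  have 7: "(f \<lhd> Y\<^sup>\<star>) \<bullet> BR (Y\<^sup>\<star>) X = BR (Y\<^sup>\<star>) Y \<bullet> (Y\<^sup>\<star> \<rhd> f)"
    using f by (intro BR_natural_right[symmetric]) simp_all
  show "antipode_family X \<bullet> (dual_arrow f \<lhd> X) = antipode_family Y \<bullet> (Y\<^sup>\<star> \<rhd> f)"
    unfolding antipode_family_def comp_assoc 1 reassoc[OF 2] reassoc[OF 3] reassoc[OF 4] reassoc[OF 5] reassoc[OF 6] 7 ..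
qed

definition ANTI where "ANTI = arrow B (coend_antipode C B j) B"

lemma ANTI: "arr ANTI" "src ANTI = B" "tgt ANTI = B" "ANTI \<bullet> J X = antipode_family X"
proof -
  have "(\<lambda>X. j (X\<^sup>\<star>) \<cdot> (beta_mor C X \<otimes>\<^sub>m twist C (X\<^sup>\<star>)) \<cdot> braid C (X\<^sup>\<star>) X) = (\<lambda>X. raw (antipode_family X))"
    unfolding raw_J[symmetric] raw_generators(4,5) raw_derived
    by (rule ext) (simp add: raw_fold antipode_family_def tens_def[of "BETA _"])
  then have "ANTI = arrow B (coend_factor C B j B (\<lambda>X. raw (antipode_family X))) B"
    by (simp add: ANTI_def coend_antipode_def)
  then show "arr ANTI" "src ANTI = B" "tgt ANTI = B" "ANTI \<bullet> J X = antipode_family X"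
    using coend_factor_arrow[OF antipode_dinat] by simp_all
qed

lemma from_B_B_eqI:
  assumes f: "f \<in> homset (B \<otimes>\<^sub>o B) Z" and g: "g \<in> homset (B \<otimes>\<^sub>o B) Z"
    and eq: "\<And>l m. l \<in> \<Lambda> \<Longrightarrow> m \<in> \<Lambda> \<Longrightarrow>
      f \<bullet> (J l \<lhd> B) \<bullet> ((l\<^sup>\<star> \<otimes>\<^sub>o l) \<rhd> J m) = g \<bullet> (J l \<lhd> B) \<bullet> ((l\<^sup>\<star> \<otimes>\<^sub>o l) \<rhd> J m)"
  shows "f = g"
proof (rule dsum_epi[OF dsum_rw[OF dsum_B, of B] f g])
  note [simp] = homsetD[OF f] homsetD[OF g]
  fix l assume l: "l \<in> \<Lambda>"
  show "f \<bullet> (QB l \<lhd> B) = g \<bullet> (QB l \<lhd> B)"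
  proof (rule dsum_epi[OF dsum_lw[OF dsum_B, of "l\<^sup>\<star> \<otimes>\<^sub>o l"]])
    show "f \<bullet> (QB l \<lhd> B) \<in> homset ((l\<^sup>\<star> \<otimes>\<^sub>o l) \<otimes>\<^sub>o B) Z" "g \<bullet> (QB l \<lhd> B) \<in> homset ((l\<^sup>\<star> \<otimes>\<^sub>o l) \<otimes>\<^sub>o B) Z"
      using l by (simp_all add: homset_def)
    fix m assume m: "m \<in> \<Lambda>"
    show "(f \<bullet> (QB l \<lhd> B)) \<bullet> ((l\<^sup>\<star> \<otimes>\<^sub>o l) \<rhd> QB m) = (g \<bullet> (QB l \<lhd> B)) \<bullet> ((l\<^sup>\<star> \<otimes>\<^sub>o l) \<rhd> QB m)"
      using eq[OF l m] l m by (simp add: J_rep)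
  qed
qed

text \<open>
  The square of the universal property of \<open>B\<close>, for families that are dinatural in each of two variables.
  Together with the uniqueness in \<open>from_B_B_eqI\<close> it makes the description of \<open>m\<^sub>B\<close> by its values on \<open>j\<^sub>X \<otimes> j\<^sub>Y\<close>
  legitimate.  The two variables are treated one after the other, through \<open>X\<^sup>\<star> \<otimes> X \<otimes> B\<close>.
\<close>

lemma factor_through_B_B:
  assumes D: "\<And>X Y. d X Y \<in> homset (X\<^sup>\<star> \<otimes>\<^sub>o X \<otimes>\<^sub>o Y\<^sup>\<star> \<otimes>\<^sub>o Y) Z"
    and dl: "\<And>f X X' Y. arr f \<Longrightarrow> src f = X \<Longrightarrow> tgt f = X' \<Longrightarrow>
      d X Y \<bullet> (dual_arrow f \<lhd> (X \<otimes>\<^sub>o Y\<^sup>\<star> \<otimes>\<^sub>o Y)) = d X' Y \<bullet> (X'\<^sup>\<star> \<rhd> (f \<lhd> (Y\<^sup>\<star> \<otimes>\<^sub>o Y)))"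
    and dr: "\<And>f X Y Y'. arr f \<Longrightarrow> src f = Y \<Longrightarrow> tgt f = Y' \<Longrightarrow>
      d X Y \<bullet> ((X\<^sup>\<star> \<otimes>\<^sub>o X) \<rhd> (dual_arrow f \<lhd> Y)) = d X Y' \<bullet> ((X\<^sup>\<star> \<otimes>\<^sub>o X \<otimes>\<^sub>o Y'\<^sup>\<star>) \<rhd> f)"
  shows "\<exists>m\<in>homset (B \<otimes>\<^sub>o B) Z. \<forall>X Y. m \<bullet> (J X \<lhd> B) \<bullet> ((X\<^sup>\<star> \<otimes>\<^sub>o X) \<rhd> J Y) = d X Y"
proof -
  note [simp] = homsetD[OF D]
  have "\<exists>m\<in>homset ((X\<^sup>\<star> \<otimes>\<^sub>o X) \<otimes>\<^sub>o B) Z. \<forall>l\<in>\<Lambda>. m \<bullet> ((X\<^sup>\<star> \<otimes>\<^sub>o X) \<rhd> QB l) = d X l" for X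
    by (rule dsum_copair[OF dsum_lw[OF dsum_B]]) (simp add: homset_def)
  then obtain m1 where m1: "\<And>X. m1 X \<in> homset (X\<^sup>\<star> \<otimes>\<^sub>o X \<otimes>\<^sub>o B) Z"
    and m1Q: "\<And>X l. l \<in> \<Lambda> \<Longrightarrow> m1 X \<bullet> ((X\<^sup>\<star> \<otimes>\<^sub>o X) \<rhd> QB l) = d X l"
    unfolding tensor_ob_assoc by metis
  note [simp] = homsetD[OF m1]
  have "\<exists>m\<in>homset (B \<otimes>\<^sub>o B) Z. \<forall>l\<in>\<Lambda>. m \<bullet> (QB l \<lhd> B) = m1 l"
    by (rule dsum_copair[OF dsum_rw[OF dsum_B]]) (simp add: homset_def)
  then obtain m where m: "m \<in> homset (B \<otimes>\<^sub>o B) Z" and mQ: "\<And>l. l \<in> \<Lambda> \<Longrightarrow> m \<bullet> (QB l \<lhd> B) = m1 l"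
    by blast
  note [simp] = homsetD[OF m]
  have m1J: "m1 X \<bullet> ((X\<^sup>\<star> \<otimes>\<^sub>o X) \<rhd> J Y) = d X Y" for X Y
  proof -
    obtain n l P Q where l: "\<And>k. k < n \<Longrightarrow> l k \<in> \<Lambda>" and ds: "dsum {..<n::nat} l Y P Q"
      by (rule decomposition[of Y]) blast
    show ?thesis
    proof (rule dsum_epi[OF dsum_lw[OF ds, of "X\<^sup>\<star> \<otimes>\<^sub>o X \<otimes>\<^sub>o Y\<^sup>\<star>"]])
      show "m1 X \<bullet> ((X\<^sup>\<star> \<otimes>\<^sub>o X) \<rhd> J Y) \<in> homset ((X\<^sup>\<star> \<otimes>\<^sub>o X \<otimes>\<^sub>o Y\<^sup>\<star>) \<otimes>\<^sub>o Y) Z"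
        "d X Y \<in> homset ((X\<^sup>\<star> \<otimes>\<^sub>o X \<otimes>\<^sub>o Y\<^sup>\<star>) \<otimes>\<^sub>o Y) Z"
        by (simp_all add: homset_def)
      fix k assume k: "k \<in> {..<n}"
      then have Q: "arr (Q k)" "src (Q k) = l k" "tgt (Q k) = Y" using dsumD(3)[OF ds] by auto
      have lk: "l k \<in> \<Lambda>" using l k by simp
      have 1: "((X\<^sup>\<star> \<otimes>\<^sub>o X) \<rhd> J Y) \<bullet> ((X\<^sup>\<star> \<otimes>\<^sub>o X \<otimes>\<^sub>o Y\<^sup>\<star>) \<rhd> Q k)
          = ((X\<^sup>\<star> \<otimes>\<^sub>o X) \<rhd> QB (l k)) \<bullet> ((X\<^sup>\<star> \<otimes>\<^sub>o X) \<rhd> (dual_arrow (Q k) \<lhd> l k))"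
        using arg_cong[OF J_dinatural[OF Q], of "\<lambda>h. (X\<^sup>\<star> \<otimes>\<^sub>o X) \<rhd> h"] Q by (simp add: J_rep[OF lk])
      show "(m1 X \<bullet> ((X\<^sup>\<star> \<otimes>\<^sub>o X) \<rhd> J Y)) \<bullet> ((X\<^sup>\<star> \<otimes>\<^sub>o X \<otimes>\<^sub>o Y\<^sup>\<star>) \<rhd> Q k)
          = d X Y \<bullet> ((X\<^sup>\<star> \<otimes>\<^sub>o X \<otimes>\<^sub>o Y\<^sup>\<star>) \<rhd> Q k)"
        unfolding comp_assoc 1 reassoc[OF m1Q[OF lk]] by (rule dr[OF Q])
    qed
  qed
  have "m \<bullet> (J X \<lhd> B) \<bullet> ((X\<^sup>\<star> \<otimes>\<^sub>o X) \<rhd> J Y) = d X Y" for X Y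
  proof -
    obtain n l P Q where l: "\<And>k. k < n \<Longrightarrow> l k \<in> \<Lambda>" and ds: "dsum {..<n::nat} l X P Q"
      by (rule decomposition[of X]) blast
    show ?thesis
    proof (rule dsum_epi[OF dsum_lw[OF dsum_rw[OF ds, of "Y\<^sup>\<star> \<otimes>\<^sub>o Y"], of "X\<^sup>\<star>"]])
      show "m \<bullet> (J X \<lhd> B) \<bullet> ((X\<^sup>\<star> \<otimes>\<^sub>o X) \<rhd> J Y) \<in> homset (X\<^sup>\<star> \<otimes>\<^sub>o X \<otimes>\<^sub>o Y\<^sup>\<star> \<otimes>\<^sub>o Y) Z"
        "d X Y \<in> homset (X\<^sup>\<star> \<otimes>\<^sub>o X \<otimes>\<^sub>o Y\<^sup>\<star> \<otimes>\<^sub>o Y) Z"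
        by (simp_all add: homset_def)
      fix k assume k: "k \<in> {..<n}"
      then have Q: "arr (Q k)" "src (Q k) = l k" "tgt (Q k) = X" using dsumD(3)[OF ds] by auto
      have lk: "l k \<in> \<Lambda>" using l k by simp
      have 1: "((X\<^sup>\<star> \<otimes>\<^sub>o X) \<rhd> J Y) \<bullet> (X\<^sup>\<star> \<rhd> (Q k \<lhd> (Y\<^sup>\<star> \<otimes>\<^sub>o Y))) = (X\<^sup>\<star> \<rhd> (Q k \<lhd> B)) \<bullet> ((X\<^sup>\<star> \<otimes>\<^sub>o l k) \<rhd> J Y)"
        using exchange_at[of "Q k" "J Y" "X\<^sup>\<star>" \<I> \<I>] Q by simp
      have 2: "(J X \<lhd> B) \<bullet> (X\<^sup>\<star> \<rhd> (Q k \<lhd> B)) = (QB (l k) \<lhd> B) \<bullet> (dual_arrow (Q k) \<lhd> (l k \<otimes>\<^sub>o B))"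
        using arg_cong[OF J_dinatural[OF Q], of "\<lambda>h. h \<lhd> B"] Q by (simp add: J_rep[OF lk])
      have 3: "(dual_arrow (Q k) \<lhd> (l k \<otimes>\<^sub>o B)) \<bullet> ((X\<^sup>\<star> \<otimes>\<^sub>o l k) \<rhd> J Y)
          = (((l k)\<^sup>\<star> \<otimes>\<^sub>o l k) \<rhd> J Y) \<bullet> (dual_arrow (Q k) \<lhd> (l k \<otimes>\<^sub>o Y\<^sup>\<star> \<otimes>\<^sub>o Y))"
        using exchange[of "dual_arrow (Q k)" "l k \<rhd> J Y"] Q by simp
      show "(m \<bullet> (J X \<lhd> B) \<bullet> ((X\<^sup>\<star> \<otimes>\<^sub>o X) \<rhd> J Y)) \<bullet> (X\<^sup>\<star> \<rhd> (Q k \<lhd> (Y\<^sup>\<star> \<otimes>\<^sub>o Y)))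
          = d X Y \<bullet> (X\<^sup>\<star> \<rhd> (Q k \<lhd> (Y\<^sup>\<star> \<otimes>\<^sub>o Y)))"
        unfolding comp_assoc 1 reassoc[OF 2] 3 reassoc[OF mQ[OF lk]] reassoc[OF m1J] by (rule dl[OF Q])
    qed
  qed
  with m show ?thesis by blast
qed

definition mult_family where
  "mult_family X Y = J (Y \<otimes>\<^sub>o X) \<bullet> (GAMMA X Y \<lhd> (Y \<otimes>\<^sub>o X)) \<bullet> (X\<^sup>\<star> \<rhd> BR X (Y\<^sup>\<star> \<otimes>\<^sub>o Y))"

lemma mult_family_homset: "mult_family X Y \<in> homset (X\<^sup>\<star> \<otimes>\<^sub>o X \<otimes>\<^sub>o Y\<^sup>\<star> \<otimes>\<^sub>o Y) B"
  by (simp add: mult_family_def homset_def)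

lemma mult_family_dinatural_left:
  assumes f: "arr f" "src f = X" "tgt f = X'"
  shows "mult_family X Y \<bullet> (dual_arrow f \<lhd> (X \<otimes>\<^sub>o Y\<^sup>\<star> \<otimes>\<^sub>o Y)) = mult_family X' Y \<bullet> (X'\<^sup>\<star> \<rhd> (f \<lhd> (Y\<^sup>\<star> \<otimes>\<^sub>o Y)))"
proof -
  have 1: "(X\<^sup>\<star> \<rhd> BR X (Y\<^sup>\<star> \<otimes>\<^sub>o Y)) \<bullet> (dual_arrow f \<lhd> (X \<otimes>\<^sub>o Y\<^sup>\<star> \<otimes>\<^sub>o Y))
      = (dual_arrow f \<lhd> (Y\<^sup>\<star> \<otimes>\<^sub>o Y \<otimes>\<^sub>o X)) \<bullet> (X'\<^sup>\<star> \<rhd> BR X (Y\<^sup>\<star> \<otimes>\<^sub>o Y))"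
    using exchange[of "dual_arrow f" "BR X (Y\<^sup>\<star> \<otimes>\<^sub>o Y)"] f by simp
  have 2: "(GAMMA X Y \<lhd> (Y \<otimes>\<^sub>o X)) \<bullet> (dual_arrow f \<lhd> (Y\<^sup>\<star> \<otimes>\<^sub>o Y \<otimes>\<^sub>o X))
      = (dual_arrow (Y \<rhd> f) \<lhd> (Y \<otimes>\<^sub>o X)) \<bullet> (GAMMA X' Y \<lhd> (Y \<otimes>\<^sub>o X))"
    using arg_cong[OF gamma_natural_left[OF f, of Y], of "\<lambda>h. h \<lhd> (Y \<otimes>\<^sub>o X)"] f by simp
  have 3: "J (Y \<otimes>\<^sub>o X) \<bullet> (dual_arrow (Y \<rhd> f) \<lhd> (Y \<otimes>\<^sub>o X)) = J (Y \<otimes>\<^sub>o X') \<bullet> (((Y \<otimes>\<^sub>o X')\<^sup>\<star> \<otimes>\<^sub>o Y) \<rhd> f)"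
    using J_dinatural[of "Y \<rhd> f" "Y \<otimes>\<^sub>o X" "Y \<otimes>\<^sub>o X'"] f by simp
  have 4: "(((Y \<otimes>\<^sub>o X')\<^sup>\<star> \<otimes>\<^sub>o Y) \<rhd> f) \<bullet> (GAMMA X' Y \<lhd> (Y \<otimes>\<^sub>o X))
      = (GAMMA X' Y \<lhd> (Y \<otimes>\<^sub>o X')) \<bullet> ((X'\<^sup>\<star> \<otimes>\<^sub>o Y\<^sup>\<star> \<otimes>\<^sub>o Y) \<rhd> f)"
    using exchange[of "GAMMA X' Y" "Y \<rhd> f"] f by simp
  have 5: "((X'\<^sup>\<star> \<otimes>\<^sub>o Y\<^sup>\<star> \<otimes>\<^sub>o Y) \<rhd> f) \<bullet> (X'\<^sup>\<star> \<rhd> BR X (Y\<^sup>\<star> \<otimes>\<^sub>o Y))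
      = (X'\<^sup>\<star> \<rhd> BR X' (Y\<^sup>\<star> \<otimes>\<^sub>o Y)) \<bullet> (X'\<^sup>\<star> \<rhd> (f \<lhd> (Y\<^sup>\<star> \<otimes>\<^sub>o Y)))"
    using arg_cong[OF BR_natural_left[OF f, of "Y\<^sup>\<star> \<otimes>\<^sub>o Y"], of "\<lambda>h. X'\<^sup>\<star> \<rhd> h"] f by simp
  show ?thesis
    unfolding mult_family_def comp_assoc 1 reassoc[OF 2] reassoc[OF 3] reassoc[OF 4] 5 ..
qed

lemma mult_family_dinatural_right:
  assumes f: "arr f" "src f = Y" "tgt f = Y'"
  shows "mult_family X Y \<bullet> ((X\<^sup>\<star> \<otimes>\<^sub>o X) \<rhd> (dual_arrow f \<lhd> Y)) = mult_family X Y' \<bullet> ((X\<^sup>\<star> \<otimes>\<^sub>o X \<otimes>\<^sub>o Y'\<^sup>\<star>) \<rhd> f)"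
proof -
  have 1: "(X\<^sup>\<star> \<rhd> BR X (Y\<^sup>\<star> \<otimes>\<^sub>o Y)) \<bullet> ((X\<^sup>\<star> \<otimes>\<^sub>o X) \<rhd> (dual_arrow f \<lhd> Y))
      = (X\<^sup>\<star> \<rhd> (dual_arrow f \<lhd> (Y \<otimes>\<^sub>o X))) \<bullet> (X\<^sup>\<star> \<rhd> BR X (Y'\<^sup>\<star> \<otimes>\<^sub>o Y))"
    using arg_cong[OF BR_natural_right[of "dual_arrow f \<lhd> Y" "Y'\<^sup>\<star> \<otimes>\<^sub>o Y" "Y\<^sup>\<star> \<otimes>\<^sub>o Y" X], of "\<lambda>h. X\<^sup>\<star> \<rhd> h"] f by simp
  have 2: "(GAMMA X Y \<lhd> (Y \<otimes>\<^sub>o X)) \<bullet> (X\<^sup>\<star> \<rhd> (dual_arrow f \<lhd> (Y \<otimes>\<^sub>o X)))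
      = (dual_arrow (f \<lhd> X) \<lhd> (Y \<otimes>\<^sub>o X)) \<bullet> (GAMMA X Y' \<lhd> (Y \<otimes>\<^sub>o X))"
    using arg_cong[OF gamma_natural_right[OF f, of X], of "\<lambda>h. h \<lhd> (Y \<otimes>\<^sub>o X)"] f by simp
  have 3: "J (Y \<otimes>\<^sub>o X) \<bullet> (dual_arrow (f \<lhd> X) \<lhd> (Y \<otimes>\<^sub>o X)) = J (Y' \<otimes>\<^sub>o X) \<bullet> ((Y' \<otimes>\<^sub>o X)\<^sup>\<star> \<rhd> (f \<lhd> X))"
    using f by (intro J_dinatural) simp_all
  have 4: "((Y' \<otimes>\<^sub>o X)\<^sup>\<star> \<rhd> (f \<lhd> X)) \<bullet> (GAMMA X Y' \<lhd> (Y \<otimes>\<^sub>o X))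
      = (GAMMA X Y' \<lhd> (Y' \<otimes>\<^sub>o X)) \<bullet> ((X\<^sup>\<star> \<otimes>\<^sub>o Y'\<^sup>\<star>) \<rhd> (f \<lhd> X))"
    using exchange[of "GAMMA X Y'" "f \<lhd> X"] f by simp
  have 5: "((X\<^sup>\<star> \<otimes>\<^sub>o Y'\<^sup>\<star>) \<rhd> (f \<lhd> X)) \<bullet> (X\<^sup>\<star> \<rhd> BR X (Y'\<^sup>\<star> \<otimes>\<^sub>o Y))
      = (X\<^sup>\<star> \<rhd> BR X (Y'\<^sup>\<star> \<otimes>\<^sub>o Y')) \<bullet> ((X\<^sup>\<star> \<otimes>\<^sub>o X \<otimes>\<^sub>o Y'\<^sup>\<star>) \<rhd> f)"
    using arg_cong[OF BR_natural_right[of "Y'\<^sup>\<star> \<rhd> f" "Y'\<^sup>\<star> \<otimes>\<^sub>o Y" "Y'\<^sup>\<star> \<otimes>\<^sub>o Y'" X], of "\<lambda>h. X\<^sup>\<star> \<rhd> h"] f by simp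
  show ?thesis
    unfolding mult_family_def comp_assoc 1 reassoc[OF 2] reassoc[OF 3] reassoc[OF 4] 5 ..
qed

definition MULT where "MULT = arrow (B \<otimes>\<^sub>o B) (coend_mult C B j) B"

lemma MULT:
  "arr MULT" "src MULT = B \<otimes>\<^sub>o B" "tgt MULT = B"
  "MULT \<bullet> (J X \<lhd> B) \<bullet> ((X\<^sup>\<star> \<otimes>\<^sub>o X) \<rhd> J Y) = mult_family X Y"
proof -
  have e: "j (Y \<otimes>\<^sub>o X) \<cdot> (gamma_mor C X Y \<otimes>\<^sub>m \<i>\<d> (Y \<otimes>\<^sub>o X)) \<cdot> (\<i>\<d> (X\<^sup>\<star>) \<otimes>\<^sub>m braid C X (Y\<^sup>\<star> \<otimes>\<^sub>o Y))
      = raw (mult_family X Y)" for X Y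
    unfolding raw_J[symmetric] raw_generators(1,4) raw_derived
    by (simp add: raw_fold mult_family_def)
  have jj: "j X \<otimes>\<^sub>m j Y = raw ((J X \<lhd> B) \<bullet> ((X\<^sup>\<star> \<otimes>\<^sub>o X) \<rhd> J Y))" for X Y
    unfolding raw_J[symmetric] by (simp add: raw_tens[symmetric] tens_def)
  let ?P = "\<lambda>m. m \<in> carrier (Hom C (B \<otimes>\<^sub>o B) B) \<and> (\<forall>X Y. m \<cdot> (j X \<otimes>\<^sub>m j Y) = raw (mult_family X Y))"
  have P_iff: "?P (raw m) \<longleftrightarrow> (\<forall>X Y. m \<bullet> (J X \<lhd> B) \<bullet> ((X\<^sup>\<star> \<otimes>\<^sub>o X) \<rhd> J Y) = mult_family X Y)"
    if m: "m \<in> homset (B \<otimes>\<^sub>o B) B" for m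
  proof -
    note [simp] = homsetD[OF m] homsetD[OF mult_family_homset]
    have "raw m \<cdot> (j X \<otimes>\<^sub>m j Y) = raw (m \<bullet> (J X \<lhd> B) \<bullet> ((X\<^sup>\<star> \<otimes>\<^sub>o X) \<rhd> J Y))" for X Y
      unfolding jj by (simp add: raw_comp[of _ m])
    moreover have "raw (m \<bullet> (J X \<lhd> B) \<bullet> ((X\<^sup>\<star> \<otimes>\<^sub>o X) \<rhd> J Y)) = raw (mult_family X Y)
        \<longleftrightarrow> m \<bullet> (J X \<lhd> B) \<bullet> ((X\<^sup>\<star> \<otimes>\<^sub>o X) \<rhd> J Y) = mult_family X Y" for X Y
      by (rule iffI, rule arrow_eqI) simp_all
    ultimately show ?thesis using raw_in_Hom'[OF m] by simp
  qed
  obtain m where m: "m \<in> homset (B \<otimes>\<^sub>o B) B"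
    "\<And>X Y. m \<bullet> (J X \<lhd> B) \<bullet> ((X\<^sup>\<star> \<otimes>\<^sub>o X) \<rhd> J Y) = mult_family X Y"
    using factor_through_B_B[OF mult_family_homset mult_family_dinatural_left mult_family_dinatural_right] by blast
  have "coend_mult C B j = raw m"
    unfolding coend_mult_def e
  proof (rule the_equality)
    show "?P (raw m)" using P_iff[OF m(1)] m(2) by blast
    fix s assume s: "?P s"
    let ?s = "arrow (B \<otimes>\<^sub>o B) s B"
    have hs: "?s \<in> homset (B \<otimes>\<^sub>o B) B" and rs: "raw ?s = s" using s by (simp_all add: homset_arrow)
    have "?s \<bullet> (J X \<lhd> B) \<bullet> ((X\<^sup>\<star> \<otimes>\<^sub>o X) \<rhd> J Y) = mult_family X Y" for X Y
      using P_iff[OF hs] s unfolding rs by blast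
    then have "?s = m" using m(2) by (intro from_B_B_eqI[OF hs m(1)]) simp
    then show "s = raw m" using rs by simp
  qed
  then have "MULT = m" using arrow_raw[of m] homsetD[OF m(1)] by (simp add: MULT_def)
  then show "arr MULT" "src MULT = B \<otimes>\<^sub>o B" "tgt MULT = B"
    "MULT \<bullet> (J X \<lhd> B) \<bullet> ((X\<^sup>\<star> \<otimes>\<^sub>o X) \<rhd> J Y) = mult_family X Y"
    using m by auto
qed

lemmas [simp] = COM(1-3) ANTI(1-3) MULT(1-3)

end

section \<open>Classes of objects in Hom(1, B)\<close>

context linear_category
begin

lemma Sum_subset:
  assumes "finite I" "K \<subseteq> I" and F: "\<And>i. i \<in> I \<Longrightarrow> F i \<in> homset X Y"
    and z: "\<And>i. i \<in> I - K \<Longrightarrow> F i = Zero X Y"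
  shows "Sum X Y F I = Sum X Y F K"
proof -
  have "(\<Oplus>\<^bsub>Hom C X Y\<^esub>i\<in>K. raw (F i)) = (\<Oplus>\<^bsub>Hom C X Y\<^esub>i\<in>I. raw (F i))"
    using assms(1,2) z raw_in_Hom'[OF F]
    by (intro Hom.M.add.finprod_mono_neutral_cong_left) (auto simp: raw_Zero)
  then show ?thesis by (simp add: Sum_def)
qed

end

context semisimple_ribbon_category
begin

text \<open>
  The basis elements are the \<open>e\<^sub>l\<close> with \<open>l \<in> \<Lambda>\<close>; products and antipodes of these lead to the objects \<open>m \<otimes> l\<close>
  and \<open>l\<^sup>\<star>\<close>, which lie outside \<open>\<Lambda>\<close> in general.
\<close>

definition E where "E X = J X \<bullet> COEVT X"

lemma E_arr [simp]: "arr (E X)" "src (E X) = \<I>" "tgt (E X) = B"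
  by (simp_all add: E_def)

lemma J_coevt_cyclic:
  assumes f: "arr f" "src f = X" "tgt f = Y" and g: "arr g" "src g = Y" "tgt g = X"
  shows "J X \<bullet> (X\<^sup>\<star> \<rhd> (g \<bullet> f)) \<bullet> COEVT X = J Y \<bullet> (Y\<^sup>\<star> \<rhd> (f \<bullet> g)) \<bullet> COEVT Y"
proof -
  have 1: "(X\<^sup>\<star> \<rhd> g) \<bullet> (dual_arrow f \<lhd> Y) = (dual_arrow f \<lhd> X) \<bullet> (Y\<^sup>\<star> \<rhd> g)"
    using exchange[of "dual_arrow f" g] f g by simp
  have "J X \<bullet> (X\<^sup>\<star> \<rhd> (g \<bullet> f)) \<bullet> COEVT X = J X \<bullet> (X\<^sup>\<star> \<rhd> g) \<bullet> (X\<^sup>\<star> \<rhd> f) \<bullet> COEVT X"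
    using f g by simp
  also have "\<dots> = J Y \<bullet> (Y\<^sup>\<star> \<rhd> f) \<bullet> (Y\<^sup>\<star> \<rhd> g) \<bullet> COEVT Y"
    unfolding coevt_natural[OF f, symmetric] reassoc[OF 1] comp_assoc reassoc[OF J_dinatural[OF f]] ..
  finally show ?thesis using f g by simp
qed

lemma E_isomorphic:
  assumes "isomorphic C X Y"
  shows "E X = E Y"
proof -
  obtain f g where fg: "f \<in> homset X Y" "g \<in> homset Y X" "g \<bullet> f = Id X" "f \<bullet> g = Id Y"
    using assms by (rule isomorphicE)
  show ?thesis
    using J_coevt_cyclic[OF homsetD[OF fg(1)] homsetD[OF fg(2)]] unfolding fg(3,4) by (simp add: E_def)
qed

text \<open>
  Insert \<open>id = \<Sum> q\<^sub>i p\<^sub>i\<close> and use cyclicity to replace \<open>q\<^sub>i p\<^sub>i\<close> by \<open>p\<^sub>i q\<^sub>i = id\<close>.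
\<close>

lemma E_dsum:
  assumes d: "dsum I F X P Q"
  shows "E X = Sum \<I> B (\<lambda>i. E (F i)) I"
proof -
  have t: "arr (P i)" "src (P i) = X" "tgt (P i) = F i" "arr (Q i)" "src (Q i) = F i" "tgt (Q i) = X" if "i \<in> I" for i
    using dsumD(2,3)[OF d that] by auto
  have "E X = J X \<bullet> (X\<^sup>\<star> \<rhd> Sum X X (\<lambda>i. Q i \<bullet> P i) I) \<bullet> COEVT X"
    by (simp add: E_def dsumD(6)[OF d])
  also have "X\<^sup>\<star> \<rhd> Sum X X (\<lambda>i. Q i \<bullet> P i) I = Sum (X\<^sup>\<star> \<otimes>\<^sub>o X) (X\<^sup>\<star> \<otimes>\<^sub>o X) (\<lambda>i. X\<^sup>\<star> \<rhd> (Q i \<bullet> P i)) I"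
    by (rule lw_Sum) (rule qp_homset[OF d])
  also have "\<dots> \<bullet> COEVT X = Sum \<I> (X\<^sup>\<star> \<otimes>\<^sub>o X) (\<lambda>i. (X\<^sup>\<star> \<rhd> (Q i \<bullet> P i)) \<bullet> COEVT X) I"
    using t by (subst Sum_comp) (auto simp: homset_def)
  also have "J X \<bullet> \<dots> = Sum \<I> B (\<lambda>i. J X \<bullet> (X\<^sup>\<star> \<rhd> (Q i \<bullet> P i)) \<bullet> COEVT X) I"
    using t by (subst comp_Sum) (auto simp: homset_def)
  also have "\<dots> = Sum \<I> B (\<lambda>i. E (F i)) I"
  proof (rule Sum_cong)
    fix i assume i: "i \<in> I"
    note ti = t[OF i]
    show "J X \<bullet> (X\<^sup>\<star> \<rhd> (Q i \<bullet> P i)) \<bullet> COEVT X = E (F i)"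
      unfolding J_coevt_cyclic[OF ti] dsumD(4)[OF d i] by (simp add: E_def)
    show "J X \<bullet> (X\<^sup>\<star> \<rhd> (Q i \<bullet> P i)) \<bullet> COEVT X \<in> homset \<I> B" using ti by (simp add: homset_def)
  qed
  finally show ?thesis .
qed

text \<open>
  The braiding in the product of the coend slides over \<open>coevt\<^sub>Y\<close>, and the result is \<open>coevt\<close> of \<open>Y \<otimes> X\<close> by
  \<open>coevt_tensor\<close>.
\<close>

lemma MULT_E: "MULT \<bullet> (E X \<lhd> B) \<bullet> E Y = E (Y \<otimes>\<^sub>o X)"
proof -
  have 1: "(COEVT X \<lhd> B) \<bullet> J Y = ((X\<^sup>\<star> \<otimes>\<^sub>o X) \<rhd> J Y) \<bullet> (COEVT X \<lhd> (Y\<^sup>\<star> \<otimes>\<^sub>o Y))"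
    using exchange[of "COEVT X" "J Y"] by simp
  have 2: "(COEVT X \<lhd> (Y\<^sup>\<star> \<otimes>\<^sub>o Y)) \<bullet> COEVT Y = ((X\<^sup>\<star> \<otimes>\<^sub>o X) \<rhd> COEVT Y) \<bullet> COEVT X"
    using exchange[of "COEVT X" "COEVT Y"] by simp
  have 3: "(X\<^sup>\<star> \<rhd> BR X (Y\<^sup>\<star> \<otimes>\<^sub>o Y)) \<bullet> ((X\<^sup>\<star> \<otimes>\<^sub>o X) \<rhd> COEVT Y) = X\<^sup>\<star> \<rhd> (COEVT Y \<lhd> X)"
    using arg_cong[OF BR_natural_right[of "COEVT Y" \<I> "Y\<^sup>\<star> \<otimes>\<^sub>o Y" X], of "\<lambda>h. X\<^sup>\<star> \<rhd> h"] by simp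
  have "MULT \<bullet> (E X \<lhd> B) \<bullet> E Y = MULT \<bullet> (J X \<lhd> B) \<bullet> (COEVT X \<lhd> B) \<bullet> J Y \<bullet> COEVT Y"
    by (simp add: E_def)
  also have "\<dots> = (MULT \<bullet> (J X \<lhd> B) \<bullet> ((X\<^sup>\<star> \<otimes>\<^sub>o X) \<rhd> J Y)) \<bullet> ((X\<^sup>\<star> \<otimes>\<^sub>o X) \<rhd> COEVT Y) \<bullet> COEVT X"
    by (simp only: reassoc[OF 1] 2 comp_assoc)
  also have "\<dots> = J (Y \<otimes>\<^sub>o X) \<bullet> (GAMMA X Y \<lhd> (Y \<otimes>\<^sub>o X)) \<bullet> (X\<^sup>\<star> \<rhd> (COEVT Y \<lhd> X)) \<bullet> COEVT X"
    by (simp only: MULT(4) mult_family_def reassoc[OF 3] comp_assoc)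
  also have "\<dots> = E (Y \<otimes>\<^sub>o X)"
    by (simp only: E_def coevt_tensor)
  finally show ?thesis .
qed

lemma ANTI_E: "ANTI \<bullet> E X = E (X\<^sup>\<star>)"
proof -
  have "ANTI \<bullet> E X = (ANTI \<bullet> J X) \<bullet> COEVT X" by (simp add: E_def)
  also have "\<dots> = J (X\<^sup>\<star>) \<bullet> (BETA X \<lhd> X\<^sup>\<star>) \<bullet> (X \<rhd> TW (X\<^sup>\<star>)) \<bullet> BR (X\<^sup>\<star>) X \<bullet> COEVT X"
    by (simp only: ANTI(4) antipode_family_def comp_assoc)
  also have "\<dots> = E (X\<^sup>\<star>)"
    by (simp only: braid_twist_coevt coevt_dual E_def)
  finally show ?thesis .
qed

lemma finite_reps: "finite \<Lambda>"
  using dsumD(1)[OF dsum_B] .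

text \<open>
  A simple summand \<open>k\<close> of \<open>l\<^sup>\<star>\<close> gives an idempotent \<open>q p\<close> of \<open>l\<^sup>\<star>\<close>.  Endomorphisms of \<open>l\<^sup>\<star>\<close> are transposes of
  endomorphisms of \<open>l\<close>, hence scalars; a nonzero scalar idempotent is the identity, so \<open>k \<simeq> l\<^sup>\<star>\<close>.
\<close>

lemma dual_rep_exists:
  assumes l: "l \<in> \<Lambda>"
  shows "\<exists>k\<in>\<Lambda>. isomorphic C k (l\<^sup>\<star>)"
proof -
  obtain n k P Q where k: "\<And>i. i < n \<Longrightarrow> k i \<in> \<Lambda>" and d: "dsum {..<n::nat} k (l\<^sup>\<star>) P Q"
    by (rule decomposition[of "l\<^sup>\<star>"]) blast
  have "n \<noteq> 0"
  proof
    assume "n = 0"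
    then have "Id (l\<^sup>\<star>) = Zero (l\<^sup>\<star>) (l\<^sup>\<star>)" using dsumD(6)[OF d] Sum_zero[of "{..<n}"] by simp
    then show False using dual_nonzero Id_rep_nonzero[OF l] by blast
  qed
  then have 0: "0 \<in> {..<n}" and k0: "k 0 \<in> \<Lambda>" using k by auto
  note [simp] = homsetD[OF dsumD(2)[OF d 0]] homsetD[OF dsumD(3)[OF d 0]]
  have PQ: "P 0 \<bullet> Q 0 = Id (k 0)" by (rule dsumD(4)[OF d 0])
  obtain g where g: "g \<in> homset l l" "Q 0 \<bullet> P 0 = dual_arrow g"
    using dual_full[of "Q 0 \<bullet> P 0" l l] by (auto simp: homset_def)
  obtain c where c: "c \<in> carrier (base C)" "g = scale c (Id l)"
    using schur_scalar[OF l g(1)] by blast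
  have QP: "Q 0 \<bullet> P 0 = scale c (Id (l\<^sup>\<star>))" using g(2) c by simp
  have "Q 0 \<bullet> (P 0 \<bullet> Q 0) = scale c (Q 0)"
    using reassoc[OF QP, of "Q 0"] c(1) by simp
  then have "scale c (Q 0) = scale \<one>\<^bsub>base C\<^esub> (Q 0)" unfolding PQ by simp
  moreover have "Q 0 \<noteq> Zero (k 0) (l\<^sup>\<star>)"
    using PQ Id_rep_nonzero[OF k0] by auto
  ultimately have "c = \<one>\<^bsub>base C\<^esub>"
    using c(1) by (intro scale_cancel_scalar[of "Q 0"]) simp_all
  with QP PQ k0 show ?thesis
    by (intro bexI[of _ "k 0"] isomorphicI[of "Q 0" _ _ "P 0"]) (simp_all add: homset_def)
qed

lemma vee:
  assumes l: "l \<in> \<Lambda>"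
  shows "vee C \<Lambda> l \<in> \<Lambda>" "isomorphic C (vee C \<Lambda> l) (l\<^sup>\<star>)"
proof -
  have "\<exists>!k. k \<in> \<Lambda> \<and> isomorphic C k (l\<^sup>\<star>)"
    using dual_rep_exists[OF l] rep_unique isomorphic_trans isomorphic_sym by metis
  from theI'[OF this] show "vee C \<Lambda> l \<in> \<Lambda>" "isomorphic C (vee C \<Lambda> l) (l\<^sup>\<star>)"
    unfolding vee_def by blast+
qed

lemma vee_inj:
  assumes l: "l \<in> \<Lambda>" and m: "m \<in> \<Lambda>" and eq: "vee C \<Lambda> l = vee C \<Lambda> m"
  shows "l = m"
proof (rule ccontr)
  assume ne: "l \<noteq> m"
  have "isomorphic C (m\<^sup>\<star>) (l\<^sup>\<star>)"
    using vee(2)[OF l] vee(2)[OF m] eq isomorphic_sym isomorphic_trans by metis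
  then obtain u v where uv: "u \<in> homset (m\<^sup>\<star>) (l\<^sup>\<star>)" "v \<in> homset (l\<^sup>\<star>) (m\<^sup>\<star>)" "u \<bullet> v = Id (l\<^sup>\<star>)"
    by (rule isomorphicE)
  obtain g where g: "g \<in> homset l m" "u = dual_arrow g" using dual_full[OF uv(1)] by blast
  have "g = Zero l m" by (rule schur_zero[OF l m ne g(1)])
  then have "u = Zero (m\<^sup>\<star>) (l\<^sup>\<star>)" using g(2) by simp
  then have "Id (l\<^sup>\<star>) = Zero (l\<^sup>\<star>) (l\<^sup>\<star>)" using uv homsetD[OF uv(2)] by simp
  then show False using dual_nonzero Id_rep_nonzero[OF l] by blast
qed

lemma E_vee: "l \<in> \<Lambda> \<Longrightarrow> E (l\<^sup>\<star>) = E (vee C \<Lambda> l)"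
  using E_isomorphic[OF vee(2)] by simp

lemma PB_E:
  assumes "m \<in> \<Lambda>" "l \<in> \<Lambda>"
  shows "PB m \<bullet> E l = (if m = l then COEVT m else Zero \<I> (m\<^sup>\<star> \<otimes>\<^sub>o m))"
proof -
  have "PB m \<bullet> E l = (PB m \<bullet> QB l) \<bullet> COEVT l" using assms by (simp add: E_def J_rep)
  also have "PB m \<bullet> QB l = (if m = l then Id (m\<^sup>\<star> \<otimes>\<^sub>o m) else Zero (l\<^sup>\<star> \<otimes>\<^sub>o l) (m\<^sup>\<star> \<otimes>\<^sub>o m))"
    using dsumD(4,5)[OF dsum_B] assms by auto
  also have "\<dots> \<bullet> COEVT l = (if m = l then COEVT m else Zero \<I> (m\<^sup>\<star> \<otimes>\<^sub>o m))"
    by auto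
  finally show ?thesis .
qed

lemma COEVT_rep_nonzero: "l \<in> \<Lambda> \<Longrightarrow> COEVT l \<noteq> Zero \<I> (l\<^sup>\<star> \<otimes>\<^sub>o l)"
  using coevt_nonzero Id_rep_nonzero by blast

lemma PB_unit_E_zero:
  assumes "\<And>f. f \<in> homset \<I> X \<Longrightarrow> f = Zero \<I> X"
  shows "PB \<I> \<bullet> E X = Zero \<I> \<I>"
proof -
  obtain n l P Q where l: "\<And>k. k < n \<Longrightarrow> l k \<in> \<Lambda>" and d: "dsum {..<n::nat} l X P Q"
    by (rule decomposition[of X]) blast
  have ne: "\<I> \<noteq> l k" if k: "k \<in> {..<n}" for k
  proof
    assume e: "\<I> = l k"
    then have "Q k = Zero \<I> X" using assms dsumD(3)[OF d k] by simp
    then have "Id \<I> = Zero \<I> \<I>"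
      using dsumD(4)[OF d k] homsetD[OF dsumD(2)[OF d k]] unfolding e by simp
    then show False using Id_rep_nonzero[OF unit_in] by simp
  qed
  have "PB \<I> \<bullet> E (l k) = Zero \<I> \<I>" if "k \<in> {..<n}" for k
    using PB_E[OF unit_in l[of k]] that ne[OF that] by simp
  moreover have "PB \<I> \<bullet> E X = Sum \<I> \<I> (\<lambda>k. PB \<I> \<bullet> E (l k)) {..<n}"
    unfolding E_dsum[OF d] using unit_in by (subst comp_Sum) (auto simp: homset_def)
  ultimately show ?thesis using Sum_zero[of "{..<n}" "\<lambda>k. PB \<I> \<bullet> E (l k)" \<I> \<I>] by simp
qed

text \<open>
  If \<open>Hom(\<I>, X)\<close> is a line then \<open>\<I>\<close> occurs exactly once in a decomposition of \<open>X\<close>: if it did not occur, the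
  generator \<open>u\<close> would have no nonzero component; two occurrences would give proportional injections,
  contradicting their orthogonality.
\<close>

lemma PB_unit_E_line:
  assumes u: "u \<in> homset \<I> X" "u \<noteq> Zero \<I> X"
    and span: "\<And>f. f \<in> homset \<I> X \<Longrightarrow> \<exists>c\<in>carrier (base C). f = scale c u"
  shows "PB \<I> \<bullet> E X = COEVT \<I>"
proof -
  obtain n l P Q where l: "\<And>k. k < n \<Longrightarrow> l k \<in> \<Lambda>" and d: "dsum {..<n::nat} l X P Q"
    by (rule decomposition[of X]) blast
  note u' [simp] = homsetD[OF u(1)]
  have "\<exists>k\<in>{..<n}. l k = \<I>"
  proof (rule ccontr)
    assume "\<not> (\<exists>k\<in>{..<n}. l k = \<I>)"
    then have "P k \<bullet> u = Zero \<I> (l k)" if "k \<in> {..<n}" for k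
      using schur_zero[OF unit_in l[of k], of "P k \<bullet> u"] that homsetD[OF dsumD(2)[OF d that]]
      by (force simp: homset_def)
    then have "u = Zero \<I> X"
      using homsetD[OF dsumD(2)[OF d]] by (intro dsum_mono[OF d u(1)]) (simp_all add: homset_def)
    with u(2) show False by simp
  qed
  then obtain k where k: "k \<in> {..<n}" "l k = \<I>" by blast
  have uniq: "l i \<noteq> \<I>" if i: "i \<in> {..<n}" "i \<noteq> k" for i
  proof
    assume li: "l i = \<I>"
    note Pk [simp] = homsetD[OF dsumD(2)[OF d k(1)]]
    obtain c where c: "c \<in> carrier (base C)" "Q i = scale c u"
      using span dsumD(3)[OF d i(1)] li by auto
    obtain b where b: "b \<in> carrier (base C)" "Q k = scale b u"
      using span dsumD(3)[OF d k(1)] k(2) by auto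
    have 1: "scale b (P k \<bullet> u) = Id \<I>" using dsumD(4)[OF d k(1)] b k(2) by simp
    have 2: "scale c (P k \<bullet> u) = Zero \<I> \<I>" using dsumD(5)[OF d k(1) i(1)] i(2) c k(2) li by simp
    have "P k \<bullet> u \<noteq> Zero \<I> \<I>" using 1 b(1) Id_rep_nonzero[OF unit_in] by auto
    then have "c = \<zero>\<^bsub>base C\<^esub>"
      using 2 c(1) k(2) by (intro scale_cancel_scalar[of "P k \<bullet> u"]) simp_all
    then have "Q i = Zero \<I> X" using c by simp
    then have "Id \<I> = Zero \<I> \<I>"
      using dsumD(4)[OF d i(1)] homsetD[OF dsumD(2)[OF d i(1)]] li by simp
    then show False using Id_rep_nonzero[OF unit_in] by simp
  qed
  have "PB \<I> \<bullet> E X = Sum \<I> \<I> (\<lambda>k. PB \<I> \<bullet> E (l k)) {..<n}"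
    unfolding E_dsum[OF d] using unit_in by (subst comp_Sum) (auto simp: homset_def)
  also have "\<dots> = PB \<I> \<bullet> E (l k)"
  proof (rule Sum_single[OF _ k(1)])
    show "PB \<I> \<bullet> E (l k) \<in> homset \<I> \<I>" using unit_in by (simp add: homset_def)
    show "PB \<I> \<bullet> E (l i) = Zero \<I> \<I>" if "i \<in> {..<n}" "i \<noteq> k" for i
      using PB_E[OF unit_in l[of i]] uniq[OF that] that by auto
  qed simp
  also have "\<dots> = COEVT \<I>" using PB_E[OF unit_in unit_in] k(2) by simp
  finally show ?thesis .
qed

text \<open>
  By the transposition \<open>Hom(\<I>, m \<otimes> l) \<simeq> Hom(l\<^sup>\<star>, m)\<close> and Schur's lemma.
\<close>

lemma PB_unit_E_tensor:
  assumes l: "l \<in> \<Lambda>" and m: "m \<in> \<Lambda>"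
  shows "PB \<I> \<bullet> E (m \<otimes>\<^sub>o l) = (if m = vee C \<Lambda> l then COEVT \<I> else Zero \<I> \<I>)"
proof -
  let ?v = "vee C \<Lambda> l"
  obtain w w' where w: "w \<in> homset ?v (l\<^sup>\<star>)" "w' \<in> homset (l\<^sup>\<star>) ?v" "w' \<bullet> w = Id ?v" "w \<bullet> w' = Id (l\<^sup>\<star>)"
    using vee(2)[OF l] by (rule isomorphicE)
  note [simp] = homsetD[OF w(1)] homsetD[OF w(2)]
  show ?thesis
  proof (cases "m = ?v")
    case False
    have "f = Zero \<I> (m \<otimes>\<^sub>o l)" if f: "f \<in> homset \<I> (m \<otimes>\<^sub>o l)" for f
    proof -
      obtain g where g: "g \<in> homset (l\<^sup>\<star>) m" "f = (g \<lhd> l) \<bullet> COEVT l"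
        using unit_transpose[OF f] by blast
      note [simp] = homsetD[OF g(1)]
      have "g \<bullet> w = Zero ?v m"
        using schur_zero[OF vee(1)[OF l] m] False by (simp add: homset_def)
      then have "g \<bullet> w \<bullet> w' = Zero (l\<^sup>\<star>) m" using reassoc[of g w] by simp
      then have "g = Zero (l\<^sup>\<star>) m" using w(4) by simp
      then show ?thesis using g(2) by simp
    qed
    with False show ?thesis by (simp add: PB_unit_E_zero)
  next
    case True
    let ?u = "(w' \<lhd> l) \<bullet> COEVT l"
    have "PB \<I> \<bullet> E (?v \<otimes>\<^sub>o l) = COEVT \<I>"
    proof (rule PB_unit_E_line)
      show "?u \<in> homset \<I> (?v \<otimes>\<^sub>o l)" by (simp add: homset_def)
      show "?u \<noteq> Zero \<I> (?v \<otimes>\<^sub>o l)"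
      proof
        assume "?u = Zero \<I> (?v \<otimes>\<^sub>o l)"
        then have "w' = Zero (l\<^sup>\<star>) ?v" using transpose_inject w(2) by blast
        then have "Id ?v = Zero ?v ?v" using w(3) by simp
        then show False using Id_rep_nonzero vee(1)[OF l] by blast
      qed
      fix f assume f: "f \<in> homset \<I> (?v \<otimes>\<^sub>o l)"
      obtain g where g: "g \<in> homset (l\<^sup>\<star>) ?v" "f = (g \<lhd> l) \<bullet> COEVT l"
        using unit_transpose[OF f] by blast
      note [simp] = homsetD[OF g(1)]
      obtain c where c: "c \<in> carrier (base C)" "g \<bullet> w = scale c (Id ?v)"
        using schur_scalar[OF vee(1)[OF l], of "g \<bullet> w"] by (auto simp: homset_def)
      have "g = (g \<bullet> w) \<bullet> w'" using w(4) by simp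
      also have "\<dots> = scale c w'" unfolding c(2) using c(1) by simp
      finally have "f = scale c ?u" using g(2) c(1) by simp
      with c(1) show "\<exists>c\<in>carrier (base C). f = scale c ?u" by blast
    qed
    with True show ?thesis by simp
  qed
qed

text \<open>
  A nonzero \<open>f : \<I> \<rightarrow> X\<close> has a nonzero component in some summand isomorphic to \<open>\<I>\<close>, hence a left inverse \<open>g\<close>,
  and \<open>tr\<^sub>q(g f) = dim\<^sub>q(\<I>) = 1\<close>.
\<close>

lemma negligible_from_unit_zero:
  assumes n: "negligible C \<I> X f"
  shows "f = \<zero>\<^bsub>Hom C \<I> X\<^esub>"
proof (rule ccontr)
  assume nz: "f \<noteq> \<zero>\<^bsub>Hom C \<I> X\<^esub>"
  have f: "f \<in> carrier (Hom C \<I> X)" using n by (simp add: negligible_def)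
  let ?f = "arrow \<I> f X"
  obtain n' l P Q where l: "\<And>k. k < n' \<Longrightarrow> l k \<in> \<Lambda>" and d: "dsum {..<n'::nat} l X P Q"
    by (rule decomposition[of X]) blast
  have "?f \<noteq> Zero \<I> X" using nz f by (simp add: Zero_def arrow_eq_iff)
  then obtain k where k: "k \<in> {..<n'}" "P k \<bullet> ?f \<noteq> P k \<bullet> Zero \<I> X"
    using dsum_mono[OF d, of ?f \<I> "Zero \<I> X"] f by (auto simp: homset_def)
  note [simp] = homsetD[OF dsumD(2)[OF d k(1)]]
  have nz': "P k \<bullet> ?f \<noteq> Zero \<I> (l k)" using k(2) by simp
  have lk: "l k = \<I>"
  proof (rule ccontr)
    assume "l k \<noteq> \<I>"
    then have "\<I> \<noteq> l k" by (rule not_sym)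
    then have "P k \<bullet> ?f = Zero \<I> (l k)"
      using k(1) f by (intro schur_zero[OF unit_in l]) (simp_all add: homset_def)
    with nz' show False by contradiction
  qed
  obtain c where c: "c \<in> carrier (base C)" "P k \<bullet> ?f = scale c (Id \<I>)"
    using schur_scalar[OF unit_in, of "P k \<bullet> ?f"] lk f by (auto simp: homset_def)
  have "c \<noteq> \<zero>\<^bsub>base C\<^esub>" using c nz' lk by auto
  interpret K: field "base C" by (rule base_field)
  have cU: "c \<in> Units (base C)" using c \<open>c \<noteq> \<zero>\<^bsub>base C\<^esub>\<close> K.field_Units by simp
  let ?g = "scale (inv\<^bsub>base C\<^esub> c) (P k)"
  have "?g \<bullet> ?f = Id \<I>" using cU c f by (simp add: scale_scale)
  then have "raw ?g \<cdot> f = \<i>\<d> \<I>"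
    using f cU lk by (metis raw_comp raw_Id raw_arrow arr_arrow arr_comp arr_Id src_tgt(1,2,5,6))
  moreover have "raw ?g \<in> carrier (Hom C X \<I>)"
    using cU lk raw_in_Hom[of ?g] by simp
  ultimately have "tr_q C \<I> (\<i>\<d> \<I>) = \<zero>\<^bsub>base C\<^esub>" using n unfolding negligible_def by metis
  then show False using dim_q_unit by (simp add: dim_q_def)
qed

end

section \<open>Elements invariant under the antipode and the handle slide\<close>

text \<open>
  \<open>Gamma_A\<close> is the equation \<open>\<Gamma>\<^sub>l(\<alpha> \<otimes> \<alpha>) = \<alpha> \<otimes> \<alpha>\<close>, with \<open>\<alpha> \<otimes> \<alpha> : \<I> \<rightarrow> B \<otimes> B\<close> written as \<open>(A \<lhd> B) \<bullet> A\<close>.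
\<close>

locale invariant_element = semisimple_ribbon_category C \<Lambda> B p q
  for C :: "('o, 'm, 'k, 'z) ribbon_cat_scheme" (structure) and \<Lambda> B p q +
  fixes a :: "'o \<Rightarrow> 'k" and A :: "('o, 'm) arrow"
  assumes a_in: "l \<in> \<Lambda> \<Longrightarrow> a l \<in> carrier (base C)"
    and A_eq: "A = Sum \<I> B (\<lambda>l. scale (a l) (E l)) \<Lambda>"
    and ANTI_A: "ANTI \<bullet> A = A"
    and Gamma_A: "(B \<rhd> MULT) \<bullet> (COM \<lhd> B) \<bullet> (A \<lhd> B) \<bullet> A = (A \<lhd> B) \<bullet> A"
begin

lemma aE_homset: "l \<in> \<Lambda> \<Longrightarrow> scale (a l) (E l) \<in> homset \<I> B"
  using a_in by (simp add: homset_def)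

lemma A_arr [simp]: "arr A" "src A = \<I>" "tgt A = B"
  unfolding A_eq using aE_homset by simp_all

lemma comp_A:
  assumes "arr h" "src h = B"
  shows "h \<bullet> A = Sum \<I> (tgt h) (\<lambda>l. scale (a l) (h \<bullet> E l)) \<Lambda>"
proof -
  have "h \<bullet> A = Sum \<I> (tgt h) (\<lambda>l. h \<bullet> scale (a l) (E l)) \<Lambda>"
    unfolding A_eq using assms aE_homset by (intro comp_Sum)
  also have "\<dots> = Sum \<I> (tgt h) (\<lambda>l. scale (a l) (h \<bullet> E l)) \<Lambda>"
    using assms a_in by (intro Sum_cong) (simp_all add: homset_def)
  finally show ?thesis .
qed

lemma comp_A_single:
  assumes h: "arr h" "src h = B" and l: "l \<in> \<Lambda>"
    and z: "\<And>k. k \<in> \<Lambda> \<Longrightarrow> k \<noteq> l \<Longrightarrow> h \<bullet> E k = Zero \<I> (tgt h)"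
  shows "h \<bullet> A = scale (a l) (h \<bullet> E l)"
  unfolding comp_A[OF h]
  using finite_reps l z a_in h by (intro Sum_single) (simp_all add: homset_def)

lemma PB_A: "l \<in> \<Lambda> \<Longrightarrow> PB l \<bullet> A = scale (a l) (COEVT l)"
  using comp_A_single[of "PB l" l] PB_E by simp

text \<open>
  Coefficient of \<open>e\<close> at \<open>l\<^sup>\<or>\<close> in \<open>S \<alpha> = \<alpha>\<close>; injectivity of \<open>\<or>\<close> isolates the contribution of \<open>l\<close>.
\<close>

lemma a_vee:
  assumes l: "l \<in> \<Lambda>"
  shows "a (vee C \<Lambda> l) = a l"
proof -
  let ?v = "vee C \<Lambda> l"
  have e: "(PB ?v \<bullet> ANTI) \<bullet> E k = PB ?v \<bullet> E (vee C \<Lambda> k)" if "k \<in> \<Lambda>" for k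
    using that by (simp add: ANTI_E E_vee)
  have "PB ?v \<bullet> A = (PB ?v \<bullet> ANTI) \<bullet> A" by (simp add: ANTI_A)
  also have "\<dots> = scale (a l) ((PB ?v \<bullet> ANTI) \<bullet> E l)"
  proof (rule comp_A_single[OF _ _ l])
    show "arr (PB ?v \<bullet> ANTI)" "src (PB ?v \<bullet> ANTI) = B" using vee(1)[OF l] by simp_all
    show "(PB ?v \<bullet> ANTI) \<bullet> E k = Zero \<I> (tgt (PB ?v \<bullet> ANTI))" if k: "k \<in> \<Lambda>" "k \<noteq> l" for k
      unfolding e[OF k(1)] using PB_E[OF vee(1)[OF l] vee(1)[OF k(1)]] vee_inj[OF k(1) l] k(2) by auto
  qed
  also have "\<dots> = scale (a l) (COEVT ?v)"
    unfolding e[OF l] using PB_E[OF vee(1)[OF l] vee(1)[OF l]] by simp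
  finally have "scale (a ?v) (COEVT ?v) = scale (a l) (COEVT ?v)" using PB_A vee(1)[OF l] by simp
  then show ?thesis
    using COEVT_rep_nonzero vee(1)[OF l] a_in l by (intro scale_cancel_scalar[of "COEVT ?v"]) simp_all
qed

text \<open>
  The component at \<open>l\<^sup>\<star> \<otimes> l\<close> of the handle slide equation is
  \<open>a\<^sub>l (id \<otimes> id \<otimes> w) (id \<otimes> coev\<^sub>l \<otimes> id) coevt\<^sub>l = a\<^sub>l (id \<otimes> id \<otimes> \<alpha>) coevt\<^sub>l\<close> with \<open>w = m (j\<^sub>l \<otimes> \<alpha>)\<close>, since the comultiplication
  maps the summand \<open>l\<^sup>\<star> \<otimes> l\<close> into \<open>(l\<^sup>\<star> \<otimes> l) \<otimes> B\<close>.  After cancelling \<open>a\<^sub>l\<close>, \<open>coevt_inject\<close> bends the strand \<open>l\<^sup>\<star>\<close>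
  away, and \<open>ev\<^sub>l\<close> closes the remaining \<open>l\<close> to a zigzag.
\<close>

lemma MULT_J_A:
  assumes l: "l \<in> \<Lambda>" and nz: "a l \<noteq> \<zero>\<^bsub>base C\<^esub>"
  shows "MULT \<bullet> (J l \<lhd> B) \<bullet> ((l\<^sup>\<star> \<otimes>\<^sub>o l) \<rhd> A) = A \<bullet> EV l"
proof -
  let ?L = "l\<^sup>\<star> \<otimes>\<^sub>o l" and ?W = "MULT \<bullet> (J l \<lhd> B) \<bullet> ((l\<^sup>\<star> \<otimes>\<^sub>o l) \<rhd> A)"
  let ?c = "(?L \<rhd> J l) \<bullet> (l\<^sup>\<star> \<rhd> (COEV l \<lhd> l)) \<bullet> COEVT l"
  note al = a_in[OF l]
  \<comment> \<open>only the summand \<open>k = l\<close> of \<open>\<alpha>\<close> survives the projection, since \<open>p\<^sub>l j\<^sub>k = 0\<close> for \<open>k \<noteq> l\<close>\<close>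
  have PC: "((PB l \<lhd> B) \<bullet> COM) \<bullet> E k = (if k = l then ?c else Zero \<I> (?L \<otimes>\<^sub>o B))" if k: "k \<in> \<Lambda>" for k
  proof -
    have PJ: "(PB l \<lhd> B) \<bullet> (J k \<lhd> B) = (if k = l then Id (?L \<otimes>\<^sub>o B) else Zero (k\<^sup>\<star> \<otimes>\<^sub>o k \<otimes>\<^sub>o B) (?L \<otimes>\<^sub>o B))"
      using arg_cong[where f = "\<lambda>h. h \<lhd> B", OF dsumD(4)[OF dsum_B l]]
        arg_cong[where f = "\<lambda>h. h \<lhd> B", OF dsumD(5)[OF dsum_B l k]] l k
      by (auto simp: J_rep)
    have "((PB l \<lhd> B) \<bullet> COM) \<bullet> E k
        = ((PB l \<lhd> B) \<bullet> (J k \<lhd> B)) \<bullet> ((k\<^sup>\<star> \<otimes>\<^sub>o k) \<rhd> J k) \<bullet> (k\<^sup>\<star> \<rhd> (COEV k \<lhd> k)) \<bullet> COEVT k"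
      unfolding E_def comp_assoc reassoc[OF COM(4)] comult_family_def ..
    then show ?thesis unfolding PJ by auto
  qed
  have PCA: "((PB l \<lhd> B) \<bullet> COM) \<bullet> A = scale (a l) ?c"
    using comp_A_single[of "(PB l \<lhd> B) \<bullet> COM" l] PC l by simp
  have 1: "(PB l \<lhd> B) \<bullet> (B \<rhd> MULT) = (?L \<rhd> MULT) \<bullet> (PB l \<lhd> (B \<otimes>\<^sub>o B))"
    using exchange[of "PB l" MULT] l by simp
  have 2: "(PB l \<lhd> (B \<otimes>\<^sub>o B)) \<bullet> (COM \<lhd> B) \<bullet> (A \<lhd> B) = scale (a l) (?c \<lhd> B)"
    using arg_cong[OF PCA, of "\<lambda>h. h \<lhd> B"] l al by simp
  have 3: "(PB l \<lhd> B) \<bullet> (A \<lhd> B) = scale (a l) (COEVT l \<lhd> B)"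
    using arg_cong[OF PB_A[OF l], of "\<lambda>h. h \<lhd> B"] l al by simp
  have "(PB l \<lhd> B) \<bullet> (B \<rhd> MULT) \<bullet> (COM \<lhd> B) \<bullet> (A \<lhd> B) \<bullet> A = (PB l \<lhd> B) \<bullet> (A \<lhd> B) \<bullet> A"
    unfolding Gamma_A ..
  then have "(?L \<rhd> MULT) \<bullet> scale (a l) (?c \<lhd> B) \<bullet> A = scale (a l) (COEVT l \<lhd> B) \<bullet> A"
    unfolding reassoc[OF 1] comp_assoc reassoc3[OF 2] reassoc[OF 3] .
  \<comment> \<open>both sides now carry the scalar \<open>a\<^sub>l\<close>, which is cancelled next\<close>
  then have eq: "scale (a l) ((?L \<rhd> MULT) \<bullet> (?c \<lhd> B) \<bullet> A) = scale (a l) ((COEVT l \<lhd> B) \<bullet> A)"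
    using al by (simp del: rw_comp)
  have "(?L \<rhd> MULT) \<bullet> (?c \<lhd> B) \<bullet> A = (COEVT l \<lhd> B) \<bullet> A"
    by (rule scale_cancel_arrow[OF _ _ _ _ al nz eq]) simp_all
  moreover have 4: "(COEVT l \<lhd> B) \<bullet> A = (?L \<rhd> A) \<bullet> COEVT l"
    using exchange[of "COEVT l" A] by simp
  moreover have 5: "(l\<^sup>\<star> \<rhd> (COEV l \<lhd> (l \<otimes>\<^sub>o B))) \<bullet> (?L \<rhd> A) = ((l\<^sup>\<star> \<otimes>\<^sub>o l \<otimes>\<^sub>o l\<^sup>\<star> \<otimes>\<^sub>o l) \<rhd> A) \<bullet> (l\<^sup>\<star> \<rhd> (COEV l \<lhd> l))"
    using exchange_at[of "COEV l" A "l\<^sup>\<star>" l \<I>] by simp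
  ultimately have eqV: "(l\<^sup>\<star> \<rhd> ((l \<rhd> ?W) \<bullet> (COEV l \<lhd> l))) \<bullet> COEVT l = (l\<^sup>\<star> \<rhd> (l \<rhd> A)) \<bullet> COEVT l"
    by (simp add: reassoc[OF 5])
  have V: "(l \<rhd> ?W) \<bullet> (COEV l \<lhd> l) = l \<rhd> A"
    by (rule coevt_inject[OF _ _ eqV, of "l \<otimes>\<^sub>o B"]) (simp_all add: homset_def)
  have 6: "(EV l \<lhd> B) \<bullet> (?L \<rhd> ?W) = ?W \<bullet> (EV l \<lhd> ?L)"
    using exchange[of "EV l" ?W] by (simp del: lw_comp)
  have 7: "(EV l \<lhd> ?L) \<bullet> (l\<^sup>\<star> \<rhd> (COEV l \<lhd> l)) = Id ?L"
    using arg_cong[OF zigzag_dual_arrow[of l], of "\<lambda>h. h \<lhd> l"] by simp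
  have "?W = (EV l \<lhd> B) \<bullet> (l\<^sup>\<star> \<rhd> ((l \<rhd> ?W) \<bullet> (COEV l \<lhd> l)))"
  proof -
    have "(EV l \<lhd> B) \<bullet> (l\<^sup>\<star> \<rhd> ((l \<rhd> ?W) \<bullet> (COEV l \<lhd> l))) = ((EV l \<lhd> B) \<bullet> (?L \<rhd> ?W)) \<bullet> (l\<^sup>\<star> \<rhd> (COEV l \<lhd> l))"
      by simp
    also have "\<dots> = ?W" unfolding 6 by (simp add: 7)
    finally show ?thesis ..
  qed
  also have "\<dots> = (EV l \<lhd> B) \<bullet> (?L \<rhd> A)" unfolding V by simp
  also have "\<dots> = A \<bullet> EV l" using exchange[of "EV l" A] by simp
  finally show ?thesis .
qed

lemma MULT_E_A:
  assumes l: "l \<in> \<Lambda>" and nz: "a l \<noteq> \<zero>\<^bsub>base C\<^esub>"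
  shows "MULT \<bullet> (E l \<lhd> B) \<bullet> A = scale (dim_q C l) A"
proof -
  have 1: "(COEVT l \<lhd> B) \<bullet> A = ((l\<^sup>\<star> \<otimes>\<^sub>o l) \<rhd> A) \<bullet> COEVT l"
    using exchange[of "COEVT l" A] by simp
  have "MULT \<bullet> (E l \<lhd> B) \<bullet> A = (MULT \<bullet> (J l \<lhd> B) \<bullet> ((l\<^sup>\<star> \<otimes>\<^sub>o l) \<rhd> A)) \<bullet> COEVT l"
    by (simp add: E_def 1)
  also have "\<dots> = A \<bullet> (EV l \<bullet> COEVT l)" unfolding MULT_J_A[OF l nz] by simp
  also have "\<dots> = scale (dim_q C l) A"
    unfolding ev_coevt EVT_COEV_dim(2) using EVT_COEV_dim(1) by simp
  finally show ?thesis .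
qed

lemma MULT_E_A_Sum: "MULT \<bullet> (E l \<lhd> B) \<bullet> A = Sum \<I> B (\<lambda>m. scale (a m) (E (m \<otimes>\<^sub>o l))) \<Lambda>"
  using comp_A[of "MULT \<bullet> (E l \<lhd> B)"] by (simp add: MULT_E)

lemma MULT_A_E_Sum: "MULT \<bullet> (A \<lhd> B) \<bullet> E l = Sum \<I> B (\<lambda>m. scale (a m) (E (l \<otimes>\<^sub>o m))) \<Lambda>"
proof -
  have 1: "(A \<lhd> B) \<bullet> E l = (B \<rhd> E l) \<bullet> A" using exchange[of A "E l"] by simp
  have 2: "(B \<rhd> E l) \<bullet> E m = (E m \<lhd> B) \<bullet> E l" for m using exchange[of "E m" "E l"] by simp
  show ?thesis unfolding 1 using comp_A[of "MULT \<bullet> (B \<rhd> E l)"] by (simp add: 2 MULT_E)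
qed

lemma MULT_A_commute: "MULT \<bullet> (A \<lhd> B) \<bullet> E l = MULT \<bullet> (E l \<lhd> B) \<bullet> A"
proof -
  have "E (l \<otimes>\<^sub>o m) = E (m \<otimes>\<^sub>o l)" for m
    by (rule E_isomorphic, rule isomorphicI[of "BR l m" _ _ "BRi l m"]) (simp_all add: homset_def)
  then show ?thesis by (simp add: MULT_E_A_Sum MULT_A_E_Sum)
qed

text \<open>
  Apply the projection to the summand \<open>\<I>\<^sup>\<star> \<otimes> \<I>\<close> of \<open>B\<close> to \<open>m (e\<^sub>l \<otimes> \<alpha>) = dim\<^sub>q(l) \<alpha>\<close>.
\<close>

lemma a_eq:
  assumes l: "l \<in> \<Lambda>" and nz: "a l \<noteq> \<zero>\<^bsub>base C\<^esub>"
  shows "a l = dim_q C l \<otimes>\<^bsub>base C\<^esub> a \<I>"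
proof -
  let ?v = "vee C \<Lambda> l"
  have "PB \<I> \<bullet> MULT \<bullet> (E l \<lhd> B) \<bullet> A = scale (a ?v) (COEVT \<I>)"
    using comp_A_single[of "PB \<I> \<bullet> MULT \<bullet> (E l \<lhd> B)" ?v] vee(1)[OF l] unit_in PB_unit_E_tensor[OF l]
    by (simp add: MULT_E)
  moreover have "PB \<I> \<bullet> MULT \<bullet> (E l \<lhd> B) \<bullet> A = scale (dim_q C l \<otimes>\<^bsub>base C\<^esub> a \<I>) (COEVT \<I>)"
    unfolding MULT_E_A[OF l nz] using unit_in a_in[OF unit_in] EVT_COEV_dim(1)[of l]
    by (simp add: PB_A scale_scale)
  ultimately have "scale (a ?v) (COEVT \<I>) = scale (dim_q C l \<otimes>\<^bsub>base C\<^esub> a \<I>) (COEVT \<I>)" by simp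
  then have "a ?v = dim_q C l \<otimes>\<^bsub>base C\<^esub> a \<I>"
    using COEVT_rep_nonzero[OF unit_in] a_in[OF unit_in] a_in[OF vee(1)[OF l]] EVT_COEV_dim(1)[of l]
    by (intro scale_cancel_scalar[of "COEVT \<I>"]) simp_all
  then show ?thesis by (simp add: a_vee[OF l])
qed

lemma A_formula:
  "A = scale (a \<I>) (Sum \<I> B (\<lambda>l. scale (dim_q C l) (E l)) {l \<in> \<Lambda>. a l \<noteq> \<zero>\<^bsub>base C\<^esub>})"
proof -
  let ?L = "{l \<in> \<Lambda>. a l \<noteq> \<zero>\<^bsub>base C\<^esub>}"
  note d = EVT_COEV_dim(1) and aI = a_in[OF unit_in]
  have "A = Sum \<I> B (\<lambda>l. scale (a l) (E l)) ?L"
    unfolding A_eq using finite_reps aE_homset by (intro Sum_subset) auto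
  also have "\<dots> = Sum \<I> B (\<lambda>l. scale (a \<I>) (scale (dim_q C l) (E l))) ?L"
  proof (rule Sum_cong)
    fix l assume l: "l \<in> ?L"
    then show "scale (a l) (E l) \<in> homset \<I> B" using aE_homset by simp
    have "a l = a \<I> \<otimes>\<^bsub>base C\<^esub> dim_q C l" using a_eq[of l] l aI d by (simp add: Hom.R.m_comm)
    then show "scale (a l) (E l) = scale (a \<I>) (scale (dim_q C l) (E l))"
      using aI d by (simp add: scale_scale)
  qed
  also have "\<dots> = scale (a \<I>) (Sum \<I> B (\<lambda>l. scale (dim_q C l) (E l)) ?L)"
    using aI d by (intro scale_Sum[symmetric]) (simp_all add: homset_def)
  finally show ?thesis .
qed

text \<open>
  An injective self-map of a finite set is onto.
\<close>

lemma vee_support: "vee C \<Lambda> ` {l \<in> \<Lambda>. a l \<noteq> \<zero>\<^bsub>base C\<^esub>} = {l \<in> \<Lambda>. a l \<noteq> \<zero>\<^bsub>base C\<^esub>}"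
proof (rule endo_inj_surj)
  show "finite {l \<in> \<Lambda>. a l \<noteq> \<zero>\<^bsub>base C\<^esub>}" using finite_reps by simp
  show "vee C \<Lambda> ` {l \<in> \<Lambda>. a l \<noteq> \<zero>\<^bsub>base C\<^esub>} \<subseteq> {l \<in> \<Lambda>. a l \<noteq> \<zero>\<^bsub>base C\<^esub>}"
    using vee(1) a_vee by auto
  show "inj_on (vee C \<Lambda>) {l \<in> \<Lambda>. a l \<noteq> \<zero>\<^bsub>base C\<^esub>}" using vee_inj by (auto intro: inj_onI)
qed

end

context semisimple_ribbon_category
begin

lemma raw_E: "ss_basis C \<Lambda> B q l = raw (E l)"
  unfolding ss_basis_def raw_derived raw_J[symmetric] E_def by (simp add: raw_comp)

lemma raw_Sum_scale:
  assumes "\<And>l. l \<in> L \<Longrightarrow> c l \<in> carrier (base C)"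
  shows "(\<Oplus>\<^bsub>Hom C \<I> B\<^esub>l\<in>L. c l \<odot>\<^bsub>Hom C \<I> B\<^esub> ss_basis C \<Lambda> B q l)
    = raw (Sum \<I> B (\<lambda>l. scale (c l) (E l)) L)"
proof -
  have h: "scale (c l) (E l) \<in> homset \<I> B" if "l \<in> L" for l using assms[OF that] by (simp add: homset_def)
  have "raw (Sum \<I> B (\<lambda>l. scale (c l) (E l)) L) = (\<Oplus>\<^bsub>Hom C \<I> B\<^esub>l\<in>L. raw (scale (c l) (E l)))"
    by (rule raw_Sum) (rule h)
  also have "\<dots> = (\<Oplus>\<^bsub>Hom C \<I> B\<^esub>l\<in>L. c l \<odot>\<^bsub>Hom C \<I> B\<^esub> ss_basis C \<Lambda> B q l)"
  proof (rule Hom.M.finsum_cong')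
    show "raw (scale (c l) (E l)) = c l \<odot>\<^bsub>Hom C \<I> B\<^esub> ss_basis C \<Lambda> B q l" if "l \<in> L" for l
      using assms[OF that] by (simp add: raw_scale raw_E)
    show "(\<lambda>l. c l \<odot>\<^bsub>Hom C \<I> B\<^esub> ss_basis C \<Lambda> B q l) \<in> L \<rightarrow> carrier (Hom C \<I> B)"
      using assms raw_in_Hom[of "E _"] by (auto simp: raw_E)
  qed simp
  finally show ?thesis ..
qed

lemma raw_tensor_unit: "arr f \<Longrightarrow> arr g \<Longrightarrow> src f = \<I> \<Longrightarrow> src g = \<I> \<Longrightarrow> tgt g = Y \<Longrightarrow>
  raw f \<otimes>\<^sub>m raw g = raw ((f \<lhd> Y) \<bullet> g)"
  by (simp add: raw_tens[symmetric] tens_def)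

lemma I_set_invariant:
  assumes a: "\<And>l. l \<in> \<Lambda> \<Longrightarrow> a l \<in> carrier (base C)"
    and A: "A = Sum \<I> B (\<lambda>l. scale (a l) (E l)) \<Lambda>" and I: "raw A \<in> I_set C B j"
  shows "invariant_element C \<Lambda> B p q a A"
proof unfold_locales
  have A' [simp]: "arr A" "src A = \<I>" "tgt A = B"
    unfolding A using a by (simp_all add: homset_def)
  have minus: "x = y" if "x \<in> carrier (Hom C \<I> Z)" "y \<in> carrier (Hom C \<I> Z)" "negligible C \<I> Z (x \<ominus>\<^bsub>Hom C \<I> Z\<^esub> y)" for x y Z
    using negligible_from_unit_zero[OF that(3)] that(1,2)
      Hom.M.minus_equality[of \<I> Z x "\<ominus>\<^bsub>Hom C \<I> Z\<^esub> y"] by (simp add: a_minus_def)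
  have r: "coend_antipode C B j = raw ANTI" "coend_mult C B j = raw MULT" "coend_comult C B j = raw COM"
    using ANTI(1) MULT(1) COM(1) by (simp_all add: ANTI_def MULT_def COM_def)
  have "raw ANTI \<cdot> raw A = raw (ANTI \<bullet> A)" by (simp add: raw_comp)
  then have "raw (ANTI \<bullet> A) = raw A"
    using I raw_in_Hom[of "ANTI \<bullet> A"] raw_in_Hom[of A] unfolding I_set_def r by (intro minus[of _ B]) simp_all
  then show "ANTI \<bullet> A = A" by (intro arrow_eqI) simp_all
  let ?G = "(B \<rhd> MULT) \<bullet> (COM \<lhd> B) \<bullet> (A \<lhd> B) \<bullet> A" and ?T = "(A \<lhd> B) \<bullet> A"
  have "Gamma_l C B j \<cdot> (raw A \<otimes>\<^sub>m raw A) = raw ?G" "raw A \<otimes>\<^sub>m raw A = raw ?T"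
    unfolding Gamma_l_def r by (simp_all add: raw_tensor_unit raw_generators(1) raw_fold)
  then have "raw ?G = raw ?T"
    using I raw_in_Hom[of ?G] raw_in_Hom[of ?T] unfolding I_set_def by (intro minus[of _ "B \<otimes>\<^sub>o B"]) simp_all
  then show "?G = ?T" by (intro arrow_eqI) simp_all
qed (use a A in auto)

end

theorem lemma3p3:
  fixes C :: "('o, 'm, 'k) ribbon_cat" (structure)
    and \<Lambda> \<Lambda>\<^sub>\<alpha> :: "'o set" and B :: 'o and p q e j :: "'o \<Rightarrow> 'm"
    and \<alpha> :: 'm and a :: "'o \<Rightarrow> 'k"
  defines "j \<equiv> ss_coend_map C \<Lambda> B q"
    and "e \<equiv> ss_basis C \<Lambda> B q"
    and "\<Lambda>\<^sub>\<alpha> \<equiv> {l \<in> \<Lambda>. a l \<noteq> \<zero>\<^bsub>base C\<^esub>}"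
  assumes ribbon: "ribbon_linear_category C"
    and semisimple: "finitely_semisimple C"
    and simple_scalar: "\<And>X. simple_object C X \<Longrightarrow> scalar_object C X"
    and representatives: "simple_representatives C \<Lambda>"
    and unit_in: "\<I> \<in> \<Lambda>"
    and B_sum: "direct_sum C \<Lambda> (\<lambda>l. l\<^sup>\<star> \<otimes>\<^sub>o l) B p q"
    and a_in: "\<And>l. l \<in> \<Lambda> \<Longrightarrow> a l \<in> carrier (base C)"
    and \<alpha>_eq: "\<alpha> = (\<Oplus>\<^bsub>Hom C \<I> B\<^esub>l\<in>\<Lambda>. a l \<odot>\<^bsub>Hom C \<I> B\<^esub> e l)"
    and \<alpha>_in_I: "\<alpha> \<in> I_set C B j"
  shows "\<alpha> = a \<I> \<odot>\<^bsub>Hom C \<I> B\<^esub> (\<Oplus>\<^bsub>Hom C \<I> B\<^esub>l\<in>\<Lambda>\<^sub>\<alpha>. dim_q C l \<odot>\<^bsub>Hom C \<I> B\<^esub> e l)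
    \<and> vee C \<Lambda> ` \<Lambda>\<^sub>\<alpha> = \<Lambda>\<^sub>\<alpha>
    \<and> (\<forall>l\<in>\<Lambda>\<^sub>\<alpha>. coend_mult C B j \<cdot> (\<alpha> \<otimes>\<^sub>m e l) = dim_q C l \<odot>\<^bsub>Hom C \<I> B\<^esub> \<alpha>
        \<and> dim_q C l \<odot>\<^bsub>Hom C \<I> B\<^esub> \<alpha> = coend_mult C B j \<cdot> (e l \<otimes>\<^sub>m \<alpha>))"
proof -
  interpret ribbon_linear_category C by (rule ribbon)
  interpret S: semisimple_ribbon_category C \<Lambda> B p q
    by unfold_locales (use semisimple simple_scalar representatives unit_in B_sum in auto)
  define A where "A = Sum \<I> B (\<lambda>l. scale (a l) (S.E l)) \<Lambda>"
  have \<alpha>: "\<alpha> = raw A"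
    unfolding \<alpha>_eq e_def A_def using a_in by (rule S.raw_Sum_scale)
  interpret V: invariant_element C \<Lambda> B p q a A
    by (rule S.I_set_invariant[OF a_in A_def]) (use \<alpha>_in_I \<alpha> j_def in simp_all)
  have dim: "dim_q C l \<in> carrier (base C)" for l by (rule EVT_COEV_dim(1))
  have "(\<Oplus>\<^bsub>Hom C \<I> B\<^esub>l\<in>\<Lambda>\<^sub>\<alpha>. dim_q C l \<odot>\<^bsub>Hom C \<I> B\<^esub> e l)
      = raw (Sum \<I> B (\<lambda>l. scale (dim_q C l) (S.E l)) \<Lambda>\<^sub>\<alpha>)"
    unfolding e_def by (rule S.raw_Sum_scale) (rule dim)
  moreover have "arr (Sum \<I> B (\<lambda>l. scale (dim_q C l) (S.E l)) \<Lambda>\<^sub>\<alpha>)"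
    using dim by (simp add: homset_def)
  ultimately have 1: "\<alpha> = a \<I> \<odot>\<^bsub>Hom C \<I> B\<^esub> (\<Oplus>\<^bsub>Hom C \<I> B\<^esub>l\<in>\<Lambda>\<^sub>\<alpha>. dim_q C l \<odot>\<^bsub>Hom C \<I> B\<^esub> e l)"
    unfolding \<alpha> by (subst V.A_formula) (simp add: raw_scale a_in unit_in \<Lambda>\<^sub>\<alpha>_def)
  have m: "coend_mult C B j = raw S.MULT"
    using S.MULT(1) by (simp add: S.MULT_def j_def)
  have 2: "coend_mult C B j \<cdot> (\<alpha> \<otimes>\<^sub>m e l) = dim_q C l \<odot>\<^bsub>Hom C \<I> B\<^esub> \<alpha>"
    "dim_q C l \<odot>\<^bsub>Hom C \<I> B\<^esub> \<alpha> = coend_mult C B j \<cdot> (e l \<otimes>\<^sub>m \<alpha>)" if l: "l \<in> \<Lambda>\<^sub>\<alpha>" for l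
  proof -
    have s: "dim_q C l \<odot>\<^bsub>Hom C \<I> B\<^esub> \<alpha> = raw (scale (dim_q C l) A)"
      using dim by (simp add: \<alpha> raw_scale)
    have L: "raw (S.MULT \<bullet> (S.E l \<lhd> B) \<bullet> A) = dim_q C l \<odot>\<^bsub>Hom C \<I> B\<^esub> \<alpha>"
      unfolding s using l V.MULT_E_A[of l] by (simp add: \<Lambda>\<^sub>\<alpha>_def)
    have "coend_mult C B j \<cdot> (\<alpha> \<otimes>\<^sub>m e l) = raw (S.MULT \<bullet> (A \<lhd> B) \<bullet> S.E l)"
      unfolding m \<alpha> e_def S.raw_E by (simp add: S.raw_tensor_unit raw_comp)
    then show "coend_mult C B j \<cdot> (\<alpha> \<otimes>\<^sub>m e l) = dim_q C l \<odot>\<^bsub>Hom C \<I> B\<^esub> \<alpha>"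
      unfolding V.MULT_A_commute L .
    have "coend_mult C B j \<cdot> (e l \<otimes>\<^sub>m \<alpha>) = raw (S.MULT \<bullet> (S.E l \<lhd> B) \<bullet> A)"
      unfolding m \<alpha> e_def S.raw_E by (simp add: S.raw_tensor_unit raw_comp)
    then show "dim_q C l \<odot>\<^bsub>Hom C \<I> B\<^esub> \<alpha> = coend_mult C B j \<cdot> (e l \<otimes>\<^sub>m \<alpha>)"
      unfolding L by simp
  qed
  from 1 2 show ?thesis using V.vee_support unfolding \<Lambda>\<^sub>\<alpha>_def by blast
qed

end
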